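(* Let $1<p<\infty$, let $X$ be a complete, doubling metric measure space supporting a $(1,p)$-Poincaré inequality, and let $\Omega\subsetneq X$ be an open set. Suppose that for some exponent $1\le q<p$ there are constants $C>0$ and $L\ge1$ such that $$\mathscr{H}^{q}_{\delta_\Omega(x)}\bigl(\partial\Omega\cap\overline B(x,2L\delta_\Omega(x))\bigr)\ge C\,\delta_\Omega(x)^{-q}\mu\bigl(\overline B(x,\delta_\Omega(x))\bigr)$$ for all $x\in\Omega$. Then $\Omega$ admits the pointwise $p$-Hardy inequality with distance to the boundary, possibly with a different dilatation constant: there exist constants $c_H>0$ and $L'\ge1$ such that for all $u\in N_0^{1,p}(\Omega)$ $$|u(x)|\le c_H\,\delta_\Omega(x)\bigl(\mathcal{M}_{L'\delta_\Omega(x)}g_u^p(x)\bigr)^{1/p}$$ holds at almost every $x\in\Omega$.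
   Context: $X=(X,d,\mu)$ is a complete metric space with a Borel regular outer measure $\mu$ such that $0<\mu(B)<\infty$ for all balls $B=B(x,r)=\{y:d(x,y)<r\}$; $tB=B(x,tr)$, and $\overline B$ is the corresponding closed ball. $\mu$ is doubling: $\mu(2B)\le c_D\,\mu(B)$ for all balls $B$, with a constant $c_D\ge1$. For a ball $B$, $u_B=\frac1{\mu(B)}\int_B u\,d\mu$. A curve is a nonconstant, rectifiable, continuous mapping from a compact interval to $X$. The $p$-modulus of a curve family $\Gamma$ is $\inf\int_X\rho^p\,d\mu$ over Borel $\rho\ge0$ with $\int_\gamma\rho\,ds\ge1$ for all $\gamma\in\Gamma$. A measurable $g\ge0$ is a $p$-weak upper gradient of $u$ if, for all curves $\gamma$ (with endpoints $x,y$) outside a family of zero $p$-modulus, $|u(x)-u(y)|\le\int_\gamma g\,ds$ whenever $u(x),u(y)$ are both finite, and $\int_\gamma g\,ds=\infty$ otherwise. $g_u$ denotes a $p$-weak upper gradient of $u$; inequalities involving $g_u$ are meant for every $p$-weak upper gradient of $u$. $X$ supports a (weak) $(1,p)$-Poincaré inequality: there are $c_P>0$, $\tau\ge1$ such that for all balls $B$ of radius $r$, all locally integrable $u$ and all $p$-weak upper gradients $g_u$ of $u$, $\frac1{\mu(B)}\int_B|u-u_B|\,d\mu\le c_P\,r\bigl(\frac1{\mu(\tau B)}\int_{\tau B}g_u^p\,d\mu\bigr)^{1/p}$. $N^{1,p}(X)$ is the space of $u\in L^p(X)$ having a $p$-weak upper gradient in $L^p(X)$. $N_0^{1,p}(\Omega)=\{u|_\Omega:u\in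 N^{1,p}(X),\ u=0\text{ in }X\setminus\Omega\}$; functions in it are regarded as extended by zero to $X$. $\delta_\Omega(x)=d(x,\partial\Omega)$ for $x\in\Omega$. $\mathcal{M}_R f(x)=\sup_{0<r\le R}\frac1{\mu(B(x,r))}\int_{B(x,r)}|f|\,d\mu$. The Hausdorff content of codimension $t$ of $E\subset X$ is $\mathscr{H}^t_R(E)=\inf\bigl\{\sum_{i\in I}\mu(B(x_i,r_i))\,r_i^{-t}: E\subset\bigcup_{i\in I}B(x_i,r_i),\ r_i\le R\bigr\}$, over countable (possibly finite) covers by balls. *)

theory Defs
  imports "HOL-Analysis.Analysis"
begin

definition borel_regular_outer_measure :: "('a::topological_space set \<Rightarrow> ennreal) \<Rightarrow> bool" where
  "borel_regular_outer_measure \<mu> \<longleftrightarrow>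
     outer_measure_space UNIV \<mu> \<and>
     sets borel \<subseteq> lambda_system UNIV UNIV \<mu> \<and>
     (\<forall>A. \<exists>B\<in>sets borel. A \<subseteq> B \<and> \<mu> A = \<mu> B)"

text \<open>The measure space of all Caratheodory-measurable sets. Measurability, integrals and
  ``almost everywhere'' always refer to this (complete) measure.\<close>

definition carath :: "('a set \<Rightarrow> ennreal) \<Rightarrow> 'a measure" where
  "carath \<mu> = measure_of UNIV (lambda_system UNIV UNIV \<mu>) \<mu>"

lemma carath_outer_measure:
  assumes "outer_measure_space UNIV \<mu>"
  shows space_carath: "space (carath \<mu>) = UNIV"
    and sets_carath: "sets (carath \<mu>) = lambda_system UNIV UNIV \<mu>"
    and emeasure_carath: "A \<in> lambda_system UNIV UNIV \<mu> \<Longrightarrow> emeasure (carath \<mu>) A = \<mu> A"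
proof -
  interpret sigma_algebra UNIV "UNIV :: 'a set set"
    using sigma_algebra_Pow[of "UNIV :: 'a set"] by simp
  have ms: "measure_space UNIV (lambda_system UNIV UNIV \<mu>) \<mu>"
    by (rule caratheodory_lemma[OF assms])
  then interpret l: sigma_algebra UNIV "lambda_system UNIV UNIV \<mu>"
    by (simp add: measure_space_def)
  show "space (carath \<mu>) = UNIV" "sets (carath \<mu>) = lambda_system UNIV UNIV \<mu>"
    by (simp_all add: carath_def)
  show "emeasure (carath \<mu>) A = \<mu> A" if "A \<in> lambda_system UNIV UNIV \<mu>"
    using ms that by (simp add: carath_def measure_space_def emeasure_measure_of_sigma)
qed

definition balls_positive_finite :: "('a::metric_space set \<Rightarrow> ennreal) \<Rightarrow> bool" where
  "balls_positive_finite \<mu> \<longleftrightarrow> (\<forall>x r. 0 < r \<longrightarrow> 0 < \<mu> (ball x r) \<and> \<mu> (ball x r) < top)"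

definition doubling :: "('a::metric_space set \<Rightarrow> ennreal) \<Rightarrow> bool" where
  "doubling \<mu> \<longleftrightarrow>
     (\<exists>c\<^sub>D::real. 1 \<le> c\<^sub>D \<and> (\<forall>x r. 0 < r \<longrightarrow> \<mu> (ball x (2 * r)) \<le> ennreal c\<^sub>D * \<mu> (ball x r)))"

text \<open>Real powers of extended nonnegative numbers, used only for exponents \<open>p > 0\<close>.\<close>

definition ennpowr :: "ennreal \<Rightarrow> real \<Rightarrow> ennreal" where
  "ennpowr x p = (if x = top then top else ennreal (enn2real x powr p))"

definition mean :: "('a set \<Rightarrow> ennreal) \<Rightarrow> 'a set \<Rightarrow> ('a \<Rightarrow> ennreal) \<Rightarrow> ennreal" where
  "mean \<mu> B f = (\<integral>\<^sup>+y\<in>B. f y \<partial>carath \<mu>) / \<mu> B"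

text \<open>A triple \<open>(a, b, \<gamma>)\<close> stands for the curve obtained by restricting \<open>\<gamma>\<close> to the
  interval \<open>[a, b]\<close>.\<close>

type_synonym 'a curve = "real \<times> real \<times> (real \<Rightarrow> 'a)"

definition curve_length :: "real \<Rightarrow> real \<Rightarrow> (real \<Rightarrow> 'a::metric_space) \<Rightarrow> ennreal" where
  "curve_length a b \<gamma> =
     (SUP (n, t) \<in> {(n::nat, t). (\<forall>i\<le>n. t i \<in> {a..b}) \<and> (\<forall>i<n. t i \<le> t (Suc i))}.
        \<Sum>i<n. ennreal (dist (\<gamma> (t i)) (\<gamma> (t (Suc i)))))"

definition curves :: "'a::metric_space curve set" where
  "curves = {(a, b, \<gamma>). a \<le> b \<and> continuous_on {a..b} \<gamma> \<and> curve_length a b \<gamma> < top \<and>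
     (\<exists>s\<in>{a..b}. \<exists>t\<in>{a..b}. \<gamma> s \<noteq> \<gamma> t)}"

text \<open>The arc-length parametrization on \<open>[0, curve_length a b \<gamma>]\<close>. The choice of \<open>t\<close> is
  immaterial, since \<open>\<gamma>\<close> is constant between any two admissible values of \<open>t\<close>.\<close>

definition arc_length_param :: "real \<Rightarrow> real \<Rightarrow> (real \<Rightarrow> 'a::metric_space) \<Rightarrow> real \<Rightarrow> 'a" where
  "arc_length_param a b \<gamma> s = \<gamma> (SOME t. t \<in> {a..b} \<and> curve_length a t \<gamma> = ennreal s)"

text \<open>The complete measure \<open>lebesgue\<close> is needed because \<open>\<rho>\<close> may be merely
  \<open>\<mu>\<close>-measurable. For a \<open>\<mu>\<close>-measurable \<open>\<rho>\<close> the integrand is measurable for all curves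
  outside a family of zero \<open>p\<close>-modulus.\<close>

definition curve_integral :: "('a::metric_space \<Rightarrow> ennreal) \<Rightarrow> 'a curve \<Rightarrow> ennreal" where
  "curve_integral \<rho> = (\<lambda>(a, b, \<gamma>).
     \<integral>\<^sup>+s\<in>{0..enn2real (curve_length a b \<gamma>)}. \<rho> (arc_length_param a b \<gamma> s) \<partial>lebesgue)"

definition modulus :: "('a::metric_space set \<Rightarrow> ennreal) \<Rightarrow> real \<Rightarrow> 'a curve set \<Rightarrow> ennreal" where
  "modulus \<mu> p \<Gamma> =
     (INF \<rho> \<in> {\<rho> \<in> borel_measurable borel. \<forall>c\<in>\<Gamma>. 1 \<le> curve_integral \<rho> c}.
        \<integral>\<^sup>+x. ennpowr (\<rho> x) p \<partial>carath \<mu>)"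

definition weak_upper_gradient ::
  "('a::metric_space set \<Rightarrow> ennreal) \<Rightarrow> real \<Rightarrow> ('a \<Rightarrow> ereal) \<Rightarrow> ('a \<Rightarrow> ennreal) \<Rightarrow> bool" where
  "weak_upper_gradient \<mu> p u g \<longleftrightarrow>
     g \<in> borel_measurable (carath \<mu>) \<and>
     (\<exists>\<Gamma>\<subseteq>curves. modulus \<mu> p \<Gamma> = 0 \<and>
       (\<forall>(a, b, \<gamma>) \<in> curves - \<Gamma>.
          if \<bar>u (\<gamma> a)\<bar> \<noteq> \<infinity> \<and> \<bar>u (\<gamma> b)\<bar> \<noteq> \<infinity>
          then \<bar>u (\<gamma> a) - u (\<gamma> b)\<bar> \<le> enn2ereal (curve_integral g (a, b, \<gamma>))
          else curve_integral g (a, b, \<gamma>) = top))"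

definition locally_integrable :: "('a::metric_space set \<Rightarrow> ennreal) \<Rightarrow> ('a \<Rightarrow> ereal) \<Rightarrow> bool" where
  "locally_integrable \<mu> u \<longleftrightarrow>
     u \<in> borel_measurable (carath \<mu>) \<and>
     (\<forall>x. \<exists>r>0. (\<integral>\<^sup>+y\<in>ball x r. e2ennreal \<bar>u y\<bar> \<partial>carath \<mu>) < top)"

text \<open>The average \<open>u\<^sub>B\<close>. An integrable \<open>u\<close> is finite almost everywhere, so passing to
  \<open>real_of_ereal\<close> does not change the integral.\<close>

definition average :: "('a set \<Rightarrow> ennreal) \<Rightarrow> 'a set \<Rightarrow> ('a \<Rightarrow> ereal) \<Rightarrow> real" where
  "average \<mu> B u = (LINT y:B|carath \<mu>. real_of_ereal (u y)) / enn2real (\<mu> B)"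

definition poincare :: "('a::metric_space set \<Rightarrow> ennreal) \<Rightarrow> real \<Rightarrow> bool" where
  "poincare \<mu> p \<longleftrightarrow>
     (\<exists>(c\<^sub>P::real) (\<tau>::real). 0 < c\<^sub>P \<and> 1 \<le> \<tau> \<and>
       (\<forall>x r u g. 0 < r \<longrightarrow> locally_integrable \<mu> u \<longrightarrow> weak_upper_gradient \<mu> p u g \<longrightarrow>
          mean \<mu> (ball x r) (\<lambda>y. e2ennreal \<bar>u y - ereal (average \<mu> (ball x r) u)\<bar>)
            \<le> ennreal (c\<^sub>P * r) * ennpowr (mean \<mu> (ball x (\<tau> * r)) (\<lambda>y. ennpowr (g y) p)) (1 / p)))"

definition newtonian :: "('a::metric_space set \<Rightarrow> ennreal) \<Rightarrow> real \<Rightarrow> ('a \<Rightarrow> ereal) set" where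
  "newtonian \<mu> p =
     {u \<in> borel_measurable (carath \<mu>).
        (\<integral>\<^sup>+x. ennpowr (e2ennreal \<bar>u x\<bar>) p \<partial>carath \<mu>) < top \<and>
        (\<exists>g. weak_upper_gradient \<mu> p u g \<and> (\<integral>\<^sup>+x. ennpowr (g x) p \<partial>carath \<mu>) < top)}"

text \<open>Functions in \<open>N\<^sub>0\<^sup>1\<^sup>,\<^sup>p(\<Omega>)\<close> are represented by their zero extensions to the whole
  space; the zero boundary values are required at every point outside \<open>\<Omega>\<close>.\<close>

definition newtonian_zero ::
  "('a::metric_space set \<Rightarrow> ennreal) \<Rightarrow> real \<Rightarrow> 'a set \<Rightarrow> ('a \<Rightarrow> ereal) set" where
  "newtonian_zero \<mu> p \<Omega> = {u \<in> newtonian \<mu> p. \<forall>x\<in>-\<Omega>. u x = 0}"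

definition boundary_dist :: "'a::metric_space set \<Rightarrow> 'a \<Rightarrow> real" where
  "boundary_dist \<Omega> x = infdist x (frontier \<Omega>)"

definition maximal_function ::
  "('a::metric_space set \<Rightarrow> ennreal) \<Rightarrow> real \<Rightarrow> ('a \<Rightarrow> ennreal) \<Rightarrow> 'a \<Rightarrow> ennreal" where
  "maximal_function \<mu> R f x = (SUP r\<in>{0<..R}. mean \<mu> (ball x r) f)"

definition hausdorff_content ::
  "('a::metric_space set \<Rightarrow> ennreal) \<Rightarrow> real \<Rightarrow> real \<Rightarrow> 'a set \<Rightarrow> ennreal" where
  "hausdorff_content \<mu> t R E =
     (INF (I, x, r) \<in> {(I::nat set, x, r). (\<forall>i\<in>I. 0 < r i \<and> r i \<le> R) \<and> E \<subseteq> (\<Union>i\<in>I. ball (x i) (r i))}.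
        \<Sum>\<^sub>\<infinity>i\<in>I. \<mu> (ball (x i) (r i)) * ennreal (r i powr (- t)))"

end

theory Submission
  imports Defs
begin

text \<open>
  If \<open>u\<close> vanishes outside \<open>\<Omega>\<close> and \<open>h\<close> is a lower semicontinuous function dominating both an upper
  gradient \<open>g\<close> of \<open>u\<close> and a function that detects the exceptional curves, then \<open>\<bar>u x\<bar>\<close> (truncated) is
  at most the \<open>h\<close>-length of any curve from \<open>x\<close> to the boundary. So a short curve has to be found.
  Let \<open>h\<^sub>j\<close> be Lipschitz functions increasing to \<open>h\<close>, and \<open>v\<^sub>j\<close> the \<open>h\<^sub>j\<close>-distance to the boundary, measured
  along chains of points with small steps. Then \<open>v\<^sub>j\<close> is continuous everywhere, is zero on the boundary
  and has upper gradient \<open>h\<^sub>j\<close>. For such functions no Lebesgue points or capacities are needed: if \<open>v\<^sub>j x\<close> is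
  large compared with the maximal function of \<open>h\<^sub>j\<^sup>p\<close> at \<open>x\<close>, then telescoping the Poincare inequality at each
  nearby boundary point gives a ball of large energy, and a Vitali cover by these balls contradicts
  the content condition (here \<open>q < p\<close> makes the geometric series converge). Hence \<open>v\<^sub>j x\<close> is bounded
  uniformly in \<open>j\<close>, and the chains converge to a curve by compactness. Finally, a
  Vitali--Caratheodory theorem and the weak-type maximal inequality allow \<open>h\<^sup>p\<close> to be replaced by
  \<open>g\<^sup>p\<close> (up to a constant) at almost every \<open>x\<close>.
\<close>

section \<open>Arc length and curve integrals\<close>

text \<open>The Poincare inequality needs a measurable function, and telescoping at a boundary point
  needs averages that converge at that very point. The infimum of \<open>h\<close>-lengths over
  curves promises neither. Chains repair both: a step of length at most \<open>e\<close> changes the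
  potential by at most \<open>max (k x) (k y) * dist x y\<close>, so the potential is locally
  Lipschitz, whether or not curves exist. The price is that a cheap chain is not a curve. It is
  therefore run with accumulated cost as time. Since \<open>h\<close> is kept above a positive
  constant, the speed is bounded independently of j, up to jumps. With \<open>h\<^sub>j\<close> at
  most j and steps at most \<open>1 / j\<^sup>2\<close>, one step costs at most 1/j, so the jumps
  vanish in the limit, and the limit curve has \<open>h\<close>-length at most the elapsed time. The
  constant survives because the estimate uses only means of \<open>h\<^sup>p\<close> over balls
  about x: neither the Lipschitz constant of \<open>h\<^sub>j\<close>, nor the step size, nor the
  truncation level enters it.\<close>

lemma curve_length_le:
  fixes \<gamma> :: "real \<Rightarrow> 'a::metric_space"
  assumes ab: "a \<le> b"
    and F: "\<And>s t. a \<le> s \<Longrightarrow> s \<le> t \<Longrightarrow> t \<le> b \<Longrightarrow> dist (\<gamma> s) (\<gamma> t) \<le> F t - F s"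
  shows "curve_length a b \<gamma> \<le> ennreal (F b - F a)"
  unfolding curve_length_def
proof (rule SUP_least, clarify)
  fix n :: nat and t :: "nat \<Rightarrow> real"
  assume t: "\<forall>i\<le>n. t i \<in> {a..b}" "\<forall>i<n. t i \<le> t (Suc i)"
  have mono: "F s \<le> F t'" if "a \<le> s" "s \<le> t'" "t' \<le> b" for s t'
    using F[OF that] zero_le_dist[of "\<gamma> s" "\<gamma> t'"] by linarith
  have "(\<Sum>i<n. dist (\<gamma> (t i)) (\<gamma> (t (Suc i)))) \<le> (\<Sum>i<n. F (t (Suc i)) - F (t i))"
    by (intro sum_mono F) (use t in auto)
  also have "\<dots> = F (t n) - F (t 0)"
    by (induction n) auto
  also have "\<dots> \<le> F b - F a"
    using mono[of "t n" b] mono[of a "t 0"] t(1) by force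
  finally show "(\<Sum>i<n. ennreal (dist (\<gamma> (t i)) (\<gamma> (t (Suc i))))) \<le> ennreal (F b - F a)"
    by (simp add: ennreal_leI)
qed

text \<open>Together with \<open>curve_length_le\<close> this is used in place of additivity of
  length: here the length grows at least as fast as distances, there it is minimal with this
  property.\<close>

lemma curve_length_add_dist:
  fixes \<gamma> :: "real \<Rightarrow> 'a::metric_space"
  assumes "a \<le> s" "s \<le> t"
  shows "curve_length a s \<gamma> + ennreal (dist (\<gamma> s) (\<gamma> t)) \<le> curve_length a t \<gamma>"
proof -
  let ?P = "\<lambda>s. {(n::nat, t). (\<forall>i\<le>n. t i \<in> {a..s}) \<and> (\<forall>i<n. t i \<le> t (Suc i))}"
  let ?S = "\<lambda>(n, t). \<Sum>i<n. ennreal (dist (\<gamma> (t i)) (\<gamma> (t (Suc i))))"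
  have ne: "?P s \<noteq> {}"
    using assms by (auto intro!: exI[of _ 0] exI[of _ "\<lambda>_. a"])
  have "curve_length a s \<gamma> + ennreal (dist (\<gamma> s) (\<gamma> t)) = (SUP x\<in>?P s. ?S x + ennreal (dist (\<gamma> s) (\<gamma> t)))"
    unfolding curve_length_def by (rule ennreal_SUP_add_left[symmetric]) (use ne in auto)
  also have "\<dots> \<le> curve_length a t \<gamma>"
  proof (rule SUP_least, clarify)
    fix n :: nat and q :: "nat \<Rightarrow> real"
    assume q: "\<forall>i\<le>n. q i \<in> {a..s}" "\<forall>i<n. q i \<le> q (Suc i)"
    \<comment> \<open>The point \<open>s\<close> is inserted before \<open>t\<close>; the extra
      segment from \<open>q n\<close> to \<open>s\<close> only increases the sum.\<close>
    define q' where "q' i = (if i \<le> n then q i else if i = Suc n then s else t)" for i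
    have mem: "(Suc (Suc n), q') \<in> ?P t"
      using q assms by (auto simp: q'_def less_Suc_eq)
    have "?S (n, q) + ennreal (dist (\<gamma> s) (\<gamma> t)) \<le> ?S (Suc (Suc n), q')"
      by (simp add: q'_def sum_nonneg flip: ennreal_plus)
    also have "\<dots> \<le> curve_length a t \<gamma>"
      unfolding curve_length_def by (rule SUP_upper[OF mem])
    finally show "(\<Sum>i<n. ennreal (dist (\<gamma> (q i)) (\<gamma> (q (Suc i))))) + ennreal (dist (\<gamma> s) (\<gamma> t)) \<le> curve_length a t \<gamma>"
      by simp
  qed
  finally show ?thesis .
qed

lemma curve_length_self: "curve_length a a \<gamma> = 0"
proof -
  have "curve_length a a \<gamma> \<le> ennreal (0 - 0)"
    by (rule curve_length_le) (auto dest: antisym)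
  then show ?thesis by simp
qed

section \<open>The length function and the arc-length parametrization\<close>

locale rectifiable =
  fixes a b :: real and \<gamma> :: "real \<Rightarrow> 'a::metric_space"
  assumes le: "a \<le> b" and cont: "continuous_on {a..b} \<gamma>" and rect: "curve_length a b \<gamma> < top"
begin

definition arc :: "real \<Rightarrow> real" where
  "arc t = enn2real (curve_length a t \<gamma>)"

abbreviation len where "len \<equiv> arc b"

abbreviation \<gamma>' where "\<gamma>' \<equiv> arc_length_param a b \<gamma>"

lemma curve_length_eq:
  assumes "a \<le> t" "t \<le> b"
  shows "curve_length a t \<gamma> = ennreal (arc t)"
proof -
  have "curve_length a t \<gamma> \<le> curve_length a b \<gamma>"
    by (rule order_trans[OF _ curve_length_add_dist[OF assms, of \<gamma>]]) simp
  then show ?thesis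
    unfolding arc_def using rect by (simp add: order.strict_trans1)
qed

lemma arc_nonneg: "0 \<le> arc t"
  by (simp add: arc_def)

lemma arc_a: "arc a = 0"
  by (simp add: arc_def curve_length_self)

lemma dist_le_arc:
  assumes "a \<le> s" "s \<le> t" "t \<le> b"
  shows "dist (\<gamma> s) (\<gamma> t) \<le> arc t - arc s"
proof -
  have "ennreal (arc s + dist (\<gamma> s) (\<gamma> t)) \<le> ennreal (arc t)"
    using curve_length_add_dist[of a s t \<gamma>] assms by (simp add: curve_length_eq arc_nonneg)
  then show ?thesis by (simp add: arc_nonneg del: ennreal_plus)
qed

lemma arc_mono: "a \<le> s \<Longrightarrow> s \<le> t \<Longrightarrow> t \<le> b \<Longrightarrow> arc s \<le> arc t"
  using dist_le_arc[of s t] zero_le_dist[of "\<gamma> s" "\<gamma> t"] by linarith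

text \<open>By \<open>dist_le_arc\<close> the increments of \<open>arc\<close> dominate distances;
  it is the least such function starting at 0. Upper bounds for \<open>arc\<close> below come from a
  suitable choice of \<open>F\<close>.\<close>

lemma arc_le:
  assumes "a \<le> t" "t \<le> b" 
    and "\<And>s s'. a \<le> s \<Longrightarrow> s \<le> s' \<Longrightarrow> s' \<le> t \<Longrightarrow> dist (\<gamma> s) (\<gamma> s') \<le> F s' - F s"
  shows "arc t \<le> F t - F a"
proof -
  have "F t - F a \<ge> 0"
    using assms(3)[of a t] assms zero_le_dist[of "\<gamma> a" "\<gamma> t"] by linarith
  then show ?thesis
    using curve_length_le[of a t \<gamma> F] assms by (simp add: curve_length_eq)
qed

text \<open>If \<open>arc\<close> skipped a value, removing the jump from \<open>arc\<close> would give an admissible \<open>F\<close> for \<open>arc_le\<close>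
  with a smaller increment.\<close>

lemma arc_surj:
  assumes "0 \<le> s" "s \<le> len"
  obtains t where "a \<le> t" "t \<le> b" "arc t = s"
proof (rule ccontr)
  assume "\<not> thesis"
  then have na: "arc t \<noteq> s" if "a \<le> t" "t \<le> b" for t
    using that \<open>\<And>t. a \<le> t \<Longrightarrow> t \<le> b \<Longrightarrow> arc t = s \<Longrightarrow> thesis\<close> by blast
  define A where "A = {t. a \<le> t \<and> t \<le> b \<and> arc t < s}"
  define t0 where "t0 = Sup A"
  have aA: "a \<in> A"
    using na[of a] assms le arc_a by (auto simp: A_def)
  have bA: "arc b > s"
    using na[of b] assms le by auto
  have bdd: "bdd_above A"
    by (auto simp: A_def intro!: bdd_aboveI[of _ b])
  have t0: "a \<le> t0" "t0 \<le> b"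
    using aA bdd by (auto simp: t0_def intro: cSup_upper) (auto simp: A_def intro!: cSup_least)
  have below: "arc t < s" if "a \<le> t" "t < t0" for t
  proof -
    obtain t' where "t' \<in> A" "t < t'"
      using less_cSupE[of t A] aA \<open>t < t0\<close> unfolding t0_def by blast
    then show ?thesis
      using arc_mono[of t t'] that by (auto simp: A_def)
  qed
  have above: "s < arc t" if "t0 < t" "t \<le> b" for t
  proof -
    have "t \<notin> A"
      using that bdd cSup_upper[of t A] unfolding t0_def by auto
    then show ?thesis using that t0 na[of t] by (auto simp: A_def)
  qed
  \<comment> \<open>\<open>J\<close> is at most the height of the jump at \<open>t0\<close>. The
    jump may lie on either side of \<open>t0\<close>, and \<open>hi\<close> decides to which side
    \<open>t0\<close> itself belongs.\<close>
  define J where "J = \<bar>s - arc t0\<bar>"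
  have J: "J > 0"
    using na[OF t0] by (simp add: J_def)
  define hi where "hi t \<longleftrightarrow> t0 < t \<or> (t = t0 \<and> s < arc t0)" for t
  define F where "F t = (if hi t then arc t - J else arc t)" for t
  have tend: "((\<lambda>t. dist (\<gamma> t0) (\<gamma> t)) \<longlongrightarrow> 0) (at t0 within {a..b})"
  proof -
    have "(\<gamma> \<longlongrightarrow> \<gamma> t0) (at t0 within {a..b})"
      using cont t0 by (auto simp: continuous_on_def)
    then show ?thesis
      using tendsto_dist[OF tendsto_const[of "\<gamma> t0"], of \<gamma>] by fastforce
  qed
  have F: "dist (\<gamma> x) (\<gamma> y) \<le> F y - F x" if xy: "a \<le> x" "x \<le> y" "y \<le> b" for x y
  proof (cases "hi x \<longleftrightarrow> hi y")
    case True
    then show ?thesis using dist_le_arc[OF xy] by (auto simp: F_def)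
  next
    case False
    then have h: "\<not> hi x" "hi y" using xy by (auto simp: hi_def)
    then have xt: "x \<le> t0" "t0 \<le> y" "x < y" using xy by (auto simp: hi_def not_less intro: le_neq_trans)
    have "dist (\<gamma> x) (\<gamma> y) \<le> arc y - J - arc x + e" if e: "e > 0" for e
    proof -
      obtain d where d: "d > 0" "\<And>t. t \<in> {a..b} \<Longrightarrow> \<bar>t - t0\<bar> < d \<Longrightarrow> dist (\<gamma> t0) (\<gamma> t) < e"
      proof -
        obtain d where "d > 0" "\<And>t. t \<in> {a..b} \<Longrightarrow> 0 < dist t t0 \<Longrightarrow> dist t t0 < d \<Longrightarrow> dist (\<gamma> t0) (\<gamma> t) < e"
          using tendstoD[OF tend e] unfolding eventually_at by (auto simp: dist_real_def)
        moreover have "dist (\<gamma> t0) (\<gamma> t) < e" if "t = t0" for t using that e by simp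
        ultimately show ?thesis
          using that[of d] by (metis dist_real_def zero_less_dist_iff)
      qed
      \<comment> \<open>The way from \<open>x\<close> to \<open>y\<close> is split at
        \<open>t0\<close> and at a nearby time across the jump. By continuity the short middle piece
        has length less than \<open>e\<close>, whereas \<open>arc\<close> rises by more than
        \<open>J\<close> over it.\<close>
      show ?thesis
      proof (cases "s < arc t0")
        case True
        then have "x < t0" using h xt by (auto simp: hi_def)
        define x' where "x' = max x (t0 - d/2)"
        have x': "x \<le> x'" "x' < t0" "\<bar>x' - t0\<bar> < d" "a \<le> x'" "x' \<le> b"
          using \<open>x < t0\<close> d(1) xy t0 by (auto simp: x'_def)
        have "dist (\<gamma> x) (\<gamma> y) \<le> dist (\<gamma> x) (\<gamma> x') + dist (\<gamma> t0) (\<gamma> x') + dist (\<gamma> t0) (\<gamma> y)"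
          by (smt (verit) dist_commute dist_triangle)
        moreover have "dist (\<gamma> x) (\<gamma> x') \<le> arc x' - arc x"
          by (rule dist_le_arc) (use x' xy in auto)
        moreover have "dist (\<gamma> t0) (\<gamma> y) \<le> arc y - arc t0"
          by (rule dist_le_arc) (use t0 xt xy in auto)
        moreover have "dist (\<gamma> t0) (\<gamma> x') < e" using d(2) x' by auto
        moreover have "arc x' < s" using below x' by auto
        ultimately show ?thesis using True by (simp add: J_def)
      next
        case False
        then have "arc t0 < s" using na[OF t0] by auto
        have "t0 < y" using False h by (auto simp: hi_def)
        define y' where "y' = min y (t0 + d/2)"
        have y': "y' \<le> y" "t0 < y'" "\<bar>y' - t0\<bar> < d" "a \<le> y'" "y' \<le> b"
          using \<open>t0 < y\<close> d(1) xy t0 by (auto simp: y'_def)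
        have "dist (\<gamma> x) (\<gamma> y) \<le> dist (\<gamma> x) (\<gamma> t0) + dist (\<gamma> t0) (\<gamma> y') + dist (\<gamma> y') (\<gamma> y)"
          by (smt (verit) dist_commute dist_triangle)
        moreover have "dist (\<gamma> y') (\<gamma> y) \<le> arc y - arc y'"
          by (rule dist_le_arc) (use y' xy in auto)
        moreover have "dist (\<gamma> x) (\<gamma> t0) \<le> arc t0 - arc x"
          by (rule dist_le_arc) (use t0 xt xy in auto)
        moreover have "dist (\<gamma> t0) (\<gamma> y') < e" using d(2) y' by auto
        moreover have "s < arc y'" using above y' by auto
        ultimately show ?thesis using \<open>arc t0 < s\<close> by (simp add: J_def)
      qed
    qed
    then show ?thesis using h by (auto simp: F_def intro: field_le_epsilon)
  qed
  have "hi b"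
    using t0 bA by (auto simp: hi_def less_le)
  moreover have "\<not> hi a"
    using t0 aA by (auto simp: hi_def A_def)
  ultimately have "arc b \<le> arc b - J"
    using arc_le[of b F] F le arc_a by (auto simp: F_def)
  then show False using J by simp
qed

lemma arc_length_param:
  assumes "0 \<le> s" "s \<le> len"
  obtains t where "a \<le> t" "t \<le> b" "arc t = s" "\<gamma>' s = \<gamma> t"
proof -
  obtain t where "a \<le> t" "t \<le> b" "arc t = s"
    using arc_surj[OF assms] .
  then have ex: "t \<in> {a..b} \<and> curve_length a t \<gamma> = ennreal s"
    by (simp add: curve_length_eq)
  define t' where "t' = (SOME t. t \<in> {a..b} \<and> curve_length a t \<gamma> = ennreal s)"
  have "t' \<in> {a..b} \<and> curve_length a t' \<gamma> = ennreal s"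
    unfolding t'_def by (rule someI, rule ex)
  then have "a \<le> t'" "t' \<le> b" "ennreal (arc t') = ennreal s"
    using curve_length_eq[of t'] by auto
  then have "a \<le> t'" "t' \<le> b" "arc t' = s"
    using assms arc_nonneg by auto
  then show ?thesis
    using that[of t'] by (simp add: arc_length_param_def t'_def)
qed

lemma arc_length_param_arc:
  assumes "a \<le> t" "t \<le> b"
  shows "\<gamma>' (arc t) = \<gamma> t"
proof -
  obtain t' where t': "a \<le> t'" "t' \<le> b" "arc t' = arc t" "\<gamma>' (arc t) = \<gamma> t'"
    using arc_length_param[of "arc t"] arc_nonneg arc_mono[of t b] assms by auto
  have "dist (\<gamma> t) (\<gamma> t') \<le> \<bar>arc t - arc t'\<bar>"
    using dist_le_arc[of t t'] dist_le_arc[of t' t] assms t'(1,2) dist_commute[of "\<gamma> t" "\<gamma> t'"]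
    by linarith
  then show ?thesis using t' by simp
qed

lemma arc_length_param_dist:
  assumes "0 \<le> s" "s \<le> len" "0 \<le> s'" "s' \<le> len"
  shows "dist (\<gamma>' s) (\<gamma>' s') \<le> \<bar>s - s'\<bar>"
proof -
  obtain t where t: "a \<le> t" "t \<le> b" "arc t = s" "\<gamma>' s = \<gamma> t"
    using arc_length_param[of s] assms by auto
  obtain t' where t': "a \<le> t'" "t' \<le> b" "arc t' = s'" "\<gamma>' s' = \<gamma> t'"
    using arc_length_param[of s'] assms by auto
  have "dist (\<gamma> t) (\<gamma> t') \<le> \<bar>arc t - arc t'\<bar>"
    using dist_le_arc[of t t'] dist_le_arc[of t' t] t(1,2) t'(1,2) dist_commute[of "\<gamma> t" "\<gamma> t'"]
    by linarith
  then show ?thesis by (simp only: t t')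
qed

lemma arc_length_param_continuous: "continuous_on {0..len} \<gamma>'"
proof (rule continuous_onI)
  fix s e :: real
  assume "s \<in> {0..len}" "0 < e"
  then show "\<exists>d>0. \<forall>s'\<in>{0..len}. dist s' s < d \<longrightarrow> dist (\<gamma>' s') (\<gamma>' s) \<le> e"
    by (intro exI[of _ e]) (auto simp: dist_real_def intro: order_trans[OF arc_length_param_dist])
qed

text \<open>For continuous integrands the curve integral becomes a Henstock-Kurzweil integral, which
  makes additivity over subintervals and comparison with Riemann sums available. The integrand is
  Borel, so integrating against the completion gives the same value.\<close>

lemma curve_integral_eq:
  fixes k :: "'a \<Rightarrow> real"
  assumes k: "continuous_on UNIV k" "\<And>x. 0 \<le> k x"
  shows "curve_integral (\<lambda>x. ennreal (k x)) (a, b, \<gamma>) = ennreal (integral {0..len} (\<lambda>s. k (\<gamma>' s)))"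
    and "(\<lambda>s. k (\<gamma>' s)) integrable_on {0..len}"
    and "continuous_on {0..len} (\<lambda>s. k (\<gamma>' s))"
proof -
  show c: "continuous_on {0..len} (\<lambda>s. k (\<gamma>' s))"
    by (rule continuous_on_compose2[OF k(1) arc_length_param_continuous]) auto
  then show i: "(\<lambda>s. k (\<gamma>' s)) integrable_on {0..len}"
    by (rule integrable_continuous_real)
  have "curve_integral (\<lambda>x. ennreal (k x)) (a, b, \<gamma>)
      = (\<integral>\<^sup>+s. ennreal (indicator {0..len} s * k (\<gamma>' s)) \<partial>lebesgue)"
    by (auto simp: curve_integral_def arc_def intro!: nn_integral_cong split: split_indicator)
  also have "\<dots> = (\<integral>\<^sup>+s. ennreal (indicator {0..len} s * k (\<gamma>' s)) \<partial>lborel)"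
    by (simp add: nn_integral_completion)
  also have "\<dots> = ennreal (integral {0..len} (\<lambda>s. k (\<gamma>' s)))"
    by (rule nn_integral_has_integral_lebesgue[OF _ integrable_integral[OF i]]) (use k in auto)
  finally show "curve_integral (\<lambda>x. ennreal (k x)) (a, b, \<gamma>) = ennreal (integral {0..len} (\<lambda>s. k (\<gamma>' s)))" .
qed

end

section \<open>Bounds for curve integrals of continuous functions\<close>

lemma continuous_on_abs_Lipschitz:
  fixes k :: "'a::metric_space \<Rightarrow> real"
  assumes m: "0 \<le> m" "\<And>x y. \<bar>k x - k y\<bar> \<le> m * dist x y"
  shows "continuous_on A k"
proof (rule continuous_onI)
  fix x :: 'a and e :: real assume e: "0 < e"
  have "dist (k y) (k x) \<le> e" if "dist y x < e / (m + 1)" for y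
  proof -
    have "\<bar>k y - k x\<bar> \<le> (m + 1) * dist y x"
      using m(2)[of y x] zero_le_dist[of y x] unfolding distrib_right by linarith
    also have "\<dots> \<le> e" using that m(1) by (simp add: field_simps)
    finally show ?thesis by (simp add: dist_real_def)
  qed
  then show "\<exists>d>0. \<forall>y\<in>A. dist y x < d \<longrightarrow> dist (k y) (k x) \<le> e"
    using e m(1) by (intro exI[of _ "e / (m + 1)"]) auto
qed

text \<open>Chain potentials change at the rate \<open>max (\<kappa> s) (\<kappa> t)\<close> only
  over short steps. By uniform continuity this maximum exceeds the values of \<open>\<kappa>\<close>
  within the step by at most \<open>\<epsilon>'\<close>, so the increments add up to at most the
  integral plus \<open>\<epsilon>' * l\<close>.\<close>

lemma abs_diff_le_integral:
  fixes F \<kappa> :: "real \<Rightarrow> real"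
  assumes l: "0 \<le> l" and c: "continuous_on {0..l} \<kappa>" and e: "0 < e"
    and F: "\<And>s t. 0 \<le> s \<Longrightarrow> s \<le> t \<Longrightarrow> t \<le> l \<Longrightarrow> t - s \<le> e \<Longrightarrow> \<bar>F t - F s\<bar> \<le> max (\<kappa> s) (\<kappa> t) * (t - s)"
  shows "\<bar>F l - F 0\<bar> \<le> integral {0..l} \<kappa>"
proof (rule field_le_epsilon)
  fix \<epsilon> :: real assume "0 < \<epsilon>"
  define \<epsilon>' where "\<epsilon>' = \<epsilon> / (l + 1)"
  have \<epsilon>': "0 < \<epsilon>'" "\<epsilon>' * l \<le> \<epsilon>"
    using \<open>0 < \<epsilon>\<close> l by (auto simp: \<epsilon>'_def field_simps)
  have "uniformly_continuous_on {0..l} \<kappa>"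
    by (rule compact_uniformly_continuous[OF c compact_Icc])
  then obtain d where d: "d > 0" "\<And>s t. s \<in> {0..l} \<Longrightarrow> t \<in> {0..l} \<Longrightarrow> \<bar>s - t\<bar> < d \<Longrightarrow> \<bar>\<kappa> s - \<kappa> t\<bar> < \<epsilon>'"
    unfolding uniformly_continuous_on_def dist_real_def using \<epsilon>'(1) by meson
  \<comment> \<open>Steps must be short for two reasons: \<open>d\<close> for the oscillation of
    \<open>\<kappa>\<close> and \<open>e\<close> for the slope hypothesis.\<close>
  obtain N :: nat where "l < real N * min d e"
    using ex_less_of_nat_mult[of "min d e" l] d(1) e by auto
  then have lN: "l < min d e * real N" by (simp only: mult.commute)
  then have "N > 0" using l by (auto intro!: gr0I)
  with lN have N: "N > 0" "l / N < min d e"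
    by (simp_all only: pos_divide_less_eq of_nat_0_less_iff)
  define \<sigma> where "\<sigma> i = real i * (l / N)" for i
  have step: "\<sigma> (Suc i) = \<sigma> i + l / N" for i
    by (simp only: \<sigma>_def of_nat_Suc distrib_right mult_1 add.commute)
  have \<sigma>0: "0 \<le> \<sigma> i" for i using l by (simp add: \<sigma>_def)
  have \<sigma>l: "\<sigma> i \<le> l" if "i \<le> N" for i
    using that l N(1) mult_right_mono[of "real i" "real N" l]
    by (simp add: \<sigma>_def pos_divide_le_eq mult.commute)
  have "\<bar>F (\<sigma> i) - F 0\<bar> \<le> integral {0..\<sigma> i} \<kappa> + \<epsilon>' * \<sigma> i" if "i \<le> N" for i
    using that
  proof (induction i)
    case 0
    then show ?case by (simp add: \<sigma>_def)
  next
    case (Suc i)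
    let ?s = "\<sigma> i" and ?t = "\<sigma> (Suc i)"
    have st: "0 \<le> ?s" "?s \<le> ?t" "?t \<le> l" "?t - ?s \<le> e" "?t - ?s < d"
      using \<sigma>0[of i] \<sigma>l[OF Suc.prems] Suc.prems N l unfolding step by auto
    have int: "\<kappa> integrable_on {0..?t}"
      by (rule integrable_continuous_real, rule continuous_on_subset[OF c]) (use st in auto)
    have int': "\<kappa> integrable_on {?s..?t}"
      by (rule integrable_continuous_real, rule continuous_on_subset[OF c]) (use st in auto)
    have "integral {?s..?t} (\<lambda>_. max (\<kappa> ?s) (\<kappa> ?t) - \<epsilon>') \<le> integral {?s..?t} \<kappa>"
    proof (rule integral_le[OF _ int'])
      fix x assume x: "x \<in> {?s..?t}"
      have "\<bar>\<kappa> ?s - \<kappa> x\<bar> < \<epsilon>'" "\<bar>\<kappa> ?t - \<kappa> x\<bar> < \<epsilon>'"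
        using x st by (auto intro!: d(2))
      then show "max (\<kappa> ?s) (\<kappa> ?t) - \<epsilon>' \<le> \<kappa> x" by auto
    qed auto
    then have "max (\<kappa> ?s) (\<kappa> ?t) * (?t - ?s) \<le> integral {?s..?t} \<kappa> + \<epsilon>' * (?t - ?s)"
      using st by (simp add: algebra_simps)
    moreover have "\<bar>F ?t - F ?s\<bar> \<le> max (\<kappa> ?s) (\<kappa> ?t) * (?t - ?s)"
      by (rule F) (use st in auto)
    moreover have "integral {0..?s} \<kappa> + integral {?s..?t} \<kappa> = integral {0..?t} \<kappa>"
      by (rule Henstock_Kurzweil_Integration.integral_combine[OF st(1,2) int])
    ultimately show ?case
      using Suc by (simp add: algebra_simps)
  qed
  from this[of N] have "\<bar>F l - F 0\<bar> \<le> integral {0..l} \<kappa> + \<epsilon>' * l"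
    using N by (simp add: \<sigma>_def)
  then show "\<bar>F l - F 0\<bar> \<le> integral {0..l} \<kappa> + \<epsilon>"
    using \<epsilon>' by linarith
qed

context rectifiable
begin

text \<open>The arc-length parametrization is 1-Lipschitz, so parameters at most \<open>e\<close>
  apart give points at most \<open>e\<close> apart. As the bound holds for every rectifiable curve,
  \<open>k\<close> is an upper gradient of \<open>v\<close> with empty exceptional family.\<close>

lemma curve_integral_ge:
  fixes k v :: "'a \<Rightarrow> real"
  assumes k: "continuous_on UNIV k" "\<And>x. 0 \<le> k x" and e: "0 < e"
    and v: "\<And>y z. dist y z \<le> e \<Longrightarrow> \<bar>v y - v z\<bar> \<le> max (k y) (k z) * dist y z"
  shows "ennreal \<bar>v (\<gamma> a) - v (\<gamma> b)\<bar> \<le> curve_integral (\<lambda>x. ennreal (k x)) (a, b, \<gamma>)"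
proof -
  have "\<bar>v (\<gamma>' len) - v (\<gamma>' 0)\<bar> \<le> integral {0..len} (\<lambda>s. k (\<gamma>' s))"
  proof (rule abs_diff_le_integral[OF arc_nonneg curve_integral_eq(3)[OF k] e])
    fix s t assume st: "0 \<le> s" "s \<le> t" "t \<le> len" "t - s \<le> e"
    then have d: "dist (\<gamma>' t) (\<gamma>' s) \<le> t - s"
      using arc_length_param_dist[of t s] by auto
    then have "\<bar>v (\<gamma>' t) - v (\<gamma>' s)\<bar> \<le> max (k (\<gamma>' t)) (k (\<gamma>' s)) * dist (\<gamma>' t) (\<gamma>' s)"
      using st by (intro v) auto
    also have "\<dots> \<le> max (k (\<gamma>' t)) (k (\<gamma>' s)) * (t - s)"
      using d k(2) by (intro mult_left_mono) (auto simp: le_max_iff_disj)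
    finally show "\<bar>v (\<gamma>' t) - v (\<gamma>' s)\<bar> \<le> max (k (\<gamma>' s)) (k (\<gamma>' t)) * (t - s)"
      by (simp add: max.commute)
  qed
  moreover have "\<gamma>' len = \<gamma> b" "\<gamma>' 0 = \<gamma> a"
    using arc_length_param_arc[of b] arc_length_param_arc[of a] le by (auto simp: arc_a)
  ultimately show ?thesis
    by (simp add: curve_integral_eq[OF k] ennreal_leI abs_minus_commute)
qed

text \<open>The comparison function in \<open>arc_le\<close> is \<open>arc\<close> up to
  \<open>t\<close> and affine of slope \<open>c\<close> afterwards; a pair of times on both sides of
  \<open>t\<close> is split there.\<close>

lemma arc_le_add:
  assumes t: "a \<le> t" "t \<le> t'" "t' \<le> b" 
    and c: "\<And>s s'. t \<le> s \<Longrightarrow> s \<le> s' \<Longrightarrow> s' \<le> t' \<Longrightarrow> dist (\<gamma> s) (\<gamma> s') \<le> c * (s' - s)"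
  shows "arc t' \<le> arc t + c * (t' - t)"
proof -
  define F where "F r = (if r \<le> t then arc r else arc t + c * (r - t))" for r
  have "arc t' \<le> F t' - F a"
  proof (rule arc_le)
    fix s s' assume s: "a \<le> s" "s \<le> s'" "s' \<le> t'"
    consider "s' \<le> t" | "t < s" | "s \<le> t" "t < s'" by linarith
    then show "dist (\<gamma> s) (\<gamma> s') \<le> F s' - F s"
    proof cases
      case 1
      then show ?thesis using dist_le_arc[of s s'] s t by (simp add: F_def)
    next
      case 2
      then show ?thesis using c[of s s'] s t by (simp add: F_def algebra_simps)
    next
      case 3
      then show ?thesis
        using c[of t s'] dist_le_arc[of s t] s t dist_triangle[of "\<gamma> s" "\<gamma> s'" "\<gamma> t"]
        by (simp add: F_def)
    qed
  qed (use t in auto)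
  then show ?thesis
    using t arc_a by (auto simp: F_def split: if_splits)
qed

end

lemma rectifiable_Lipschitz:
  fixes \<gamma> :: "real \<Rightarrow> 'a::metric_space"
  assumes T: "0 \<le> T" and lip: "\<And>s t. 0 \<le> s \<Longrightarrow> s \<le> t \<Longrightarrow> t \<le> T \<Longrightarrow> dist (\<gamma> s) (\<gamma> t) \<le> c * (t - s)"
  shows "rectifiable 0 T \<gamma>"
proof
  show "continuous_on {0..T} \<gamma>"
  proof (rule continuous_onI)
    fix x e :: real assume x: "x \<in> {0..T}" and e: "0 < e"
    have "dist (\<gamma> y) (\<gamma> x) \<le> e" if "y \<in> {0..T}" "dist y x < e / (\<bar>c\<bar> + 1)" for y
    proof -
      have "dist (\<gamma> y) (\<gamma> x) \<le> c * \<bar>y - x\<bar>"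
        using lip[of x y] lip[of y x] x that by (cases "x \<le> y") (auto simp: dist_commute)
      also have "\<dots> \<le> (\<bar>c\<bar> + 1) * \<bar>y - x\<bar>" by (intro mult_right_mono) auto
      also have "\<dots> \<le> e" using that(2) by (simp add: dist_real_def field_simps)
      finally show ?thesis .
    qed
    then show "\<exists>d>0. \<forall>y\<in>{0..T}. dist y x < d \<longrightarrow> dist (\<gamma> y) (\<gamma> x) \<le> e"
      using e by (intro exI[of _ "e / (\<bar>c\<bar> + 1)"]) auto
  qed
  have "curve_length 0 T \<gamma> \<le> ennreal (c * T - c * 0)"
    by (rule curve_length_le[OF T]) (use lip in \<open>auto simp: algebra_simps\<close>)
  then show "curve_length 0 T \<gamma> < top"
    by (rule order.strict_trans1) simp
qed fact

text \<open>The hypothesis \<open>slope\<close> is an integrated form of the statement that the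
  speed is at most 1 / k, so that formally k ds is at most dt. Instead of differentiating, time is
  cut into \<open>N\<close> parts. On each part \<open>k\<close> is nearly a constant
  \<open>A\<close>, the length is at most the time divided by \<open>A - x\<close>, and the
  integrand is at most \<open>A + x\<close>.\<close>

lemma curve_integral_le:
  fixes \<gamma> :: "real \<Rightarrow> 'a::metric_space" and k :: "'a \<Rightarrow> real"
  assumes T: "0 \<le> T" and \<eta>: "0 < \<eta>" "\<And>x. \<eta> \<le> k x" and m: "0 \<le> m" "\<And>x y. \<bar>k x - k y\<bar> \<le> m * dist x y"
    and lip: "\<And>s t. 0 \<le> s \<Longrightarrow> s \<le> t \<Longrightarrow> t \<le> T \<Longrightarrow> dist (\<gamma> s) (\<gamma> t) \<le> (t - s) / \<eta>"
    and slope: "\<And>s t. 0 \<le> s \<Longrightarrow> s \<le> t \<Longrightarrow> t \<le> T \<Longrightarrow>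
      dist (\<gamma> s) (\<gamma> t) * (k (\<gamma> s) - m * (t - s) / \<eta>) \<le> t - s"
  shows "curve_integral (\<lambda>x. ennreal (k x)) (0, T, \<gamma>) \<le> ennreal T"
proof -
  interpret rectifiable 0 T \<gamma>
    using rectifiable_Lipschitz[OF T, of \<gamma> "1 / \<eta>"] lip by simp
  have kc: "continuous_on UNIV k"
    by (rule continuous_on_abs_Lipschitz[OF m])
  have k0: "0 \<le> k x" for x using \<eta>(1) \<eta>(2)[of x] by linarith
  let ?I = "\<lambda>t. integral {0..arc t} (\<lambda>s. k (\<gamma>' s))"
  \<comment> \<open>In time \<open>T / N\<close> the curve moves by at most
    \<open>T / N / \<eta>\<close>, so \<open>X N\<close> bounds the change of \<open>k\<close> along
    it.\<close>
  define X where "X N = m * (T / real N) / \<eta>" for N :: nat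
  have bound: "?I T \<le> (\<eta> + X N) / (\<eta> - X N) * T" if N: "N > 0" "X N < \<eta>" for N
  proof -
    define x where "x = X N"
    define \<Delta> where "\<Delta> = T / real N"
    have x: "0 \<le> x" "x < \<eta>" "x = m * \<Delta> / \<eta>" and \<Delta>: "0 \<le> \<Delta>"
      using N T m \<eta> by (auto simp: x_def X_def \<Delta>_def)
    define \<sigma> where "\<sigma> i = real i * \<Delta>" for i
    have step: "\<sigma> (Suc i) = \<sigma> i + \<Delta>" for i by (simp add: \<sigma>_def algebra_simps)
    have \<sigma>0: "0 \<le> \<sigma> i" for i using \<Delta> by (simp add: \<sigma>_def)
    have \<sigma>T: "\<sigma> i \<le> T" if "i \<le> N" for i
      using that T N(1) mult_right_mono[of "real i" "real N" T] by (simp add: \<sigma>_def \<Delta>_def field_simps)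
    have \<sigma>T': "\<sigma> i + \<Delta> \<le> T" if "Suc i \<le> N" for i
      using \<sigma>T[OF that] by (simp add: step)
    have "?I (\<sigma> i) \<le> (\<eta> + x) / (\<eta> - x) * \<sigma> i" if "i \<le> N" for i
      using that
    proof (induction i)
      case 0
      then show ?case by (simp add: \<sigma>_def arc_a)
    next
      case (Suc i)
      let ?t = "\<sigma> i" and ?t' = "\<sigma> (Suc i)"
      define A where "A = k (\<gamma> ?t)"
      have A: "\<eta> \<le> A" using \<eta>(2) by (simp add: A_def)
      have t: "0 \<le> ?t" "?t \<le> ?t'" "?t' \<le> T" "?t' - ?t = \<Delta>" "?t \<le> T"
        using \<sigma>0[of i] \<sigma>T[of i] \<sigma>T'[of i] Suc.prems \<Delta> by (auto simp: step)
      have loc: "dist (\<gamma> s) (\<gamma> s') \<le> 1 / (A - x) * (s' - s)" if s: "?t \<le> s" "s \<le> s'" "s' \<le> ?t'" for s s'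
      proof -
        have "\<bar>k (\<gamma> ?t) - k (\<gamma> s)\<bar> \<le> m * ((s - ?t) / \<eta>)"
          by (rule order_trans[OF m(2)], rule mult_left_mono[OF lip m(1)]) (use s t in auto)
        then have "A - m * (s - ?t) / \<eta> \<le> k (\<gamma> s)" by (simp add: A_def)
        moreover have "m * (s - ?t) / \<eta> + m * (s' - s) / \<eta> \<le> x"
        proof -
          have "m * (s - ?t) / \<eta> + m * (s' - s) / \<eta> = m * (s' - ?t) / \<eta>"
            by (simp add: add_divide_distrib[symmetric] distrib_left[symmetric])
          also have "\<dots> \<le> x"
            unfolding x(3) using s t m(1) \<eta>(1) by (intro divide_right_mono mult_left_mono) auto
          finally show ?thesis .
        qed
        ultimately have "A - x \<le> k (\<gamma> s) - m * (s' - s) / \<eta>" by linarith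
        then have "dist (\<gamma> s) (\<gamma> s') * (A - x) \<le> dist (\<gamma> s) (\<gamma> s') * (k (\<gamma> s) - m * (s' - s) / \<eta>)"
          by (intro mult_left_mono) auto
        also have "\<dots> \<le> s' - s"
          by (rule slope) (use s t in auto)
        finally have "dist (\<gamma> s) (\<gamma> s') * (A - x) \<le> s' - s" .
        moreover have "0 < A - x" using A x by linarith
        ultimately show ?thesis by (simp add: pos_le_divide_eq)
      qed
      have l1: "arc ?t' \<le> arc ?t + 1 / (A - x) * \<Delta>"
        using arc_le_add[of ?t ?t' "1 / (A - x)"] loc t by auto
      have l2: "arc ?t' \<le> arc ?t + 1 / \<eta> * \<Delta>"
        using arc_le_add[of ?t ?t' "1 / \<eta>"] lip t by auto
      have l0: "arc ?t \<le> arc ?t'" "arc ?t' \<le> len"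
        using arc_mono t by auto
      have int: "(\<lambda>s. k (\<gamma>' s)) integrable_on {0..arc ?t'}"
        by (rule integrable_on_subinterval[OF curve_integral_eq(2)[OF kc k0]]) (use l0 in auto)
      have int': "(\<lambda>s. k (\<gamma>' s)) integrable_on {arc ?t..arc ?t'}"
        by (rule integrable_on_subinterval[OF int]) (use arc_nonneg in auto)
      have "integral {arc ?t..arc ?t'} (\<lambda>s. k (\<gamma>' s)) \<le> integral {arc ?t..arc ?t'} (\<lambda>s. A + x)"
      proof (rule integral_le[OF int'])
        fix r assume r: "r \<in> {arc ?t..arc ?t'}"
        have "\<bar>k (\<gamma>' r) - k (\<gamma>' (arc ?t))\<bar> \<le> m * dist (\<gamma>' r) (\<gamma>' (arc ?t))"
          by (rule m)
        also have "\<dots> \<le> m * (1 / \<eta> * \<Delta>)"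
        proof (rule mult_left_mono[OF _ m(1)])
          have "dist (\<gamma>' r) (\<gamma>' (arc ?t)) \<le> \<bar>r - arc ?t\<bar>"
            by (rule arc_length_param_dist) (use r l0 arc_nonneg[of ?t] in auto)
          then show "dist (\<gamma>' r) (\<gamma>' (arc ?t)) \<le> 1 / \<eta> * \<Delta>" using r l2 by auto
        qed
        finally show "k (\<gamma>' r) \<le> A + x"
          using t arc_length_param_arc[of ?t] by (simp add: A_def x(3))
      qed auto
      also have "\<dots> = (A + x) * (arc ?t' - arc ?t)"
        using l0 by simp
      also have "\<dots> \<le> (A + x) * (1 / (A - x) * \<Delta>)"
        using l1 A \<eta> x by (intro mult_left_mono) auto
      \<comment> \<open>The quotient \<open>(A + x) / (A - x)\<close> decreases in \<open>A\<close>,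
        so its value at \<open>\<eta>\<close> serves all parts at once.\<close>
      also have "\<dots> \<le> (\<eta> + x) / (\<eta> - x) * \<Delta>"
      proof -
        have "(A + x) / (A - x) \<le> (\<eta> + x) / (\<eta> - x)"
        proof -
          have "(A + x) * (\<eta> - x) \<le> (\<eta> + x) * (A - x)"
            using mult_left_mono[OF A x(1)] by (simp add: algebra_simps)
          moreover have "0 < A - x" "0 < \<eta> - x" using A x by linarith+
          ultimately show ?thesis by (simp add: pos_le_divide_eq pos_divide_le_eq)
        qed
        from mult_right_mono[OF this \<Delta>] show ?thesis by simp
      qed
      finally have "integral {arc ?t..arc ?t'} (\<lambda>s. k (\<gamma>' s)) \<le> (\<eta> + x) / (\<eta> - x) * \<Delta>" .
      moreover have "?I ?t + integral {arc ?t..arc ?t'} (\<lambda>s. k (\<gamma>' s)) = ?I ?t'"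
        by (rule Henstock_Kurzweil_Integration.integral_combine[OF arc_nonneg l0(1) int])
      moreover have "?I ?t \<le> (\<eta> + x) / (\<eta> - x) * ?t"
        using Suc by simp
      ultimately show ?case unfolding step distrib_left by linarith
    qed
    from this[of N] show ?thesis using N by (simp add: \<sigma>_def \<Delta>_def x_def)
  qed
  have X0: "X \<longlonglongrightarrow> 0"
    unfolding X_def using tendsto_mult[OF tendsto_const[of "m * T / \<eta>"] lim_1_over_n] by (simp add: field_simps)
  have "(\<lambda>N. (\<eta> + X N) / (\<eta> - X N) * T) \<longlonglongrightarrow> (\<eta> + 0) / (\<eta> - 0) * T"
    by (intro tendsto_intros X0) (use \<eta> in auto)
  moreover have "eventually (\<lambda>N. ?I T \<le> (\<eta> + X N) / (\<eta> - X N) * T) sequentially"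
    using order_tendstoD(2)[OF X0 \<eta>(1)] eventually_gt_at_top[of 0]
    by eventually_elim (rule bound)
  ultimately have "?I T \<le> (\<eta> + 0) / (\<eta> - 0) * T"
    by (intro tendsto_lowerbound) auto
  then show ?thesis
    using \<eta> by (simp add: curve_integral_eq[OF kc k0] ennreal_leI)
qed

section \<open>Chains and short curves\<close>

text \<open>The cost is a Riemann sum for the integral of \<open>k\<close>, weighted at the endpoint
  of each step that comes first on the way to \<open>E\<close>. Chains grow at this end, so that
  prepending a point compares the potentials of neighbours.\<close>

inductive chain :: "'a::metric_space set \<Rightarrow> ('a \<Rightarrow> real) \<Rightarrow> real \<Rightarrow> 'a \<Rightarrow> real \<Rightarrow> bool"
  for E k e where
  base: "w \<in> E \<Longrightarrow> chain E k e w 0"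
| step: "chain E k e y c \<Longrightarrow> dist x y \<le> e \<Longrightarrow> chain E k e x (k x * dist x y + c)"

text \<open>Inserting \<open>n\<close> truncates the potential and keeps the set nonempty when no
  chain leads from \<open>x\<close> to \<open>E\<close>.\<close>

definition chain_potential :: "'a::metric_space set \<Rightarrow> ('a \<Rightarrow> real) \<Rightarrow> real \<Rightarrow> real \<Rightarrow> 'a \<Rightarrow> real" where
  "chain_potential E k e n x = Inf (insert n {c. chain E k e x c})"

lemma chain_nonneg: "chain E k e x c \<Longrightarrow> (\<And>x. 0 \<le> k x) \<Longrightarrow> 0 \<le> c"
  by (induction rule: chain.induct) auto

text \<open>A step of length at most \<open>e\<close> can be prepended in either direction, which
  gives the two-sided bound. In the last claim \<open>K \<le> n\<close> ensures that a value below
  \<open>K\<close> stems from a chain and not from the truncation.\<close>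

lemma
  assumes k: "\<And>x. 0 \<le> k x" and n: "0 \<le> n"
  shows chain_potential_nonneg: "0 \<le> chain_potential E k e n x"
    and chain_potential_le: "chain_potential E k e n x \<le> n"
    and chain_potential_zero: "x \<in> E \<Longrightarrow> chain_potential E k e n x = 0"
    and chain_potential_step: "dist x y \<le> e \<Longrightarrow>
      \<bar>chain_potential E k e n x - chain_potential E k e n y\<bar> \<le> max (k x) (k y) * dist x y"
    and chain_potential_less: "chain_potential E k e n x < K \<Longrightarrow> K \<le> n \<Longrightarrow> \<exists>c<K. chain E k e x c"
proof -
  let ?V = "\<lambda>x. insert n {c. chain E k e x c}"
  have bdd: "bdd_below (?V x)" for x
    using chain_nonneg[of E k e] k n by (auto intro!: bdd_belowI[of _ 0])
  have low: "chain_potential E k e n x \<le> c" if "c = n \<or> chain E k e x c" for x c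
    unfolding chain_potential_def using bdd that by (auto intro: cInf_lower)
  show nn: "0 \<le> chain_potential E k e n x" for x
    unfolding chain_potential_def using chain_nonneg[of E k e] k n by (intro cInf_greatest) auto
  show "chain_potential E k e n x \<le> n"
    by (rule low) simp
  show "chain_potential E k e n x = 0" if "x \<in> E"
    using low[of 0 x] nn[of x] chain.base[OF that] by (auto intro: antisym)
  have one: "chain_potential E k e n x \<le> chain_potential E k e n y + k x * dist x y"
    if d: "dist x y \<le> e" for x y
  proof -
    have "chain_potential E k e n x - k x * dist x y \<le> chain_potential E k e n y"
      unfolding chain_potential_def[of E k e n y]
    proof (rule cInf_greatest)
      fix c assume "c \<in> ?V y"
      then consider "c = n" | "chain E k e y c" by auto
      then show "chain_potential E k e n x - k x * dist x y \<le> c"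
      proof cases
        case 1
        have "0 \<le> k x * dist x y" using k by (rule mult_nonneg_nonneg) simp
        then show ?thesis using low[of n x, OF disjI1[OF refl]] 1 by linarith
      next
        case 2
        from low[of _ x, OF disjI2, OF chain.step[OF this d]] show ?thesis by simp
      qed
    qed simp
    then show ?thesis by simp
  qed
  show "\<bar>chain_potential E k e n x - chain_potential E k e n y\<bar> \<le> max (k x) (k y) * dist x y"
    if d: "dist x y \<le> e"
  proof -
    have "k x * dist x y \<le> max (k x) (k y) * dist x y" "k y * dist x y \<le> max (k x) (k y) * dist x y"
      by (auto intro: mult_right_mono)
    then show ?thesis
      using one[OF d] one[of y x] d by (auto simp: dist_commute abs_le_iff)
  qed
  show "\<exists>c<K. chain E k e x c" if "chain_potential E k e n x < K" "K \<le> n"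
    using that bdd cInf_less_iff[of "?V x" K] unfolding chain_potential_def by auto
qed

text \<open>The curve runs at unit cost; the error term accounts for the waiting time at the vertices.\<close>

lemma chain_path:
  assumes "chain E k e x T" and k: "\<And>x. 0 < k x" "\<And>x. k x \<le> M" and err: "M * e \<le> err" "0 \<le> err"
  shows "\<exists>\<gamma>. \<gamma> 0 = x \<and> (\<forall>t\<ge>T. \<gamma> t \<in> E) \<and>
    (\<forall>c t. 0 \<le> c \<longrightarrow> 0 \<le> t \<longrightarrow> (\<forall>r\<in>{0..t}. c \<le> k (\<gamma> r)) \<longrightarrow> c * dist (\<gamma> 0) (\<gamma> t) \<le> t) \<and>
    (\<forall>c s t. 0 \<le> c \<longrightarrow> 0 \<le> s \<longrightarrow> s \<le> t \<longrightarrow> (\<forall>r\<in>{s..t}. c \<le> k (\<gamma> r)) \<longrightarrow> c * dist (\<gamma> s) (\<gamma> t) \<le> t - s + err)"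
  using assms(1)
proof (induction rule: chain.induct)
  case (base w)
  then show ?case using err by (intro exI[of _ "\<lambda>_. w"]) auto
next
  case (step y T x)
  from step.IH obtain \<gamma> where "\<gamma> 0 = y" "\<forall>t\<ge>T. \<gamma> t \<in> E"
    "\<forall>c t. 0 \<le> c \<longrightarrow> 0 \<le> t \<longrightarrow> (\<forall>r\<in>{0..t}. c \<le> k (\<gamma> r)) \<longrightarrow> c * dist (\<gamma> 0) (\<gamma> t) \<le> t"
    "\<forall>c s t. 0 \<le> c \<longrightarrow> 0 \<le> s \<longrightarrow> s \<le> t \<longrightarrow> (\<forall>r\<in>{s..t}. c \<le> k (\<gamma> r)) \<longrightarrow> c * dist (\<gamma> s) (\<gamma> t) \<le> t - s + err"
    by blast
  note \<gamma> = this[rule_format]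
  have T: "0 \<le> T" using chain_nonneg[OF step(1)] k(1) by (simp add: less_imp_le)
  show ?case
  proof (cases "x = y")
    case True
    then show ?thesis using \<gamma> by (intro exI[of _ \<gamma>]) auto
  next
    case False
    define \<Delta> where "\<Delta> = k x * dist x y"
    have \<Delta>: "0 < \<Delta>" using False k by (simp add: \<Delta>_def)
    have "\<Delta> \<le> M * e"
      unfolding \<Delta>_def using k(1)[of x] k(2)[of x] step(2) by (intro mult_mono) auto
    then have \<Delta>err: "\<Delta> \<le> err" using err by simp
    define \<gamma>' where "\<gamma>' t = (if t < \<Delta> then x else \<gamma> (t - \<Delta>))" for t
    \<comment> \<open>Seen from time 0, the waiting time \<open>\<Delta>\<close> has been paid in
      full, so no error occurs. Carrying this exact bound through the induction prevents the errors
      of successive vertices from adding up: a piece that starts during a waiting period loses at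
      most that one \<open>\<Delta>\<close>.\<close>
    have from0: "c * dist x (\<gamma>' t) \<le> t"
      if c: "0 \<le> c" "c \<le> k x" and t: "\<Delta> \<le> t" "\<And>r. r \<in> {\<Delta>..t} \<Longrightarrow> c \<le> k (\<gamma>' r)" for c t
    proof -
      have "c * dist (\<gamma> 0) (\<gamma> (t - \<Delta>)) \<le> t - \<Delta>"
      proof (rule \<gamma>(3))
        fix r assume "r \<in> {0..t - \<Delta>}"
        then show "c \<le> k (\<gamma> r)" using t(2)[of "r + \<Delta>"] by (auto simp: \<gamma>'_def)
      qed (use c t in auto)
      moreover have "c * dist x y \<le> \<Delta>" unfolding \<Delta>_def using c by (intro mult_right_mono) auto
      moreover have "c * dist x (\<gamma>' t) \<le> c * (dist x y + dist y (\<gamma> (t - \<Delta>)))"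
        using t(1) c dist_triangle[of x "\<gamma> (t - \<Delta>)" y] by (intro mult_left_mono) (auto simp: \<gamma>'_def)
      ultimately show ?thesis by (simp add: \<gamma>(1) distrib_left)
    qed
    show ?thesis
    proof (intro exI[of _ \<gamma>'] conjI allI impI)
      show "\<gamma>' 0 = x" using \<Delta> by (simp add: \<gamma>'_def)
      show "\<gamma>' t \<in> E" if "k x * dist x y + T \<le> t" for t
        using that T \<gamma>(2)[of "t - \<Delta>"] by (auto simp: \<gamma>'_def \<Delta>_def)
      show "c * dist (\<gamma>' 0) (\<gamma>' t) \<le> t" if "0 \<le> c" "0 \<le> t" "\<forall>r\<in>{0..t}. c \<le> k (\<gamma>' r)" for c t
      proof (cases "t < \<Delta>")
        case True
        then show ?thesis using that \<Delta> by (simp add: \<gamma>'_def)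
      next
        case f: False
        have "c \<le> k x" using that(3)[rule_format, of 0] that \<Delta> by (simp add: \<gamma>'_def)
        moreover have "c \<le> k (\<gamma>' r)" if "r \<in> {\<Delta>..t}" for r
          using that \<Delta> \<open>\<forall>r\<in>{0..t}. c \<le> k (\<gamma>' r)\<close> by auto
        ultimately have "c * dist x (\<gamma>' t) \<le> t" using that f by (intro from0) auto
        then show ?thesis using \<Delta> by (simp add: \<gamma>'_def)
      qed
      show "c * dist (\<gamma>' s) (\<gamma>' t) \<le> t - s + err"
        if "0 \<le> c" "0 \<le> s" "s \<le> t" "\<forall>r\<in>{s..t}. c \<le> k (\<gamma>' r)" for c s t
      proof -
        consider "t < \<Delta>" | "s < \<Delta>" "\<Delta> \<le> t" | "\<Delta> \<le> s" using that by linarith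
        then show ?thesis
        proof cases
          case 1
          then show ?thesis using that err by (simp add: \<gamma>'_def)
        next
          case 2
          have "c \<le> k x" using that(4)[rule_format, of s] that 2 by (simp add: \<gamma>'_def)
          then have "c * dist x (\<gamma>' t) \<le> t"
            using 2 that by (intro from0) auto
          then show ?thesis using 2 \<Delta>err by (simp add: \<gamma>'_def)
        next
          case 3
          have "c * dist (\<gamma> (s - \<Delta>)) (\<gamma> (t - \<Delta>)) \<le> t - \<Delta> - (s - \<Delta>) + err"
          proof (rule \<gamma>(4))
            fix r assume "r \<in> {s - \<Delta>..t - \<Delta>}"
            then show "c \<le> k (\<gamma> r)" using that(4)[rule_format, of "r + \<Delta>"] 3 by (auto simp: \<gamma>'_def)
          qed (use that 3 in auto)
          then show ?thesis using 3 that by (simp add: \<gamma>'_def)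
        qed
      qed
    qed
  qed
qed

section \<open>Pointwise limits of discontinuous paths\<close>

lemma compact_product:
  fixes S :: "'a::topological_space set"
  assumes "compact S"
  shows "compact {f::'b \<Rightarrow> 'a. \<forall>t. f t \<in> S}"
proof -
  have "{f::'b \<Rightarrow> 'a. \<forall>t. f t \<in> S} = PiE UNIV (\<lambda>_. S)"
    by (auto simp: PiE_def Pi_def)
  then show ?thesis
    using assms compactin_PiE[of "\<lambda>_::'b. euclidean :: 'a topology" UNIV "\<lambda>_. S"]
    by (auto simp: euclidean_product_topology)
qed

text \<open>The paths \<open>\<Gamma> j\<close> may jump, so compactness comes from Tychonoff's
  theorem for pointwise convergence. It preserves every closed condition on finitely many values of
  a path. The slope condition is closed once it is stated for a fixed continuous \<open>k m\<close>
  instead of the varying \<open>k j\<close>.\<close>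

lemma limit_path:
  fixes k :: "nat \<Rightarrow> 'a::metric_space \<Rightarrow> real" and \<Gamma> :: "nat \<Rightarrow> real \<Rightarrow> 'a" and l err :: "nat \<Rightarrow> real"
  assumes proper: "\<And>R. compact (cball x R)" and K: "0 \<le> K"
    and \<eta>: "0 < \<eta>" "\<And>j y. \<eta> \<le> k j y" 
    and l: "\<And>j. 0 \<le> l j" "\<And>j y z. \<bar>k j y - k j z\<bar> \<le> l j * dist y z"
    and mono: "\<And>i j y. i \<le> j \<Longrightarrow> k i y \<le> k j y" and E: "closed E"
    and err: "decseq err" "err \<longlonglongrightarrow> 0"
    and \<Gamma>: "\<And>j. \<Gamma> j 0 = x" "\<And>j. \<Gamma> j K \<in> E"
    and slope: "\<And>j c s t. 0 \<le> c \<Longrightarrow> 0 \<le> s \<Longrightarrow> s \<le> t \<Longrightarrow> (\<And>r. r \<in> {s..t} \<Longrightarrow> c \<le> k j (\<Gamma> j r)) \<Longrightarrow>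
      c * dist (\<Gamma> j s) (\<Gamma> j t) \<le> t - s + err j"
  obtains \<gamma> where "\<gamma> 0 = x" "\<gamma> K \<in> E"
    "\<And>s t. 0 \<le> s \<Longrightarrow> s \<le> t \<Longrightarrow> t \<le> K \<Longrightarrow> dist (\<gamma> s) (\<gamma> t) \<le> (t - s) / \<eta>"
    "\<And>m s t. 0 \<le> s \<Longrightarrow> s \<le> t \<Longrightarrow> t \<le> K \<Longrightarrow>
       dist (\<gamma> s) (\<gamma> t) * (k m (\<gamma> s) - l m * (t - s) / \<eta>) \<le> t - s"
proof -
  \<comment> \<open>Freezing the path outside \<open>[0, K]\<close> confines all its values to one
    ball.\<close>
  define \<Gamma>' where "\<Gamma>' j t = \<Gamma> j (max 0 (min K t))" for j t
  define S where "S = {f::real \<Rightarrow> 'a. \<forall>t. f t \<in> cball x ((K + err 0) / \<eta>)}"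
  \<comment> \<open>\<open>C N\<close> collects what holds for all \<open>\<Gamma>' M\<close> with
    \<open>M \<ge> N\<close>: only \<open>k m\<close> with \<open>m \<le> N\<close> occur, and the
    error is \<open>err N\<close>.\<close>
  define C where "C N = {f::real \<Rightarrow> 'a. f 0 = x \<and> f K \<in> E \<and> (\<forall>s t. 0 \<le> s \<and> s \<le> t \<and> t \<le> K \<longrightarrow>
      dist (f s) (f t) \<le> (t - s + err N) / \<eta> \<and>
      (\<forall>m. m \<le> N \<longrightarrow> dist (f s) (f t) * (k m (f s) - l m * (t - s + err N) / \<eta>) \<le> t - s + err N))}" for N
  have kc: "continuous_on UNIV (k m)" for m
    by (rule continuous_on_abs_Lipschitz[OF l])
  have kc': "continuous_on UNIV (\<lambda>f::real \<Rightarrow> 'a. k m (f s))" for m s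
    by (rule continuous_on_compose2[OF kc]) auto
  have Ccl: "closed (C N)" for N
  proof -
    have "closed ((\<lambda>f::real \<Rightarrow> 'a. f K) -` E)"
      by (rule closed_vimage[OF E]) simp
    then have "closed {f::real \<Rightarrow> 'a. f K \<in> E}" by (simp add: vimage_def)
    moreover have "closed {f::real \<Rightarrow> 'a. f 0 = x}"
      by (intro closed_Collect_eq continuous_on_product_coordinates continuous_on_const)
    moreover have dc: "continuous_on UNIV (\<lambda>f::real \<Rightarrow> 'a. dist (f s) (f t))" for s t
      by (intro continuous_on_dist continuous_on_product_coordinates)
    moreover have "closed {f::real \<Rightarrow> 'a. dist (f s) (f t) \<le> c}" for s t c
      by (intro closed_Collect_le dc continuous_on_const)
    moreover have "closed {f::real \<Rightarrow> 'a. dist (f s) (f t) * (k m (f s) - c) \<le> c'}" for s t m c c'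
      by (intro closed_Collect_le continuous_on_mult continuous_on_diff dc kc' continuous_on_const)
    ultimately show ?thesis
      unfolding C_def
      by (intro closed_Collect_conj closed_Collect_all closed_Collect_imp open_Collect_const)
  qed
  have Scomp: "compact S"
    unfolding S_def by (rule compact_product[OF proper])
  have fip: "S \<inter> (\<Inter>N\<in>I. C N) \<noteq> {}" if "finite I" for I
  proof -
    obtain M where M: "\<And>N. N \<in> I \<Longrightarrow> N \<le> M"
      using \<open>finite I\<close> unfolding finite_nat_set_iff_bounded_le by blast
    have e0: "err j \<ge> 0" "err j \<le> err 0" for j
      using err decseq_ge[OF err] decseqD[OF err(1), of 0 j] by auto
    have lip: "dist (\<Gamma> M s) (\<Gamma> M t) \<le> (t - s + err M) / \<eta>" if "0 \<le> s" "s \<le> t" for s t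
      using slope[of \<eta> s t M] that \<eta> by (simp add: field_simps)
    have "\<Gamma>' M \<in> S"
    proof -
      have "dist (\<Gamma> M 0) (\<Gamma> M t) \<le> (K + err 0) / \<eta>" if "0 \<le> t" "t \<le> K" for t
        by (rule order_trans[OF lip]) (use that \<eta> e0 in \<open>auto intro!: divide_right_mono add_mono\<close>)
      then show ?thesis using K by (simp add: S_def \<Gamma>'_def \<Gamma>)
    qed
    moreover have "\<Gamma>' M \<in> C N" if "N \<in> I" for N
    proof -
      have NM: "N \<le> M" "err M \<le> err N" using M[OF that] decseqD[OF err(1)] by auto
      have 2: "dist (\<Gamma> M s) (\<Gamma> M t) * (k m (\<Gamma> M s) - l m * (t - s + err N) / \<eta>) \<le> t - s + err N"
        if st: "0 \<le> s" "s \<le> t" "t \<le> K" and m: "m \<le> N" for s t m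
      proof -
        \<comment> \<open>Up to time \<open>t\<close> the path stays within
          \<open>(t - s + err N) / \<eta>\<close> of its position at time \<open>s\<close>, so
          \<open>c\<close> is a lower bound for \<open>k m\<close>, hence for \<open>k M\<close>, on
          the whole piece. For negative \<open>c\<close> the left-hand side is not positive.\<close>
        define c where "c = k m (\<Gamma> M s) - l m * (t - s + err N) / \<eta>"
        show ?thesis
        proof (cases "0 \<le> c")
          case True
          have "c * dist (\<Gamma> M s) (\<Gamma> M t) \<le> t - s + err M"
          proof (rule slope)
            fix r assume r: "r \<in> {s..t}"
            have "\<bar>k m (\<Gamma> M s) - k m (\<Gamma> M r)\<bar> \<le> l m * ((t - s + err N) / \<eta>)"
            proof (rule order_trans[OF l(2)], rule mult_left_mono[OF _ l(1)])
              show "dist (\<Gamma> M s) (\<Gamma> M r) \<le> (t - s + err N) / \<eta>"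
                by (rule order_trans[OF lip]) (use r st \<eta> NM in \<open>auto intro!: divide_right_mono add_mono\<close>)
            qed
            then have "c \<le> k m (\<Gamma> M r)" by (simp add: c_def)
            also have "\<dots> \<le> k M (\<Gamma> M r)" using mono m NM by auto
            finally show "c \<le> k M (\<Gamma> M r)" .
          qed (use True st in auto)
          then show ?thesis using NM by (simp add: c_def mult.commute)
        next
          case False
          then have "dist (\<Gamma> M s) (\<Gamma> M t) * c \<le> 0" by (simp add: mult_le_0_iff)
          then show ?thesis using st e0(1)[of N] by (simp add: c_def)
        qed
      qed
      have 1: "dist (\<Gamma> M s) (\<Gamma> M t) \<le> (t - s + err N) / \<eta>" if "0 \<le> s" "s \<le> t" for s t
        by (rule order_trans[OF lip[OF that]]) (use \<eta> NM in \<open>auto intro!: divide_right_mono\<close>)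
      show ?thesis
        using 1 2 K by (auto simp: C_def \<Gamma>'_def \<Gamma> max_absorb2 min_absorb2)
    qed
    ultimately show ?thesis by blast
  qed
  have "S \<inter> (\<Inter>N\<in>UNIV. C N) \<noteq> {}"
    by (rule compact_imp_fip_image[OF Scomp Ccl fip])
  then obtain \<gamma> where \<gamma>: "\<And>N. \<gamma> \<in> C N" by auto
  have ee: "(\<lambda>N. (a + err N) / \<eta>) \<longlonglongrightarrow> a / \<eta>" "(\<lambda>N. a + err N) \<longlonglongrightarrow> a" for a
    using \<eta>(1) by (auto intro!: tendsto_eq_intros err(2))
  show thesis
  proof
    show "\<gamma> 0 = x" "\<gamma> K \<in> E" using \<gamma>[of 0] by (auto simp: C_def)
    show "dist (\<gamma> s) (\<gamma> t) \<le> (t - s) / \<eta>" if "0 \<le> s" "s \<le> t" "t \<le> K" for s t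
      by (rule LIMSEQ_le_const[OF ee(1)]) (use that \<gamma> in \<open>auto simp: C_def\<close>)
    show "dist (\<gamma> s) (\<gamma> t) * (k m (\<gamma> s) - l m * (t - s) / \<eta>) \<le> t - s" 
      if "0 \<le> s" "s \<le> t" "t \<le> K" for m s t
    proof (rule LIMSEQ_le)
      show "(\<lambda>N. t - s + err N) \<longlonglongrightarrow> t - s" by (rule ee)
      have "(\<lambda>N. dist (\<gamma> s) (\<gamma> t) * (k m (\<gamma> s) - l m * ((t - s + err N) / \<eta>))) \<longlonglongrightarrow> 
          dist (\<gamma> s) (\<gamma> t) * (k m (\<gamma> s) - l m * ((t - s) / \<eta>))"
        by (intro tendsto_intros ee)
      then show "(\<lambda>N. dist (\<gamma> s) (\<gamma> t) * (k m (\<gamma> s) - l m * (t - s + err N) / \<eta>)) \<longlonglongrightarrow> 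
          dist (\<gamma> s) (\<gamma> t) * (k m (\<gamma> s) - l m * (t - s) / \<eta>)" by simp
      show "\<exists>M. \<forall>N\<ge>M. dist (\<gamma> s) (\<gamma> t) * (k m (\<gamma> s) - l m * (t - s + err N) / \<eta>) \<le> t - s + err N"
        using \<gamma> that by (intro exI[of _ m]) (auto simp: C_def)
    qed
  qed
qed

text \<open>An inf-convolution: the largest \<open>j\<close>-Lipschitz minorant of \<open>h\<close>
  truncated at \<open>j\<close>. The truncation keeps it real-valued and bounded although
  \<open>h\<close> may be infinite.\<close>

definition lip_approx :: "('a::metric_space \<Rightarrow> ennreal) \<Rightarrow> nat \<Rightarrow> 'a \<Rightarrow> real" where
  "lip_approx h j x = Inf (range (\<lambda>y. enn2real (min (h y) (of_nat j)) + real j * dist x y))"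

lemma lip_approx_lower: "lip_approx h j x \<le> enn2real (min (h y) (of_nat j)) + real j * dist x y"
  unfolding lip_approx_def by (rule cInf_lower) (auto intro!: bdd_belowI[of _ 0])

lemma lip_approx_greatest:
  "(\<And>y. c \<le> enn2real (min (h y) (of_nat j)) + real j * dist x y) \<Longrightarrow> c \<le> lip_approx h j x"
  unfolding lip_approx_def by (rule cInf_greatest) auto

lemma lip_approx_nonneg: "0 \<le> lip_approx h j x"
  by (rule lip_approx_greatest) simp

lemma min_of_nat_less_top [simp]: "min a (of_nat j) < (top::ennreal)"
  by (simp add: min_less_iff_disj ennreal_of_nat_eq_real_of_nat)

lemma lip_approx_le: "ennreal (lip_approx h j x) \<le> h x" "lip_approx h j x \<le> real j"
proof -
  have *: "lip_approx h j x \<le> enn2real (min (h x) (of_nat j))"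
    using lip_approx_lower[of h j x x] by simp
  have "ennreal (lip_approx h j x) \<le> min (h x) (of_nat j)"
    using ennreal_leI[OF *] by simp
  then show "ennreal (lip_approx h j x) \<le> h x" by simp
  have "enn2real (min (h x) (of_nat j)) \<le> real j"
    by (rule enn2real_leI) (auto simp: ennreal_of_nat_eq_real_of_nat)
  then show "lip_approx h j x \<le> real j" using * by simp
qed

lemma le_enn2real_min:
  assumes "ennreal c \<le> a" "c \<le> real j"
  shows "c \<le> enn2real (min a (of_nat j))"
proof (cases "0 \<le> c")
  case True
  have "ennreal c \<le> min a (of_nat j)"
    using assms by (simp add: ennreal_of_nat_eq_real_of_nat ennreal_leI)
  then show ?thesis
    using enn2real_mono[OF _ min_of_nat_less_top] True by fastforce
next
  case False
  then show ?thesis by (rule order_trans[OF less_imp_le, OF not_le_imp_less]) simp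
qed

lemma lip_approx_ge:
  assumes "\<And>x. ennreal \<eta> \<le> h x" "\<eta> \<le> real j"
  shows "\<eta> \<le> lip_approx h j x"
  by (rule lip_approx_greatest) (use assms in \<open>auto intro!: add_increasing2 le_enn2real_min\<close>)

lemma lip_approx_Lipschitz: "\<bar>lip_approx h j x - lip_approx h j y\<bar> \<le> real j * dist x y"
proof -
  have "lip_approx h j x - real j * dist x y \<le> lip_approx h j y" for x y
  proof (rule lip_approx_greatest)
    fix z
    have "real j * dist x z \<le> real j * (dist x y + dist y z)"
      by (intro mult_left_mono dist_triangle) auto
    then show "lip_approx h j x - real j * dist x y \<le> enn2real (min (h z) (of_nat j)) + real j * dist y z"
      using lip_approx_lower[of h j x z] by (simp add: distrib_left)
  qed
  from this[of x y] this[of y x] show ?thesis by (simp add: dist_commute abs_le_iff)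
qed

lemma lip_approx_continuous: "continuous_on A (lip_approx h j)"
  by (rule continuous_on_abs_Lipschitz[OF of_nat_0_le_iff lip_approx_Lipschitz])

lemma lip_approx_mono:
  assumes "i \<le> j"
  shows "lip_approx h i x \<le> lip_approx h j x"
proof (rule lip_approx_greatest)
  fix y
  have "min (h y) (of_nat i) \<le> min (h y) (of_nat j)"
    using assms by (intro min.mono) auto
  then have "enn2real (min (h y) (of_nat i)) \<le> enn2real (min (h y) (of_nat j))"
    by (rule enn2real_mono) simp
  moreover have "real i * dist x y \<le> real j * dist x y"
    using assms by (intro mult_right_mono) auto
  ultimately show "lip_approx h i x \<le> enn2real (min (h y) (of_nat j)) + real j * dist x y"
    using lip_approx_lower[of h i x y] by linarith
qed

lemma SUP_lip_approx:
  assumes lsc: "\<And>c. open {x. c < h x}"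
  shows "(SUP j. ennreal (lip_approx h j x)) = h x"
proof (rule antisym)
  show "(SUP j. ennreal (lip_approx h j x)) \<le> h x"
    by (rule SUP_least) (rule lip_approx_le)
  show "h x \<le> (SUP j. ennreal (lip_approx h j x))"
  proof (rule dense_le)
    fix c assume "c < h x"
    then have "c < top" by (rule order.strict_trans2) simp
    then obtain c' where c': "c = ennreal c'" "0 \<le> c'" by (cases c) auto
    obtain r where r: "r > 0" "\<And>y. dist x y < r \<Longrightarrow> c < h y"
      using lsc[of c] \<open>c < h x\<close> unfolding open_contains_ball by (auto simp: subset_iff)
    \<comment> \<open>Near \<open>x\<close> the truncation at \<open>j\<close> must not cut below
      \<open>c'\<close>; at distance at least \<open>r\<close> the penalty alone must reach
      \<open>c'\<close>.\<close>
    obtain j :: nat where j: "c' \<le> real j" "c' / r \<le> real j"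
      using real_arch_simple[of "max c' (c' / r)"] by auto
    have "c' \<le> lip_approx h j x"
    proof (rule lip_approx_greatest)
      fix y
      show "c' \<le> enn2real (min (h y) (of_nat j)) + real j * dist x y"
      proof (cases "dist x y < r")
        case True
        then have "c' \<le> enn2real (min (h y) (of_nat j))"
          using r(2)[of y] j c' by (intro le_enn2real_min) auto
        moreover have "0 \<le> real j * dist x y" by simp
        ultimately show ?thesis by linarith
      next
        case False
        have "c' \<le> real j * r" using j(2) r(1) by (simp add: field_simps)
        also have "\<dots> \<le> real j * dist x y" using False by (intro mult_left_mono) auto
        finally show ?thesis by (simp add: add_increasing)
      qed
    qed
    then have "c \<le> ennreal (lip_approx h j x)" using c' by (simp add: ennreal_leI)
    also have "\<dots> \<le> (SUP j. ennreal (lip_approx h j x))" by (rule SUP_upper) simp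
    finally show "c \<le> (SUP j. ennreal (lip_approx h j x))" .
  qed
qed

text \<open>Monotone convergence along the arc-length parameter. It carries bounds for the
  continuous minorants over to a function that is merely lower semicontinuous.\<close>

lemma (in rectifiable) curve_integral_SUP_le:
  fixes k :: "nat \<Rightarrow> 'a \<Rightarrow> real"
  assumes k: "\<And>j. continuous_on UNIV (k j)" "\<And>j x. 0 \<le> k j x" "\<And>i j x. i \<le> j \<Longrightarrow> k i x \<le> k j x"
    and h: "\<And>x. (SUP j. ennreal (k j x)) = h x"
    and le: "\<And>j. curve_integral (\<lambda>x. ennreal (k j x)) (a, b, \<gamma>) \<le> T"
  shows "curve_integral h (a, b, \<gamma>) \<le> T"
proof -
  let ?f = "\<lambda>j s. ennreal (k j (\<gamma>' s)) * indicator {0..len} s"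
  have eq: "curve_integral g (a, b, \<gamma>) = (\<integral>\<^sup>+s. g (\<gamma>' s) * indicator {0..len} s \<partial>lebesgue)" for g
    by (simp add: curve_integral_def arc_def)
  have "curve_integral h (a, b, \<gamma>) = (\<integral>\<^sup>+s. (SUP j. ?f j s) \<partial>lebesgue)"
    unfolding eq by (auto intro!: nn_integral_cong simp: h SUP_mult_right_ennreal[symmetric])
  also have "\<dots> = (SUP j. \<integral>\<^sup>+s. ?f j s \<partial>lebesgue)"
  proof (rule nn_integral_monotone_convergence_SUP)
    show "incseq ?f"
      using k(3) by (auto simp: incseq_def le_fun_def intro!: mult_right_mono ennreal_leI)
    show "?f j \<in> borel_measurable lebesgue" for j
    proof -
      have "(\<lambda>s. indicator {0..len} s *\<^sub>R k j (\<gamma>' s)) \<in> borel_measurable borel"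
        by (rule borel_measurable_continuous_on_indicator[OF _ curve_integral_eq(3)[OF k(1,2)]]) simp
      then have "(\<lambda>s. ennreal (indicator {0..len} s *\<^sub>R k j (\<gamma>' s))) \<in> borel_measurable lebesgue"
        by (intro measurable_compose[OF measurable_completion measurable_ennreal]) simp
      moreover have "(\<lambda>s. ennreal (indicator {0..len} s *\<^sub>R k j (\<gamma>' s))) = ?f j"
        by (auto simp: indicator_def)
      ultimately show ?thesis by simp
    qed
  qed
  also have "\<dots> \<le> T"
    by (rule SUP_least) (use le in \<open>simp add: eq\<close>)
  finally show ?thesis .
qed

text \<open>A common bound \<open>K\<close> for the cost gives all chains the same time interval
  \<open>[0, K]\<close>: a path that has reached its end waits there. So the step paths of all
  minorants can be passed to the limit together.\<close>

lemma exists_curve_integral_le: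
  fixes h :: "'a::metric_space \<Rightarrow> ennreal"
  assumes proper: "\<And>R. compact (cball (x::'a) R)" and lsc: "\<And>c. open {x. c < h x}"
    and \<eta>: "0 < \<eta>" "\<eta> \<le> 1" "\<And>x. ennreal \<eta> \<le> h x" and E: "closed E" "x \<notin> E" and K: "K \<le> n" "0 \<le> n"
    and pot: "\<And>j. chain_potential E (lip_approx h (Suc j)) (1 / (real (Suc j))\<^sup>2) n x < K"
  obtains \<gamma> where "(0, K, \<gamma>) \<in> curves" "\<gamma> 0 = x" "\<gamma> K \<in> E" "curve_integral h (0, K, \<gamma>) \<le> ennreal K"
proof -
  \<comment> \<open>Starting at index 1 gives \<open>\<eta> \<le> Suc j\<close>, so the truncation
    preserves the lower bound. A step of length at most \<open>1 / (Suc j)\<^sup>2\<close> costs at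
    most \<open>Suc j\<close> times this, which is \<open>err j\<close>.\<close>
  let ?k = "\<lambda>j. lip_approx h (Suc j)"
  define err where "err j = 1 / real (Suc j)" for j :: nat
  have k\<eta>: "\<eta> \<le> ?k j y" for j y
    using \<eta> by (intro lip_approx_ge) auto
  have k0: "0 < ?k j y" for j y
    using k\<eta>[of j y] \<eta>(1) by linarith
  have "\<exists>\<gamma>. \<gamma> 0 = x \<and> \<gamma> K \<in> E \<and>
      (\<forall>c s t. 0 \<le> c \<longrightarrow> 0 \<le> s \<longrightarrow> s \<le> t \<longrightarrow> (\<forall>r\<in>{s..t}. c \<le> ?k j (\<gamma> r)) \<longrightarrow> c * dist (\<gamma> s) (\<gamma> t) \<le> t - s + err j)" for j
  proof -
    obtain c where c: "c < K" "chain E (?k j) (1 / (real (Suc j))\<^sup>2) x c"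
      using chain_potential_less[OF less_imp_le[OF k0] K(2) pot K(1)] by blast
    have "real (Suc j) * (1 / (real (Suc j))\<^sup>2) \<le> err j"
      by (simp add: err_def power2_eq_square)
    from chain_path[OF c(2) k0 lip_approx_le(2) this] obtain \<gamma> where "\<gamma> 0 = x" "\<forall>t\<ge>c. \<gamma> t \<in> E"
      "\<forall>c s t. 0 \<le> c \<longrightarrow> 0 \<le> s \<longrightarrow> s \<le> t \<longrightarrow> (\<forall>r\<in>{s..t}. c \<le> ?k j (\<gamma> r)) \<longrightarrow> c * dist (\<gamma> s) (\<gamma> t) \<le> t - s + err j"
      by (auto simp: err_def)
    then show ?thesis using c(1) by (intro exI[of _ \<gamma>]) auto
  qed
  then obtain \<Gamma> where \<Gamma>: "\<And>j. \<Gamma> j 0 = x" "\<And>j. \<Gamma> j K \<in> E"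
    "\<And>j c s t. 0 \<le> c \<Longrightarrow> 0 \<le> s \<Longrightarrow> s \<le> t \<Longrightarrow> \<forall>r\<in>{s..t}. c \<le> ?k j (\<Gamma> j r) \<Longrightarrow> c * dist (\<Gamma> j s) (\<Gamma> j t) \<le> t - s + err j"
    by metis
  have K0: "0 \<le> K"
    using pot[of 0] chain_potential_nonneg[of "?k 0" n E] less_imp_le[OF k0[of 0]] K(2) 
    by (meson less_imp_le order_trans)
  have err: "decseq err" "err \<longlonglongrightarrow> 0"
    unfolding err_def using LIMSEQ_inverse_real_of_nat
    by (auto simp: decseq_def divide_simps inverse_eq_divide)
  obtain \<gamma> where \<gamma>: "\<gamma> 0 = x" "\<gamma> K \<in> E"
    "\<And>s t. 0 \<le> s \<Longrightarrow> s \<le> t \<Longrightarrow> t \<le> K \<Longrightarrow> dist (\<gamma> s) (\<gamma> t) \<le> (t - s) / \<eta>"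
    "\<And>m s t. 0 \<le> s \<Longrightarrow> s \<le> t \<Longrightarrow> t \<le> K \<Longrightarrow>
       dist (\<gamma> s) (\<gamma> t) * (?k m (\<gamma> s) - real (Suc m) * (t - s) / \<eta>) \<le> t - s"
  proof (rule limit_path[where k = ?k and l = "\<lambda>m. real (Suc m)" and \<Gamma> = \<Gamma>, OF proper K0 \<eta>(1) k\<eta> of_nat_0_le_iff lip_approx_Lipschitz _ E(1) err])
    show "lip_approx h (Suc i) y \<le> lip_approx h (Suc j) y" if "i \<le> j" for i j y
      using that by (intro lip_approx_mono) simp
    show "c * dist (\<Gamma> j s) (\<Gamma> j t) \<le> t - s + err j"
      if "0 \<le> c" "0 \<le> s" "s \<le> t" "\<And>r. r \<in> {s..t} \<Longrightarrow> c \<le> lip_approx h (Suc j) (\<Gamma> j r)" for j c s t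
      using that by (intro \<Gamma>(3)) auto
  qed (use \<Gamma>(1,2) that in auto)
  interpret rectifiable 0 K \<gamma>
    using rectifiable_Lipschitz[OF K0, of \<gamma> "1 / \<eta>"] \<gamma>(3) by simp
  have "curve_integral (\<lambda>y. ennreal (?k m y)) (0, K, \<gamma>) \<le> ennreal K" for m
    by (rule curve_integral_le[OF K0 \<eta>(1) k\<eta> of_nat_0_le_iff lip_approx_Lipschitz \<gamma>(3) \<gamma>(4)])
  moreover have "(SUP j. ennreal (?k j y)) = h y" for y
  proof -
    have "(SUP j. ennreal (?k j y)) = (SUP j. ennreal (lip_approx h j y))"
    proof (rule SUP_eq)
      show "\<exists>j\<in>UNIV. ennreal (?k i y) \<le> ennreal (lip_approx h j y)" for i
        by (intro bexI[of _ "Suc i"]) auto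
      show "\<exists>i\<in>UNIV. ennreal (lip_approx h j y) \<le> ennreal (?k i y)" for j
        by (intro bexI[of _ j] ennreal_leI lip_approx_mono) auto
    qed
    then show ?thesis using SUP_lip_approx[OF lsc] by simp
  qed
  ultimately have "curve_integral h (0, K, \<gamma>) \<le> ennreal K"
    using curve_integral_SUP_le[where k = ?k and h = h and T = "ennreal K", OF lip_approx_continuous lip_approx_nonneg lip_approx_mono]
    by simp
  moreover have "(0, K, \<gamma>) \<in> curves"
  proof -
    have "\<gamma> 0 \<noteq> \<gamma> K" using \<gamma>(1,2) E(2) by metis
    moreover have "0 \<in> {0..K}" "K \<in> {0..K}" using K0 by auto
    ultimately show ?thesis using K0 cont rect unfolding curves_def by blast
  qed
  ultimately show thesis using that[of \<gamma>] \<gamma>(1,2) by simp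
qed

section \<open>Doubling measures\<close>

text \<open>Greedy choice: take a ball of largest radius, discard those that meet it, and repeat. A
  discarded ball has no larger radius, so it lies in the tripled chosen ball.\<close>

lemma finite_Vitali:
  fixes c :: "'b \<Rightarrow> 'a::metric_space" and r :: "'b \<Rightarrow> real"
  assumes "finite I"
  shows "\<exists>J\<subseteq>I. disjoint_family_on (\<lambda>i. ball (c i) (r i)) J \<and>
    (\<Union>i\<in>I. ball (c i) (r i)) \<subseteq> (\<Union>i\<in>J. ball (c i) (3 * r i))"
  using assms
proof (induction I rule: finite_psubset_induct)
  case (psubset I)
  show ?case
  proof (cases "I = {}")
    case True
    then show ?thesis by (auto simp: disjoint_family_on_def)
  next
    case False
    then have "Max (r ` I) \<in> r ` I" using psubset(1) by (intro Max_in) auto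
    then obtain m where "m \<in> I" "r m = Max (r ` I)" by auto
    then have m: "m \<in> I" "\<And>i. i \<in> I \<Longrightarrow> r i \<le> r m" using psubset(1) by auto
    define I' where "I' = {i \<in> I. i \<noteq> m \<and> ball (c i) (r i) \<inter> ball (c m) (r m) = {}}"
    have "I' \<subset> I" using m by (auto simp: I'_def)
    from psubset.IH[OF this] obtain J where J: "J \<subseteq> I'" "disjoint_family_on (\<lambda>i. ball (c i) (r i)) J"
      "(\<Union>i\<in>I'. ball (c i) (r i)) \<subseteq> (\<Union>i\<in>J. ball (c i) (3 * r i))" by auto
    show ?thesis
    proof (intro exI[of _ "insert m J"] conjI)
      show "insert m J \<subseteq> I" using J m by (auto simp: I'_def)
      show "disjoint_family_on (\<lambda>i. ball (c i) (r i)) (insert m J)"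
        using J unfolding disjoint_family_on_def I'_def by blast
      show "(\<Union>i\<in>I. ball (c i) (r i)) \<subseteq> (\<Union>i\<in>insert m J. ball (c i) (3 * r i))"
      proof
        fix x assume "x \<in> (\<Union>i\<in>I. ball (c i) (r i))"
        then obtain i where i: "i \<in> I" "dist (c i) x < r i" by auto
        show "x \<in> (\<Union>i\<in>insert m J. ball (c i) (3 * r i))"
        proof (cases "i \<in> I'")
          case True
          moreover have "x \<in> ball (c i) (r i)" using i by simp
          ultimately show ?thesis using J(3) by blast
        next
          case False
          have "\<exists>y. dist (c i) y < r i \<and> dist (c m) y < r m"
          proof (cases "i = m")
            case True
            then show ?thesis using i(2) by auto
          next
            case ne: False
            then show ?thesis using False i(1) by (auto simp: I'_def)
          qed
          then obtain y where "dist (c i) y < r i" "dist (c m) y < r m" by blast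
          moreover have "dist (c m) x \<le> dist (c m) y + dist (c i) y + dist (c i) x"
            by (smt (verit) dist_commute dist_triangle)
          ultimately have "dist (c m) x < 3 * r m" using i m(2)[of i] by linarith
          then show ?thesis by auto
        qed
      qed
    qed
  qed
qed

section \<open>Ball volumes and total boundedness\<close>

locale doubling_measure =
  fixes \<mu> :: "'a::metric_space set \<Rightarrow> ennreal" and c\<^sub>D :: real
  assumes bro: "borel_regular_outer_measure \<mu>"
    and bpf: "balls_positive_finite \<mu>"
    and c\<^sub>D: "1 \<le> c\<^sub>D"
    and doubling: "0 < r \<Longrightarrow> \<mu> (ball x (2 * r)) \<le> ennreal c\<^sub>D * \<mu> (ball x r)"
begin

abbreviation M :: "'a measure" where "M \<equiv> carath \<mu>"

lemma om: "outer_measure_space UNIV \<mu>"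
  using bro by (simp add: borel_regular_outer_measure_def)

lemma space_M [simp]: "space M = UNIV"
  by (rule space_carath[OF om])

lemma borel_sets_M: "A \<in> sets borel \<Longrightarrow> A \<in> sets M"
  using bro sets_carath[OF om] by (auto simp: borel_regular_outer_measure_def)

lemma open_sets_M [simp]: "open A \<Longrightarrow> A \<in> sets M"
  by (rule borel_sets_M) simp

lemma emeasure_M: "A \<in> sets M \<Longrightarrow> emeasure M A = \<mu> A"
  using emeasure_carath[OF om] sets_carath[OF om] by auto

lemma emeasure_open: "open A \<Longrightarrow> emeasure M A = \<mu> A"
  by (simp add: emeasure_M)

lemma borel_measurable_M: "f \<in> borel_measurable borel \<Longrightarrow> f \<in> borel_measurable M"
  unfolding measurable_def using borel_sets_M by auto

definition V :: "'a \<Rightarrow> real \<Rightarrow> real" where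
  "V x r = enn2real (\<mu> (ball x r))"

lemma \<mu>_ball: "0 < r \<Longrightarrow> \<mu> (ball x r) = ennreal (V x r)"
  using bpf by (simp add: V_def balls_positive_finite_def)

lemma V_pos: "0 < r \<Longrightarrow> 0 < V x r"
  using bpf by (simp add: V_def balls_positive_finite_def enn2real_positive_iff)

lemma V_nonneg [simp]: "0 \<le> V x r"
  by (simp add: V_def)

lemma V_subset: "ball x r \<subseteq> ball y s \<Longrightarrow> 0 < s \<Longrightarrow> V x r \<le> V y s"
  using emeasure_mono[of "ball x r" "ball y s" M] bpf
  by (auto simp: V_def emeasure_open balls_positive_finite_def intro!: enn2real_mono)

lemma V_double: "0 < r \<Longrightarrow> V x (2 * r) \<le> c\<^sub>D * V x r"
  using doubling[of r x] c\<^sub>D by (simp add: \<mu>_ball flip: ennreal_mult)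

lemma V_double_power: "0 < r \<Longrightarrow> V x (2 ^ k * r) \<le> c\<^sub>D ^ k * V x r"
proof (induction k)
  case (Suc k)
  have "V x (2 ^ Suc k * r) \<le> c\<^sub>D * V x (2 ^ k * r)"
    using V_double[of "2 ^ k * r" x] Suc.prems by (simp add: mult.assoc)
  also have "\<dots> \<le> c\<^sub>D * (c\<^sub>D ^ k * V x r)"
    using Suc c\<^sub>D by (intro mult_left_mono) auto
  finally show ?case by (simp add: mult.assoc)
qed simp

lemma V_compare:
  assumes "dist x y + r \<le> 2 ^ k * s" "0 < s"
  shows "V x r \<le> c\<^sub>D ^ k * V y s"
proof -
  have "ball x r \<subseteq> ball y (2 ^ k * s)"
  proof
    fix z assume "z \<in> ball x r"
    then show "z \<in> ball y (2 ^ k * s)"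
      using assms(1) dist_triangle[of y z x] by (simp add: dist_commute)
  qed
  then have "V x r \<le> V y (2 ^ k * s)" using assms by (intro V_subset) auto
  also have "\<dots> \<le> c\<^sub>D ^ k * V y s" by (rule V_double_power[OF assms(2)])
  finally show ?thesis .
qed

lemma exists_power_ge: "\<exists>k::nat. a \<le> 2 ^ k * (s::real)" if "0 < s"
proof -
  obtain k where "a / s < 2 ^ k" using real_arch_pow[of 2 "a / s"] by auto
  then show ?thesis using that by (intro exI[of _ k]) (simp add: field_simps)
qed

lemma sum_disjoint_balls:
  assumes "finite J" "disjoint_family_on (\<lambda>i. ball (c i) (r i)) J" "f \<in> borel_measurable M"
  shows "(\<Sum>i\<in>J. \<integral>\<^sup>+y\<in>ball (c i) (r i). f y \<partial>M) = (\<integral>\<^sup>+y\<in>(\<Union>i\<in>J. ball (c i) (r i)). f y \<partial>M)"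
proof -
  have "(\<Sum>i\<in>J. \<integral>\<^sup>+y\<in>ball (c i) (r i). f y \<partial>M) = (\<integral>\<^sup>+y. (\<Sum>i\<in>J. f y * indicator (ball (c i) (r i)) y) \<partial>M)"
    by (intro nn_integral_sum[symmetric] borel_measurable_times_ennreal borel_measurable_indicator) (auto simp: assms(3))
  also have "\<dots> = (\<integral>\<^sup>+y\<in>(\<Union>i\<in>J. ball (c i) (r i)). f y \<partial>M)"
    using assms(1,2) by (intro nn_integral_cong) (simp add: indicator_UN_disjoint sum_distrib_left)
  finally show ?thesis .
qed

text \<open>For an \<open>e\<close>-separated set the balls of radius \<open>e / 2\<close> are
  disjoint, lie in \<open>ball x (R + e)\<close>, and each has at least the fraction
  \<open>1 / c\<^sub>D ^ k\<close> of its volume. This bounds the cardinality, and a separated set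
  of maximal cardinality is an \<open>e\<close>-net.\<close>

lemma totally_bounded_cball:
  assumes e: "0 < e"
  shows "\<exists>F. finite F \<and> cball (x::'a) R \<subseteq> (\<Union>y\<in>F. ball y e)"
proof (cases "R < 0")
  case True
  then have "cball x R = {}" by auto
  then show ?thesis by auto
next
  case False
  define sep where "sep F \<longleftrightarrow> finite F \<and> F \<subseteq> cball x R \<and> (\<forall>a\<in>F. \<forall>b\<in>F. a \<noteq> b \<longrightarrow> e \<le> dist a b)" for F
  obtain k :: nat where k: "2 * R + e \<le> 2 ^ k * (e / 2)"
    using exists_power_ge[of "e / 2" "2 * R + e"] e by auto
  have card: "real (card F) \<le> c\<^sub>D ^ k" if "sep F" for F
  proof -
    have F: "finite F" "F \<subseteq> cball x R" "\<And>a b. a \<in> F \<Longrightarrow> b \<in> F \<Longrightarrow> a \<noteq> b \<Longrightarrow> e \<le> dist a b"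
      using that by (auto simp: sep_def)
    have disj: "disjoint_family_on (\<lambda>y. ball y (e / 2)) F"
      unfolding disjoint_family_on_def
    proof (intro ballI impI, rule ccontr)
      fix a b assume ab: "a \<in> F" "b \<in> F" "a \<noteq> b" "ball a (e / 2) \<inter> ball b (e / 2) \<noteq> {}"
      then obtain z where "dist a z < e / 2" "dist b z < e / 2" by auto
      then show False using F(3)[OF ab(1-3)] dist_triangle2[of a b z] by linarith
    qed
    have "(\<Sum>y\<in>F. emeasure M (ball y (e / 2))) = emeasure M (\<Union>y\<in>F. ball y (e / 2))"
      by (rule sum_emeasure[OF _ disj F(1)]) auto
    also have "\<dots> \<le> emeasure M (ball x (R + e))"
    proof (rule emeasure_mono)
      show "(\<Union>y\<in>F. ball y (e / 2)) \<subseteq> ball x (R + e)"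
      proof
        fix z assume "z \<in> (\<Union>y\<in>F. ball y (e / 2))"
        then obtain y where y: "y \<in> F" "dist y z < e / 2" by auto
        then have "dist x y \<le> R" using F(2) by auto
        then show "z \<in> ball x (R + e)"
          using y e dist_triangle[of x z y] by simp
      qed
    qed simp
    finally have le: "(\<Sum>y\<in>F. V y (e / 2)) \<le> V x (R + e)"
      using e False by (simp add: emeasure_open \<mu>_ball)
    have "V x (R + e) \<le> c\<^sub>D ^ k * V y (e / 2)" if "y \<in> F" for y
    proof (rule V_compare)
      have "dist x y \<le> R" using F(2) that by auto
      then show "dist x y + (R + e) \<le> 2 ^ k * (e / 2)" using k by linarith
    qed (use e in auto)
    then have "(\<Sum>y\<in>F. V x (R + e)) \<le> (\<Sum>y\<in>F. c\<^sub>D ^ k * V y (e / 2))"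
      by (rule sum_mono)
    also have "\<dots> \<le> c\<^sub>D ^ k * V x (R + e)"
      using le c\<^sub>D by (simp add: sum_distrib_left[symmetric])
    finally have "real (card F) * V x (R + e) \<le> c\<^sub>D ^ k * V x (R + e)" by simp
    then show ?thesis using V_pos[of "R + e" x] e False by simp
  qed
  define N where "N = nat \<lceil>c\<^sub>D ^ k\<rceil>"
  have cardN: "card F \<le> N" if "sep F" for F
    using card[OF that] unfolding N_def by linarith
  have "sep {}" by (simp add: sep_def)
  then obtain F where F: "sep F" "\<And>G. sep G \<Longrightarrow> card G \<le> card F"
    using ex_has_greatest_nat[of sep "{}" card "Suc N"] cardN by (metis le_imp_less_Suc)
  have "cball x R \<subseteq> (\<Union>y\<in>F. ball y e)"
  proof (rule ccontr)
    assume "\<not> ?thesis"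
    then obtain z where "z \<in> cball x R" "z \<notin> (\<Union>y\<in>F. ball y e)" by blast
    then have z: "z \<in> cball x R" "\<And>y. y \<in> F \<Longrightarrow> e \<le> dist y z"
      by (auto simp: not_less)
    then have "z \<notin> F" using e by force
    have "sep (insert z F)"
      using F(1) z by (auto simp: sep_def dist_commute)
    then have "card (insert z F) \<le> card F" by (rule F(2))
    then show False using \<open>z \<notin> F\<close> F(1) by (simp add: sep_def)
  qed
  then show ?thesis using F(1) by (auto simp: sep_def)
qed

end

section \<open>Properness and the maximal function\<close>

locale complete_doubling_measure = doubling_measure \<mu> c\<^sub>D
  for \<mu> :: "'a::complete_space set \<Rightarrow> ennreal" and c\<^sub>D :: real
begin

lemma compact_cball: "compact (cball (x::'a) R)"
  unfolding compact_eq_totally_bounded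
  using totally_bounded_cball by (auto simp: complete_eq_closed)

lemma open_compact_exhaustion:
  fixes U :: "'a set"
  assumes "open U"
  obtains K :: "nat \<Rightarrow> 'a set" where "incseq K" "\<And>m. compact (K m)" "(\<Union>m. K m) = U"
proof -
  fix a :: 'a
  define K where "K m = cball a (real m) \<inter> (\<Inter>y\<in>-U. {x. 1 / real (Suc m) \<le> dist x y})" for m
  have "compact (K m)" for m
    unfolding K_def
    by (intro compact_Int_closed compact_cball closed_INT ballI closed_Collect_le continuous_intros)
  moreover have "incseq K"
  proof (rule incseq_SucI)
    fix m
    have "1 / real (Suc (Suc m)) \<le> 1 / real (Suc m)" by (simp add: field_simps)
    note le = order_trans[OF this]
    show "K m \<subseteq> K (Suc m)"
      unfolding K_def by (intro Int_mono INF_mono' Collect_mono impI le) auto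
  qed
  moreover have "(\<Union>m. K m) = U"
  proof (intro equalityI subsetI)
    fix x assume "x \<in> (\<Union>m. K m)"
    then obtain m where "x \<in> K m" by auto
    then show "x \<in> U" by (force simp: K_def)
  next
    fix x assume "x \<in> U"
    then obtain e where e: "e > 0" "ball x e \<subseteq> U"
      using assms by (auto simp: open_contains_ball)
    obtain m1 where m1: "dist a x \<le> real m1" using real_arch_simple by blast
    obtain m2 where m2: "1 / real (Suc m2) < e" using nat_approx_posE[OF e(1)] by metis
    define m where "m = max m1 m2"
    have "1 / real (Suc m) \<le> 1 / real (Suc m2)" by (simp add: m_def field_simps)
    then have "1 / real (Suc m) \<le> dist x y" if "y \<notin> U" for y
      using e(2) that m2 by (force simp: subset_iff not_less)
    then show "x \<in> (\<Union>m. K m)"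
      using m1 by (intro UN_I[of m]) (auto simp: K_def m_def)
  qed
  ultimately show thesis using that by blast
qed

text \<open>The union of all bad balls is open, which gives the level set a measurable superset at
  once. Compact subsets of the union are covered by finitely many bad balls, to which the finite
  covering lemma applies, and they exhaust it. The factor \<open>c\<^sub>D ^ 2\<close> pays for
  tripling radii, as 3 is at most \<open>2 ^ 2\<close>.\<close>

lemma weak_type:
  assumes f: "f \<in> borel_measurable M"
  shows "\<exists>U. open U \<and> {x. \<exists>r>0. l < mean \<mu> (ball x r) f} \<subseteq> U \<and>
    l * \<mu> U \<le> ennreal (c\<^sub>D ^ 2) * (\<integral>\<^sup>+y. f y \<partial>M)"
proof -
  define P where "P = {(x, r). 0 < r \<and> l < mean \<mu> (ball x r) f}"
  define U where "U = (\<Union>(x, r)\<in>P. ball x r)"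
  have oU: "open U" unfolding U_def by auto
  have P: "l * \<mu> (ball x r) \<le> (\<integral>\<^sup>+y\<in>ball x r. f y \<partial>M)" if "(x, r) \<in> P" for x r
  proof -
    have r: "0 < r" "l < mean \<mu> (ball x r) f" using that by (auto simp: P_def)
    have "l * \<mu> (ball x r) \<le> mean \<mu> (ball x r) f * \<mu> (ball x r)"
      using r(2) by (intro mult_right_mono) auto
    also have "\<dots> = (\<integral>\<^sup>+y\<in>ball x r. f y \<partial>M)"
      unfolding mean_def ennreal_divide_times
      using V_pos[OF r(1), of x] by (simp add: \<mu>_ball[OF r(1)] divide_ennreal)
    finally show ?thesis .
  qed
  have main: "l * \<mu> K \<le> ennreal (c\<^sub>D ^ 2) * (\<integral>\<^sup>+y. f y \<partial>M)" if K: "compact K" "K \<subseteq> U" for K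
  proof -
    obtain I where I: "I \<subseteq> P" "finite I" "K \<subseteq> (\<Union>i\<in>I. ball (fst i) (snd i))"
    proof (rule compactE_image[OF K(1), of P "\<lambda>i. ball (fst i) (snd i)"])
      show "K \<subseteq> (\<Union>i\<in>P. ball (fst i) (snd i))" using K(2) by (simp add: U_def case_prod_beta)
    qed auto
    obtain J where J: "J \<subseteq> I" "disjoint_family_on (\<lambda>i. ball (fst i) (snd i)) J"
      "(\<Union>i\<in>I. ball (fst i) (snd i)) \<subseteq> (\<Union>i\<in>J. ball (fst i) (3 * snd i))"
      using finite_Vitali[OF I(2), of fst snd] by blast
    have fJ: "finite J" using J(1) I(2) by (rule finite_subset)
    have pos: "0 < snd i" if "i \<in> J" for i using that J(1) I(1) by (auto simp: P_def)
    have "\<mu> K = emeasure M K"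
      using K(1) by (intro emeasure_M[symmetric] borel_sets_M borel_closed compact_imp_closed)
    also have "\<dots> \<le> emeasure M (\<Union>i\<in>J. ball (fst i) (3 * snd i))"
      using I(3) J(3) by (intro emeasure_mono open_sets_M) auto
    also have "\<dots> \<le> (\<Sum>i\<in>J. emeasure M (ball (fst i) (3 * snd i)))"
      by (rule emeasure_subadditive_finite[OF fJ]) auto
    also have "\<dots> \<le> (\<Sum>i\<in>J. ennreal (c\<^sub>D ^ 2) * \<mu> (ball (fst i) (snd i)))"
    proof (rule sum_mono)
      fix i assume "i \<in> J"
      from pos[OF this] V_compare[of "fst i" "fst i" "3 * snd i" 2 "snd i"]
      show "emeasure M (ball (fst i) (3 * snd i)) \<le> ennreal (c\<^sub>D ^ 2) * \<mu> (ball (fst i) (snd i))"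
        using c\<^sub>D by (simp add: emeasure_open \<mu>_ball ennreal_leI flip: ennreal_mult)
    qed
    finally have "l * \<mu> K \<le> l * (\<Sum>i\<in>J. ennreal (c\<^sub>D ^ 2) * \<mu> (ball (fst i) (snd i)))"
      by (intro mult_left_mono) auto
    also have "\<dots> = ennreal (c\<^sub>D ^ 2) * (\<Sum>i\<in>J. l * \<mu> (ball (fst i) (snd i)))"
      by (simp add: sum_distrib_left mult.left_commute)
    also have "\<dots> \<le> ennreal (c\<^sub>D ^ 2) * (\<Sum>i\<in>J. \<integral>\<^sup>+y\<in>ball (fst i) (snd i). f y \<partial>M)"
      using J(1) I(1) P by (intro mult_left_mono sum_mono) auto
    also have "\<dots> \<le> ennreal (c\<^sub>D ^ 2) * (\<integral>\<^sup>+y. f y \<partial>M)"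
      unfolding sum_disjoint_balls[OF fJ J(2) f]
      by (intro mult_left_mono nn_integral_mono) (auto simp: indicator_def)
    finally show ?thesis .
  qed
  obtain K where K: "incseq K" "\<And>m. compact (K m)" "(\<Union>m. K m) = U"
    using open_compact_exhaustion[OF oU] by blast
  have Ks: "K m \<in> sets M" for m
    using K(2) by (intro borel_sets_M borel_closed compact_imp_closed)
  have "\<mu> U = (SUP m. \<mu> (K m))"
    using SUP_emeasure_incseq[of K M, OF image_subsetI[OF Ks] K(1)] Ks oU
    by (simp add: K(3) emeasure_M emeasure_open)
  then have "l * \<mu> U = (SUP m. l * \<mu> (K m))"
    by (simp add: SUP_mult_left_ennreal)
  also have "\<dots> \<le> ennreal (c\<^sub>D ^ 2) * (\<integral>\<^sup>+y. f y \<partial>M)"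
    by (rule SUP_least, rule main) (use K in auto)
  finally have "l * \<mu> U \<le> ennreal (c\<^sub>D ^ 2) * (\<integral>\<^sup>+y. f y \<partial>M)" .
  moreover have "{x. \<exists>r>0. l < mean \<mu> (ball x r) f} \<subseteq> U"
    by (force simp: U_def P_def)
  ultimately show ?thesis using oU by blast
qed

text \<open>Where the maximal function is unbounded, the point lies in every \<open>U n\<close>, and
  the measure of \<open>U n\<close> is at most a constant divided by \<open>n\<close>.\<close>

lemma AE_maximal_finite:
  assumes f: "f \<in> borel_measurable M" "(\<integral>\<^sup>+y. f y \<partial>M) < top"
  shows "AE x in M. \<exists>c<top. \<forall>r>0. mean \<mu> (ball x r) f \<le> c"
proof -
  define I where "I = ennreal (c\<^sub>D ^ 2) * (\<integral>\<^sup>+y. f y \<partial>M)"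
  have "\<forall>n::nat. \<exists>U. open U \<and> {x. \<exists>r>0. of_nat n < mean \<mu> (ball x r) f} \<subseteq> U \<and> of_nat n * \<mu> U \<le> I"
    unfolding I_def by (intro allI weak_type[OF f(1)])
  from choice[OF this] obtain U where "\<forall>n. open (U n) \<and>
    {x. \<exists>r>0. of_nat n < mean \<mu> (ball x r) f} \<subseteq> U n \<and> of_nat n * \<mu> (U n) \<le> I" by blast
  then have U: "\<And>n. open (U n)" "\<And>n. {x. \<exists>r>0. of_nat n < mean \<mu> (ball x r) f} \<subseteq> U n" 
    "\<And>n::nat. of_nat n * \<mu> (U n) \<le> I" by auto
  have I: "I < top" using f(2) by (simp add: I_def ennreal_mult_less_top)
  then obtain i where i: "I = ennreal i" "0 \<le> i" by (cases I) auto
  define N where "N = (\<Inter>n. U n)"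
  have Ns: "N \<in> sets M" unfolding N_def using U(1) by auto
  have "emeasure M N \<le> 0"
  proof (rule ennreal_le_epsilon)
    fix e :: real assume e: "0 < e"
    obtain n :: nat where n: "i / e < real n" using reals_Archimedean2 by blast
    then have n0: "0 < real n" using i e by (smt (verit) divide_nonneg_pos)
    have "ennreal (real n) * emeasure M N \<le> ennreal (real n) * \<mu> (U n)"
      using U(1) by (intro mult_left_mono) (auto simp: emeasure_open[symmetric] N_def intro!: emeasure_mono)
    also have "\<dots> \<le> ennreal i" using U(3)[of n] i by (simp add: ennreal_of_nat_eq_real_of_nat)
    also have "\<dots> \<le> ennreal (real n * e)" using n e by (intro ennreal_leI) (simp add: field_simps)
    also have "\<dots> = ennreal (real n) * ennreal e" using n0 e by (simp add: ennreal_mult)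
    finally show "emeasure M N \<le> 0 + ennreal e"
      using n0 by (simp add: ennreal_mult_le_mult_iff)
  qed
  then have "N \<in> null_sets M" using Ns by (auto simp: null_sets_def)
  then show ?thesis
  proof (rule AE_I')
    show "{x \<in> space M. \<not> (\<exists>c<top. \<forall>r>0. mean \<mu> (ball x r) f \<le> c)} \<subseteq> N"
    proof
      fix x assume "x \<in> {x \<in> space M. \<not> (\<exists>c<top. \<forall>r>0. mean \<mu> (ball x r) f \<le> c)}"
      then have "\<exists>r>0. of_nat n < mean \<mu> (ball x r) f" for n :: nat
        by (auto simp: not_le ennreal_of_nat_eq_real_of_nat dest: spec[of _ "ennreal (real n)"])
      then show "x \<in> N" using U(2) by (auto simp: N_def)
    qed
  qed
qed

end

section \<open>Regularity of the measure and lower semicontinuous majorants\<close>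

context doubling_measure
begin

lemma emeasure_decseq_less:
  assumes X: "decseq X" "\<And>n. X n \<in> sets M" "emeasure M (X 0) < top" and lt: "emeasure M (\<Inter>n. X n) < e"
  shows "\<exists>n. emeasure M (X n) < e"
proof -
  have "(\<lambda>n. emeasure M (X n)) \<longlonglongrightarrow> emeasure M (\<Inter>n. X n)"
  proof (rule Lim_emeasure_decseq)
    show "emeasure M (X n) \<noteq> \<infinity>" for n
    proof -
      have "emeasure M (X n) \<le> emeasure M (X 0)"
        using decseqD[OF X(1), of 0 n] X(2) by (intro emeasure_mono) auto
      then show ?thesis using X(3) by (simp add: order.strict_trans1 less_top)
    qed
  qed (use X in auto)
  then have "eventually (\<lambda>n. emeasure M (X n) < e) sequentially"
    using lt by (rule order_tendstoD)
  then show ?thesis by (auto simp: eventually_sequentially)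
qed

text \<open>Approximating from both sides makes the induction over Borel sets symmetric under
  complements. The ball provides the finite measure that continuity from above requires, both for
  open sets and for countable unions.\<close>

lemma regular_in_ball:
  assumes R: "0 < R" and A: "A \<in> sets borel" and e: "0 < (e::real)"
  shows "\<exists>U F. open U \<and> closed F \<and> F \<subseteq> A \<and> A \<subseteq> U \<and> emeasure M ((U - F) \<inter> ball a R) < ennreal e"
proof -
  have fin: "emeasure M (X \<inter> ball a R) < top" for X
  proof -
    have "emeasure M (X \<inter> ball a R) \<le> emeasure M (ball a R)" by (intro emeasure_mono) auto
    also have "\<dots> < top" using R by (simp add: emeasure_open \<mu>_ball)
    finally show ?thesis .
  qed
  have clM: "closed F \<Longrightarrow> F \<in> sets M" for F by (intro borel_sets_M borel_closed)
  have "A \<in> sigma_sets UNIV {S. open S}" using A by (simp add: sets_borel)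
  then show ?thesis using e
  proof (induction arbitrary: e rule: sigma_sets.induct)
    case (Basic A)
    then have oA: "open A" by simp
    define F where "F m = (\<Inter>y\<in>-A. {x. 1 / real (Suc m) \<le> dist x y})" for m
    have F: "closed (F m)" for m
      unfolding F_def by (intro closed_INT ballI closed_Collect_le continuous_intros)
    have FA: "F m \<subseteq> A" for m by (force simp: F_def)
    have "\<exists>m. emeasure M ((A - F m) \<inter> ball a R) < ennreal e"
    proof (rule emeasure_decseq_less)
      show "decseq (\<lambda>m. (A - F m) \<inter> ball a R)"
      proof (rule decseq_SucI)
        fix m
        have "1 / real (Suc (Suc m)) \<le> 1 / real (Suc m)" by (simp add: field_simps)
        note le = order_trans[OF this]
        have "F m \<subseteq> F (Suc m)"
          unfolding F_def by (intro INF_mono' Collect_mono impI le) auto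
        then show "(A - F (Suc m)) \<inter> ball a R \<subseteq> (A - F m) \<inter> ball a R" by blast
      qed
      have "A \<subseteq> (\<Union>m. F m)"
      proof
        fix x assume "x \<in> A"
        then obtain d where d: "d > 0" "ball x d \<subseteq> A" using oA by (auto simp: open_contains_ball)
        obtain m where m: "1 / real (Suc m) < d" using nat_approx_posE[OF d(1)] by metis
        have "1 / real (Suc m) \<le> dist x y" if "y \<notin> A" for y
          using d(2) that m by (force simp: subset_iff not_less)
        then show "x \<in> (\<Union>m. F m)" by (auto simp: F_def)
      qed
      then have "(\<Inter>m. (A - F m) \<inter> ball a R) = {}" by blast
      then show "emeasure M (\<Inter>m. (A - F m) \<inter> ball a R) < ennreal e" using Basic(2) by simp
    qed (use sets.Int[OF sets.Diff[OF open_sets_M[OF oA] clM[OF F]]] fin in auto)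
    then show ?case using oA F FA by blast
  next
    case Empty
    then show ?case by (intro exI[of _ "{}"]) auto
  next
    case (Compl A)
    from Compl.IH[OF Compl.prems] obtain U F where UF: "open U" "closed F" "F \<subseteq> A" "A \<subseteq> U"
      "emeasure M ((U - F) \<inter> ball a R) < ennreal e"
      by blast
    have "- F - - U = U - F" by auto
    then have "emeasure M ((- F - - U) \<inter> ball a R) < ennreal e" using UF(5) by simp
    moreover have "open (- F)" "closed (- U)" using UF(1,2) by auto
    moreover have "- U \<subseteq> UNIV - A" "UNIV - A \<subseteq> - F" using UF(3,4) by auto
    ultimately show ?case by blast
  next
    case (Union A)
    \<comment> \<open>The sum is \<open>e / 2\<close>, strictly below \<open>e\<close>. The slack is
      spent on replacing the union of all \<open>F i\<close>, which need not be closed, by a finite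
      one.\<close>
    define e' where "e' i = e / 2 * (1 / 2) ^ Suc i" for i
    have e': "0 < e' i" for i using Union.prems by (simp add: e'_def)
    have "\<forall>i. \<exists>U F. open U \<and> closed F \<and> F \<subseteq> A i \<and> A i \<subseteq> U \<and> emeasure M ((U - F) \<inter> ball a R) < ennreal (e' i)"
      using Union.IH e' by blast
    from choice[OF this] obtain U where "\<forall>i. \<exists>F. open (U i) \<and> closed F \<and> F \<subseteq> A i \<and> A i \<subseteq> U i \<and>
      emeasure M ((U i - F) \<inter> ball a R) < ennreal (e' i)" by blast
    from choice[OF this] obtain F where UF: "\<And>i. open (U i)" "\<And>i. closed (F i)" "\<And>i. F i \<subseteq> A i" "\<And>i. A i \<subseteq> U i"
      "\<And>i. emeasure M ((U i - F i) \<inter> ball a R) < ennreal (e' i)" by blast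
    define X where "X m = ((\<Union>i. U i) - (\<Union>i<m. F i)) \<inter> ball a R" for m :: nat
    have Fc: "closed (\<Union>i<m. F i)" for m :: nat using UF(2) by auto
    have Xs: "X m \<in> sets M" for m
      unfolding X_def using UF(1) by (intro sets.Int sets.Diff open_sets_M clM Fc open_UN open_ball) auto
    have UFM: "(U i - F i) \<inter> ball a R \<in> sets M" for i
      using UF(1,2) by (intro sets.Int sets.Diff open_sets_M clM open_ball) auto
    have "(\<Inter>m. X m) \<subseteq> (\<Union>i. (U i - F i) \<inter> ball a R)"
    proof
      fix x assume x: "x \<in> (\<Inter>m. X m)"
      then have "x \<in> X 0" by blast
      then obtain i where "x \<in> U i" "x \<in> ball a R" by (auto simp: X_def)
      moreover have "x \<in> X (Suc i)" using x by blast
      then have "x \<notin> F i" by (auto simp: X_def)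
      ultimately show "x \<in> (\<Union>i. (U i - F i) \<inter> ball a R)" by blast
    qed
    then have "emeasure M (\<Inter>m. X m) \<le> emeasure M (\<Union>i. (U i - F i) \<inter> ball a R)"
      by (rule emeasure_mono[OF _ sets.countable_UN[OF image_subsetI[OF UFM]]])
    also have "\<dots> \<le> (\<Sum>i. emeasure M ((U i - F i) \<inter> ball a R))"
      by (rule emeasure_subadditive_countably[OF image_subsetI[OF UFM]])
    also have "\<dots> \<le> (\<Sum>i. ennreal (e' i))"
      using UF(5) by (intro suminf_le) (auto intro: less_imp_le)
    also have "\<dots> = ennreal (e / 2 * 1)"
      using e' sums_mult[OF power_half_series, of "e / 2"] unfolding e'_def
      by (intro suminf_ennreal_eq) (auto simp: less_imp_le)
    also have "\<dots> < ennreal e" using Union.prems by (intro ennreal_lessI) auto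
    finally have "\<exists>m. emeasure M (X m) < ennreal e"
    proof (intro emeasure_decseq_less Xs)
      show "decseq X"
        by (rule decseq_SucI) (auto simp: X_def)
      show "emeasure M (X 0) < top" unfolding X_def by (rule fin)
    qed
    then obtain m where m: "emeasure M (((\<Union>i. U i) - (\<Union>i<m. F i)) \<inter> ball a R) < ennreal e"
      unfolding X_def ..
    have "open (\<Union>i. U i)" using UF(1) by auto
    moreover have "(\<Union>i<m. F i) \<subseteq> (\<Union>i. A i)" "(\<Union>i. A i) \<subseteq> (\<Union>i. U i)" using UF(3,4) by blast+
    ultimately show ?case
      using m Fc[of m] by (intro exI[of _ "\<Union>i. U i"] exI[of _ "\<Union>i<m. F i"] conjI)
  qed
qed

text \<open>Borel regularity gives the part of \<open>A\<close> in a ball a Borel hull of the same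
  finite measure, hence differing from it by a null set, and the Borel case applies to the hull. The
  parts are glued with geometrically decreasing errors.\<close>

lemma outer_regular_M:
  assumes A: "A \<in> sets M" and e: "0 < (e::real)"
  shows "\<exists>U. open U \<and> A \<subseteq> U \<and> emeasure M (U - A) \<le> ennreal e"
proof -
  fix a :: 'a
  define B where "B n = ball a (real (Suc n))" for n
  define e' where "e' i = e * (1 / 2) ^ Suc i" for i
  have e': "0 < e' i" for i using e by (simp add: e'_def)
  have "\<exists>U. open U \<and> A \<inter> B n \<subseteq> U \<and> U \<subseteq> B n \<and> emeasure M (U - A) \<le> ennreal (e' n)" for n
  proof -
    obtain H where H: "H \<in> sets borel" "A \<inter> B n \<subseteq> H" "\<mu> (A \<inter> B n) = \<mu> H"
      using bro unfolding borel_regular_outer_measure_def by meson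
    have AB: "A \<inter> B n \<in> sets M" using A by (auto simp: B_def)
    have HM: "H \<in> sets M" using H(1) by (rule borel_sets_M)
    have "emeasure M (A \<inter> B n) \<le> emeasure M (B n)" using A by (intro emeasure_mono) (auto simp: B_def)
    also have "\<dots> < top" by (simp add: emeasure_open \<mu>_ball B_def)
    finally have fin: "emeasure M (A \<inter> B n) < top" .
    then have "emeasure M (H - A \<inter> B n) = emeasure M H - emeasure M (A \<inter> B n)"
      using H HM AB by (intro emeasure_Diff) auto
    also have "\<dots> = 0"
      using H(3) HM AB fin by (simp add: emeasure_M)
    finally have null: "emeasure M (H - A \<inter> B n) = 0" .
    obtain U F where UF: "open U" "closed F" "F \<subseteq> H" "H \<subseteq> U" "emeasure M ((U - F) \<inter> B n) < ennreal (e' n)"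
      using regular_in_ball[OF _ H(1) e', of "real (Suc n)" a n] unfolding B_def by auto
    have FM: "F \<in> sets M" using UF(2) by (intro borel_sets_M borel_closed)
    have "emeasure M (U \<inter> B n - A) \<le> emeasure M (((U - F) \<inter> B n) \<union> (H - A \<inter> B n))"
    proof (rule emeasure_mono)
      show "U \<inter> B n - A \<subseteq> ((U - F) \<inter> B n) \<union> (H - A \<inter> B n)" using UF(3) by auto
      show "((U - F) \<inter> B n) \<union> (H - A \<inter> B n) \<in> sets M"
        using UF(1) unfolding B_def by (intro sets.Un sets.Int sets.Diff open_sets_M open_ball FM HM AB[unfolded B_def])
    qed
    also have "\<dots> \<le> emeasure M ((U - F) \<inter> B n) + emeasure M (H - A \<inter> B n)"
      using UF(1) unfolding B_def
      by (intro emeasure_subadditive sets.Int sets.Diff open_sets_M open_ball FM HM AB[unfolded B_def])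
    also have "\<dots> \<le> ennreal (e' n)" using null UF(5) by simp
    finally have "emeasure M (U \<inter> B n - A) \<le> ennreal (e' n)" .
    moreover have "open (U \<inter> B n)" using UF(1) by (auto simp: B_def)
    ultimately show ?thesis using H(2) UF(4) by (intro exI[of _ "U \<inter> B n"]) auto
  qed
  then have "\<forall>n. \<exists>U. open U \<and> A \<inter> B n \<subseteq> U \<and> U \<subseteq> B n \<and> emeasure M (U - A) \<le> ennreal (e' n)" by blast
  from choice[OF this] obtain U where U: "\<And>n. open (U n)" "\<And>n. A \<inter> B n \<subseteq> U n" "\<And>n. emeasure M (U n - A) \<le> ennreal (e' n)"
    by blast
  have "A \<subseteq> (\<Union>n. U n)"
  proof
    fix x assume "x \<in> A"
    obtain n where "dist a x < real n" using reals_Archimedean2 by blast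
    then have "x \<in> B n" by (simp add: B_def)
    then show "x \<in> (\<Union>n. U n)" using \<open>x \<in> A\<close> U(2) by blast
  qed
  moreover have "emeasure M ((\<Union>n. U n) - A) \<le> ennreal e"
  proof -
    have "(\<Union>n. U n) - A = (\<Union>n. U n - A)" by auto
    then have "emeasure M ((\<Union>n. U n) - A) = emeasure M (\<Union>n. U n - A)" by simp
    also have "\<dots> \<le> (\<Sum>n. emeasure M (U n - A))"
      using U(1) A by (intro emeasure_subadditive_countably) auto
    also have "\<dots> \<le> (\<Sum>i. ennreal (e' i))"
      using U(3) by (intro suminf_le) auto
    also have "\<dots> = ennreal (e * 1)"
      using e' sums_mult[OF power_half_series, of e] unfolding e'_def
      by (intro suminf_ennreal_eq) (auto simp: less_imp_le)
    finally show ?thesis by simp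
  qed
  ultimately show ?thesis using U(1) by (intro exI[of _ "\<Union>n. U n"]) auto
qed

text \<open>A version of the Vitali--Caratheodory theorem up to a factor; the dyadic level sets
  of \<open>g\<close> are enlarged to open sets.\<close>

lemma Vitali_Caratheodory:
  assumes g: "g \<in> borel_measurable M" and \<eta>: "0 < (\<eta>::real)" and e: "0 < (e::real)"
  obtains H f where "\<And>c. open {x. c < H x}" "f \<in> borel_measurable M" "(\<integral>\<^sup>+x. f x \<partial>M) \<le> ennreal e"
    "\<And>x. g x \<le> H x" "\<And>x. ennreal \<eta> \<le> H x" "\<And>x. H x \<le> ennreal \<eta> + 2 * g x + f x"
proof -
  \<comment> \<open>On \<open>A k\<close> the majorant is at least \<open>b k\<close>, twice the
    level that defines \<open>A k\<close>. This is the factor 2 before \<open>g x\<close> in the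
    conclusion, and finally the \<open>2 powr (1 / p)\<close> in the Hardy inequality.\<close>
  define A where "A k = {x. ennreal (\<eta> * 2 ^ k) < g x}" for k :: nat
  define b where "b k = \<eta> * 2 ^ Suc k" for k :: nat
  have b: "0 < b k" for k using \<eta> by (simp add: b_def)
  define e' where "e' k = (e * (1 / 2) ^ Suc k) / b k" for k
  have e': "0 < e' k" for k using e b by (simp add: e'_def)
  have AM: "A k \<in> sets M" for k
    using borel_measurable_less[OF borel_measurable_const g, of "ennreal (\<eta> * 2 ^ k)"]
    by (simp add: A_def)
  have "\<forall>k. \<exists>U. open U \<and> A k \<subseteq> U \<and> emeasure M (U - A k) \<le> ennreal (e' k)"
    using outer_regular_M[OF AM e'] by blast
  from choice[OF this] obtain U where U: "\<And>k. open (U k)" "\<And>k. A k \<subseteq> U k" "\<And>k. emeasure M (U k - A k) \<le> ennreal (e' k)"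
    by blast
  \<comment> \<open>A supremum of multiples of indicators of open sets is lower semicontinuous. What
    is added on the sets \<open>U k - A k\<close> is charged to \<open>f\<close>.\<close>
  define H where "H x = max (ennreal \<eta>) (SUP k. ennreal (b k) * indicator (U k) x)" for x
  define f where "f x = (\<Sum>k. ennreal (b k) * indicator (U k - A k) x)" for x
  have UAM: "U k - A k \<in> sets M" for k using U(1) AM by auto
  show thesis
  proof
    show "open {x. c < H x}" for c
    proof (cases "c < ennreal \<eta>")
      case True
      then have "{x. c < H x} = UNIV" by (auto simp: H_def less_max_iff_disj)
      then show ?thesis by simp
    next
      case False
      have "{x. c < H x} = (\<Union>k\<in>{k. c < ennreal (b k)}. U k)"
        using False by (auto simp: H_def less_max_iff_disj less_SUP_iff indicator_def)
      then show ?thesis using U(1) by auto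
    qed
    show "f \<in> borel_measurable M"
      unfolding f_def using UAM
      by (intro borel_measurable_suminf_order borel_measurable_times_ennreal borel_measurable_indicator) auto
    have "(\<integral>\<^sup>+x. f x \<partial>M) = (\<Sum>k. \<integral>\<^sup>+x. ennreal (b k) * indicator (U k - A k) x \<partial>M)"
      unfolding f_def using UAM
      by (intro nn_integral_suminf borel_measurable_times_ennreal borel_measurable_indicator) auto
    also have "\<dots> = (\<Sum>k. ennreal (b k) * emeasure M (U k - A k))"
      using UAM by (simp add: nn_integral_cmult_indicator)
    also have "\<dots> \<le> (\<Sum>k. ennreal (e * (1 / 2) ^ Suc k))"
    proof (rule suminf_le)
      fix k
      have "ennreal (b k) * emeasure M (U k - A k) \<le> ennreal (b k) * ennreal (e' k)"
        using U(3) by (intro mult_left_mono) auto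
      also have "\<dots> = ennreal (e * (1 / 2) ^ Suc k)"
        using b[of k] e'[of k] by (simp add: e'_def flip: ennreal_mult)
      finally show "ennreal (b k) * emeasure M (U k - A k) \<le> ennreal (e * (1 / 2) ^ Suc k)" .
    qed auto
    also have "\<dots> = ennreal (e * 1)"
      using e sums_mult[OF power_half_series, of e] by (intro suminf_ennreal_eq) auto
    finally show "(\<integral>\<^sup>+x. f x \<partial>M) \<le> ennreal e" by simp
    show "ennreal \<eta> \<le> H x" for x by (simp add: H_def)
    have Hb: "ennreal (b k) \<le> H x" if "ennreal (\<eta> * 2 ^ k) < g x" for k x
    proof -
      have "x \<in> U k" using that U(2) by (auto simp: A_def)
      then have "ennreal (b k) \<le> (SUP k. ennreal (b k) * indicator (U k) x)"
        by (intro SUP_upper2[of k]) auto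
      then show ?thesis by (simp add: H_def max.coboundedI2)
    qed
    show "g x \<le> H x" for x
    proof (rule dense_le)
      fix c assume c: "c < g x"
      then have "c < top" by (rule order.strict_trans2) simp
      then obtain c' where c': "c = ennreal c'" "0 \<le> c'" by (cases c) auto
      show "c \<le> H x"
      proof (cases "c' \<le> \<eta>")
        case True
        then show ?thesis using c' by (auto simp: H_def intro!: max.coboundedI1 ennreal_leI)
      next
        case False
        have ex: "\<exists>k. c' \<le> \<eta> * 2 ^ k"
          using exists_power_ge[OF \<eta>, of c'] by (simp add: mult.commute)
        \<comment> \<open>By minimality of \<open>k\<close>, \<open>c'\<close> and so
          \<open>g x\<close> exceeds the preceding level \<open>\<eta> * 2 ^ (k - 1)\<close>; at
          such points the majorant is at least \<open>\<eta> * 2 ^ k\<close>, which is at least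
          \<open>c'\<close>.\<close>
        define k where "k = (LEAST k. c' \<le> \<eta> * 2 ^ k)"
        have k: "c' \<le> \<eta> * 2 ^ k" unfolding k_def by (rule LeastI_ex[OF ex])
        have "k \<noteq> 0" using k False by (intro notI) simp
        then obtain j where j: "k = Suc j" by (cases k) auto
        then have "\<not> c' \<le> \<eta> * 2 ^ j" using not_less_Least[of j "\<lambda>k. c' \<le> \<eta> * 2 ^ k"] k_def by auto
        then have "ennreal (\<eta> * 2 ^ j) < g x" using c c' by (meson ennreal_leI less_imp_le not_le order.strict_trans1)
        from Hb[OF this] have "ennreal (b j) \<le> H x" .
        moreover have "c \<le> ennreal (b j)" using k c' by (auto simp: b_def j intro: ennreal_leI)
        ultimately show ?thesis by simp
      qed
    qed
    show "H x \<le> ennreal \<eta> + 2 * g x + f x" for x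
      unfolding H_def
    proof (rule max.boundedI)
      show "ennreal \<eta> \<le> ennreal \<eta> + 2 * g x + f x" by (simp add: add_increasing2 add.assoc)
      show "(SUP k. ennreal (b k) * indicator (U k) x) \<le> ennreal \<eta> + 2 * g x + f x"
      proof (rule SUP_least)
        fix k
        show "ennreal (b k) * indicator (U k) x \<le> ennreal \<eta> + 2 * g x + f x"
        proof (cases "x \<in> A k")
          case True
          have "ennreal (b k) = 2 * ennreal (\<eta> * 2 ^ k)"
            using \<eta> by (simp add: b_def ennreal_mult' mult.left_commute flip: ennreal_numeral)
          also have "\<dots> \<le> 2 * g x" using True by (intro mult_left_mono) (auto simp: A_def)
          finally have "ennreal (b k) * indicator (U k) x \<le> 2 * g x"
            by (auto simp: indicator_def)
          then show ?thesis by (simp add: add_increasing add_increasing2 add.assoc)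
        next
          case False
          then have "ennreal (b k) * indicator (U k) x = ennreal (b k) * indicator (U k - A k) x"
            by (auto simp: indicator_def)
          also have "\<dots> \<le> f x"
          proof -
            define s where "s k = ennreal (b k) * indicator (U k - A k) x" for k
            have "sum s {k} \<le> suminf s" by (rule sum_le_suminf) auto
            then show ?thesis by (simp add: f_def s_def[symmetric])
          qed
          finally show ?thesis by (simp add: add_increasing)
        qed
      qed
    qed
  qed
qed

end

section \<open>The estimate for continuous functions\<close>

lemma modulus_empty: "modulus \<mu> p {} = 0"
proof -
  have "modulus \<mu> p {} \<le> (\<integral>\<^sup>+x. ennpowr ((\<lambda>_. 0) x) p \<partial>carath \<mu>)"
    unfolding modulus_def by (rule INF_lower) auto
  also have "\<dots> = 0" by (simp add: ennpowr_def)
  finally show ?thesis by simp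
qed

lemma ennpowr_ennreal [simp]: "0 \<le> a \<Longrightarrow> ennpowr (ennreal a) p = ennreal (a powr p)"
  by (simp add: ennpowr_def)

locale poincare_space = complete_doubling_measure \<mu> c\<^sub>D
  for \<mu> :: "'a::complete_space set \<Rightarrow> ennreal" and c\<^sub>D :: real +
  fixes p c\<^sub>P \<tau> :: real
  assumes p: "1 < p" and c\<^sub>P: "0 < c\<^sub>P" and \<tau>: "1 \<le> \<tau>"
    and poincare: "0 < r \<Longrightarrow> locally_integrable \<mu> u \<Longrightarrow> weak_upper_gradient \<mu> p u g \<Longrightarrow>
      mean \<mu> (ball x r) (\<lambda>y. e2ennreal \<bar>u y - ereal (average \<mu> (ball x r) u)\<bar>)
        \<le> ennreal (c\<^sub>P * r) * ennpowr (mean \<mu> (ball x (\<tau> * r)) (\<lambda>y. ennpowr (g y) p)) (1 / p)"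

text \<open>The properties of chain potentials that enter the boundary estimate. The parameters
  \<open>e\<close>, \<open>n\<close> and \<open>N\<close> yield continuity and integrability; they
  do not appear in the constants.\<close>

locale test_function = poincare_space \<mu> c\<^sub>D p c\<^sub>P \<tau>
  for \<mu> :: "'a::complete_space set \<Rightarrow> ennreal" and c\<^sub>D p c\<^sub>P \<tau> :: real +
  fixes v k :: "'a \<Rightarrow> real" and e n N :: real
  assumes k_cont: "continuous_on UNIV k" and k_nonneg: "0 \<le> k y" and k_le: "k y \<le> N"
    and e: "0 < e" and v_nonneg: "0 \<le> v y" and v_le: "v y \<le> n"
    and v_step: "dist y z \<le> e \<Longrightarrow> \<bar>v y - v z\<bar> \<le> max (k y) (k z) * dist y z"
begin

lemma v_cont: "continuous_on UNIV v"
proof (rule continuous_onI)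
  fix y :: 'a and \<epsilon> :: real assume \<epsilon>: "0 < \<epsilon>"
  have N: "0 \<le> N" using k_nonneg[of y] k_le[of y] by linarith
  have "dist (v z) (v y) \<le> \<epsilon>" if "dist z y < min e (\<epsilon> / (N + 1))" for z
  proof -
    have "\<bar>v z - v y\<bar> \<le> max (k z) (k y) * dist z y" using that by (intro v_step) auto
    also have "\<dots> \<le> (N + 1) * dist z y"
      using k_le[of z] k_le[of y] by (intro mult_right_mono) auto
    also have "\<dots> \<le> \<epsilon>" using that N by (simp add: field_simps)
    finally show ?thesis by (simp add: dist_real_def)
  qed
  then show "\<exists>d>0. \<forall>z\<in>UNIV. dist z y < d \<longrightarrow> dist (v z) (v y) \<le> \<epsilon>"
    using e \<epsilon> N by (intro exI[of _ "min e (\<epsilon> / (N + 1))"]) auto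
qed

lemma v_measurable: "v \<in> borel_measurable M"
  by (intro borel_measurable_M borel_measurable_continuous_onI v_cont)

lemma k_measurable: "k \<in> borel_measurable M"
  by (intro borel_measurable_M borel_measurable_continuous_onI k_cont)

lemma upper_gradient: "weak_upper_gradient \<mu> p (\<lambda>x. ereal (v x)) (\<lambda>x. ennreal (k x))"
  unfolding weak_upper_gradient_def
proof (intro conjI exI[of _ "{}"])
  show "(\<lambda>x. ennreal (k x)) \<in> borel_measurable M" using k_measurable by simp
  show "modulus \<mu> p {} = 0" by (rule modulus_empty)
  show "\<forall>(a, b, \<gamma>)\<in>curves - {}.
      if \<bar>ereal (v (\<gamma> a))\<bar> \<noteq> \<infinity> \<and> \<bar>ereal (v (\<gamma> b))\<bar> \<noteq> \<infinity>
      then \<bar>ereal (v (\<gamma> a)) - ereal (v (\<gamma> b))\<bar> \<le> enn2ereal (curve_integral (\<lambda>x. ennreal (k x)) (a, b, \<gamma>))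
      else curve_integral (\<lambda>x. ennreal (k x)) (a, b, \<gamma>) = top"
  proof clarify
    fix a b and \<gamma> :: "real \<Rightarrow> 'a" assume "(a, b, \<gamma>) \<in> curves"
    then interpret rectifiable a b \<gamma> by unfold_locales (auto simp: curves_def)
    from iffD1[OF less_eq_ennreal.rep_eq curve_integral_ge[OF k_cont k_nonneg e v_step]]
    show "if \<bar>ereal (v (\<gamma> a))\<bar> \<noteq> \<infinity> \<and> \<bar>ereal (v (\<gamma> b))\<bar> \<noteq> \<infinity>
      then \<bar>ereal (v (\<gamma> a)) - ereal (v (\<gamma> b))\<bar> \<le> enn2ereal (curve_integral (\<lambda>x. ennreal (k x)) (a, b, \<gamma>))
      else curve_integral (\<lambda>x. ennreal (k x)) (a, b, \<gamma>) = top"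
      by (simp add: enn2ereal_ennreal)
  qed
qed simp

lemma v_locally_integrable: "locally_integrable \<mu> (\<lambda>x. ereal (v x))"
  unfolding locally_integrable_def
proof (intro conjI allI)
  show "(\<lambda>x. ereal (v x)) \<in> borel_measurable M" using v_measurable by simp
  show "\<exists>r>0. (\<integral>\<^sup>+y\<in>ball x r. e2ennreal \<bar>ereal (v y)\<bar> \<partial>M) < top" for x
  proof (intro exI conjI)
    have "(\<integral>\<^sup>+y\<in>ball x 1. e2ennreal \<bar>ereal (v y)\<bar> \<partial>M) \<le> (\<integral>\<^sup>+y\<in>ball x 1. ennreal n \<partial>M)"
      using v_nonneg v_le by (intro nn_integral_mono mult_right_mono) (auto simp: e2ennreal_ereal ennreal_leI)
    also have "\<dots> < top" by (simp add: nn_integral_cmult_indicator emeasure_open \<mu>_ball ennreal_mult_less_top)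
    finally show "(\<integral>\<^sup>+y\<in>ball x 1. e2ennreal \<bar>ereal (v y)\<bar> \<partial>M) < top" .
  qed simp
qed

definition avg :: "'a \<Rightarrow> real \<Rightarrow> real" where
  "avg x r = (LINT y:ball x r|M. v y) / V x r"

definition energy :: "'a \<Rightarrow> real \<Rightarrow> real" where
  "energy x r = enn2real (mean \<mu> (ball x r) (\<lambda>y. ennpowr (ennreal (k y)) p))"

lemma energy_nonneg [simp]: "0 \<le> energy x r"
  by (simp add: energy_def)

lemma nn_integral_k: "0 < r \<Longrightarrow> (\<integral>\<^sup>+y\<in>ball x r. ennreal (k y powr p) \<partial>M) = ennreal (energy x r * V x r)"
proof -
  assume r: "0 < r"
  have "(\<integral>\<^sup>+y\<in>ball x r. ennreal (k y powr p) \<partial>M) \<le> (\<integral>\<^sup>+y\<in>ball x r. ennreal (N powr p) \<partial>M)"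
    using k_nonneg k_le p by (intro nn_integral_mono mult_right_mono ennreal_leI powr_mono2) auto
  also have "\<dots> < top" using r by (simp add: nn_integral_cmult_indicator emeasure_open \<mu>_ball ennreal_mult_less_top)
  finally obtain i where i: "(\<integral>\<^sup>+y\<in>ball x r. ennreal (k y powr p) \<partial>M) = ennreal i" "0 \<le> i"
    by (cases "\<integral>\<^sup>+y\<in>ball x r. ennreal (k y powr p) \<partial>M") auto
  have "energy x r = i / V x r"
    using i V_pos[OF r, of x] k_nonneg by (simp add: energy_def mean_def \<mu>_ball[OF r] divide_ennreal)
  then show ?thesis using i V_pos[OF r, of x] by simp
qed

lemma mean_k: "0 < r \<Longrightarrow> mean \<mu> (ball x r) (\<lambda>y. ennpowr (ennreal (k y)) p) = ennreal (energy x r)"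
  using V_pos[of r x] k_nonneg by (simp add: mean_def nn_integral_k \<mu>_ball divide_ennreal)

lemma avg_dist:
  assumes r: "0 < r"
  shows "ennreal (\<bar>avg x r - c\<bar> * V x r) \<le> (\<integral>\<^sup>+y\<in>ball x r. ennreal \<bar>v y - c\<bar> \<partial>M)"
proof -
  have fin: "emeasure M (ball x r) < \<infinity>" using r by (simp add: emeasure_open \<mu>_ball)
  have iv: "set_integrable M (ball x r) v"
    unfolding set_integrable_def
    by (rule integrableI_bounded_set[OF open_sets_M[OF open_ball, of x r]
          borel_measurable_scaleR[OF borel_measurable_indicator[OF open_sets_M[OF open_ball]] v_measurable] fin, where B = n])
      (use v_nonneg v_le in auto)
  have ic: "set_integrable M (ball x r) (\<lambda>_. c)"
    using fin by (simp add: set_integrable_def)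
  have "V x r = measure M (ball x r)"
    by (simp add: V_def measure_def emeasure_open)
  then have "(LINT y:ball x r|M. v y - c) = (avg x r - c) * V x r"
    using V_pos[OF r, of x] fin
    by (simp add: set_integral_diff[OF iv ic] avg_def set_integral_const left_diff_distrib)
  then have "ennreal (\<bar>avg x r - c\<bar> * V x r) = ennreal (norm (LINT y:ball x r|M. v y - c))"
    by (simp add: abs_mult)
  also have "\<dots> \<le> (\<integral>\<^sup>+y. norm (indicator (ball x r) y *\<^sub>R (v y - c)) \<partial>M)"
    unfolding set_lebesgue_integral_def
    using set_integral_diff(1)[OF iv ic] by (intro integral_norm_bound_ennreal) (simp add: set_integrable_def)
  also have "\<dots> = (\<integral>\<^sup>+y\<in>ball x r. ennreal \<bar>v y - c\<bar> \<partial>M)"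
    by (intro nn_integral_cong) (simp add: indicator_def)
  finally show ?thesis .
qed

text \<open>The integral of the oscillation about \<open>avg x r\<close> over the smaller ball is at
  most that over the larger one; dividing by the smaller volume costs the factor
  \<open>D\<close>.\<close>

lemma avg_compare:
  assumes s: "0 < s" and r: "0 < r" and sub: "ball z s \<subseteq> ball x r" and D: "V x r \<le> D * V z s"
  shows "\<bar>avg z s - avg x r\<bar> \<le> D * c\<^sub>P * r * energy x (\<tau> * r) powr (1 / p)"
proof -
  let ?E = "c\<^sub>P * r * energy x (\<tau> * r) powr (1 / p)"
  have E0: "0 \<le> ?E" using c\<^sub>P r by simp
  have \<tau>r: "0 < \<tau> * r" using \<tau> r by simp
  have av: "average \<mu> (ball x r) (\<lambda>y. ereal (v y)) = avg x r"
    by (simp add: average_def avg_def V_def)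
  have "mean \<mu> (ball x r) (\<lambda>y. ennreal \<bar>v y - avg x r\<bar>) \<le> ennreal ?E"
    using poincare[OF r v_locally_integrable upper_gradient, of x] c\<^sub>P r
    by (simp add: av mean_k[OF \<tau>r] e2ennreal_ereal ennreal_mult)
  then have "mean \<mu> (ball x r) (\<lambda>y. ennreal \<bar>v y - avg x r\<bar>) * ennreal (V x r) \<le> ennreal ?E * ennreal (V x r)"
    by (rule mult_right_mono) simp
  also have "mean \<mu> (ball x r) (\<lambda>y. ennreal \<bar>v y - avg x r\<bar>) * ennreal (V x r) = (\<integral>\<^sup>+y\<in>ball x r. ennreal \<bar>v y - avg x r\<bar> \<partial>M)"
    using V_pos[OF r, of x] unfolding mean_def ennreal_divide_times
    by (simp add: \<mu>_ball[OF r] divide_ennreal)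
  finally have 1: "(\<integral>\<^sup>+y\<in>ball x r. ennreal \<bar>v y - avg x r\<bar> \<partial>M) \<le> ennreal (?E * V x r)"
    using E0 by (simp add: ennreal_mult)
  have "ennreal (\<bar>avg z s - avg x r\<bar> * V z s) \<le> (\<integral>\<^sup>+y\<in>ball z s. ennreal \<bar>v y - avg x r\<bar> \<partial>M)"
    by (rule avg_dist[OF s])
  also have "\<dots> \<le> (\<integral>\<^sup>+y\<in>ball x r. ennreal \<bar>v y - avg x r\<bar> \<partial>M)"
    using sub by (intro nn_integral_mono mult_left_mono) (auto simp: indicator_def)
  also have "\<dots> \<le> ennreal (?E * V x r)" by (rule 1)
  finally have "\<bar>avg z s - avg x r\<bar> * V z s \<le> ?E * V x r"
    using E0 by (simp add: ennreal_le_iff)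
  also have "\<dots> \<le> ?E * (D * V z s)" using D E0 by (rule mult_left_mono)
  finally have "\<bar>avg z s - avg x r\<bar> * V z s \<le> (D * ?E) * V z s" by (simp add: mult.assoc mult.left_commute)
  then show ?thesis using V_pos[OF s, of z] by (simp add: mult.assoc)
qed

lemma avg_tendsto:
  assumes r: "0 < r"
  shows "(\<lambda>i. avg x (r / 2 ^ i)) \<longlonglongrightarrow> v x"
proof (rule LIMSEQ_I)
  fix \<epsilon> :: real assume \<epsilon>: "0 < \<epsilon>"
  have "continuous_on UNIV v" by (rule v_cont)
  then obtain d where d: "0 < d" "\<And>y. dist y x < d \<Longrightarrow> dist (v y) (v x) < \<epsilon> / 2"
    using \<epsilon> unfolding continuous_on_iff by (metis UNIV_I half_gt_zero)
  have "(\<lambda>i. r / 2 ^ i) \<longlonglongrightarrow> 0"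
    using tendsto_mult[OF tendsto_const LIMSEQ_realpow_zero[of "1/2"], of r] by (simp add: power_one_over field_simps)
  from order_tendstoD(2)[OF this d(1)] obtain i0 where i0: "\<And>i. i \<ge> i0 \<Longrightarrow> r / 2 ^ i < d"
    by (auto simp: eventually_sequentially)
  have "norm (avg x (r / 2 ^ i) - v x) < \<epsilon>" if "i \<ge> i0" for i
  proof -
    let ?s = "r / 2 ^ i"
    have s: "0 < ?s" using r by simp
    have "ennreal (\<bar>avg x ?s - v x\<bar> * V x ?s) \<le> (\<integral>\<^sup>+y\<in>ball x ?s. ennreal \<bar>v y - v x\<bar> \<partial>M)"
      by (rule avg_dist[OF s])
    also have "\<dots> \<le> (\<integral>\<^sup>+y\<in>ball x ?s. ennreal (\<epsilon> / 2) \<partial>M)"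
    proof (intro nn_integral_mono)
      fix y
      show "ennreal \<bar>v y - v x\<bar> * indicator (ball x ?s) y \<le> ennreal (\<epsilon> / 2) * indicator (ball x ?s) y"
        using d(2)[of y] i0[OF that]
        by (auto simp: indicator_def dist_real_def dist_commute intro!: ennreal_leI)
    qed
    also have "\<dots> = ennreal (\<epsilon> / 2 * V x ?s)"
      using \<epsilon> by (simp add: nn_integral_cmult_indicator emeasure_open \<mu>_ball[OF s] flip: ennreal_mult)
    finally have "\<bar>avg x ?s - v x\<bar> * V x ?s \<le> \<epsilon> / 2 * V x ?s"
      using \<epsilon> by (simp add: ennreal_le_iff)
    then have "\<bar>avg x ?s - v x\<bar> \<le> \<epsilon> / 2" using V_pos[OF s, of x] by simp
    then show ?thesis using \<epsilon> by simp
  qed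
  then show "\<exists>i0. \<forall>i\<ge>i0. norm (avg x (r / 2 ^ i) - v x) < \<epsilon>" by blast
qed

text \<open>Applied twice: with \<open>l = 1 / 2\<close> at the point \<open>x\<close>, where
  energies are bounded, and contrapositively with \<open>l = ratio q\<close> at boundary points, to
  find a scale where the averages change a lot.\<close>

lemma telescope:
  assumes r: "0 < r" and l: "0 \<le> l" "l < 1" and B: "0 \<le> B"
    and step: "\<And>i. \<bar>avg x (r / 2 ^ Suc i) - avg x (r / 2 ^ i)\<bar> \<le> B * l ^ i"
  shows "\<bar>v x - avg x r\<bar> \<le> B / (1 - l)"
proof (rule LIMSEQ_le_const2)
  show "(\<lambda>i. \<bar>avg x (r / 2 ^ i) - avg x r\<bar>) \<longlonglongrightarrow> \<bar>v x - avg x r\<bar>"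
    by (intro tendsto_intros avg_tendsto r)
  have "\<bar>avg x (r / 2 ^ i) - avg x r\<bar> \<le> B / (1 - l) - B / (1 - l) * l ^ i" for i
  proof (induction i)
    case (Suc i)
    have "B / (1 - l) * l ^ i - B / (1 - l) * l ^ Suc i = (B / (1 - l) * (1 - l)) * l ^ i"
      by (simp only: power_Suc right_diff_distrib left_diff_distrib mult.assoc mult_1 mult_1_right)
    also have "\<dots> = B * l ^ i" using l by simp
    finally have "B / (1 - l) * l ^ i - B / (1 - l) * l ^ Suc i = B * l ^ i" .
    then show ?case using Suc step[of i] by linarith
  qed simp
  moreover have "0 \<le> B / (1 - l) * l ^ i" for i using B l by simp
  ultimately show "\<exists>i0. \<forall>i\<ge>i0. \<bar>avg x (r / 2 ^ i) - avg x r\<bar> \<le> B / (1 - l)"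
    by (meson diff_le_eq order_trans le_add_same_cancel1)
qed

lemma avg_step:
  assumes r: "0 < r"
  shows "\<bar>avg x (r / 2 ^ Suc i) - avg x (r / 2 ^ i)\<bar> \<le> c\<^sub>D * c\<^sub>P * (r / 2 ^ i) * energy x (\<tau> * (r / 2 ^ i)) powr (1 / p)"
proof (rule avg_compare)
  show "V x (r / 2 ^ i) \<le> c\<^sub>D * V x (r / 2 ^ Suc i)"
    using V_double[of "r / 2 ^ Suc i" x] r by simp
  show "ball x (r / 2 ^ Suc i) \<subseteq> ball x (r / 2 ^ i)"
    using r by (intro subset_ball) (simp add: field_simps)
qed (use r in auto)

end

text \<open>The content is defined by covers indexed by natural numbers, whereas the Vitali cover is
  indexed by its centres; a finite index set is renumbered.\<close>

lemma hausdorff_content_le_sum: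
  assumes J: "finite J" and r: "\<And>i. i \<in> J \<Longrightarrow> 0 < r i \<and> r i \<le> R" and E: "E \<subseteq> (\<Union>i\<in>J. ball (c i) (r i))"
  shows "hausdorff_content \<mu> t R E \<le> (\<Sum>i\<in>J. \<mu> (ball (c i) (r i)) * ennreal (r i powr (- t)))"
proof -
  obtain h where h: "bij_betw h {0..<card J} J"
    using ex_bij_betw_nat_finite[OF J] by blast
  have hJ: "h ` {0..<card J} = J" using h by (rule bij_betw_imp_surj_on)
  have "hausdorff_content \<mu> t R E \<le>
    (\<Sum>\<^sub>\<infinity>i\<in>{0..<card J}. \<mu> (ball (c (h i)) (r (h i))) * ennreal (r (h i) powr (- t)))"
    unfolding hausdorff_content_def
  proof (rule INF_lower2[of "({0..<card J}, c \<circ> h, r \<circ> h)"])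
    have "(\<Union>i\<in>{0..<card J}. ball (c (h i)) (r (h i))) = (\<Union>i\<in>h ` {0..<card J}. ball (c i) (r i))" by blast
    moreover have "0 < r (h i) \<and> r (h i) \<le> R" if "i \<in> {0..<card J}" for i
      using that hJ by (intro r) blast
    ultimately show "({0..<card J}, c \<circ> h, r \<circ> h)
      \<in> {(I, x, r). (\<forall>i\<in>I. 0 < r i \<and> r i \<le> R) \<and> E \<subseteq> (\<Union>i\<in>I. ball (x i) (r i))}"
      using E unfolding hJ by simp
  qed simp
  also have "\<dots> = (\<Sum>i\<in>{0..<card J}. \<mu> (ball (c (h i)) (r (h i))) * ennreal (r (h i) powr (- t)))"
    by (rule infsum_finite) simp
  also have "\<dots> = (\<Sum>i\<in>J. \<mu> (ball (c i) (r i)) * ennreal (r i powr (- t)))"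
    by (rule sum.reindex_bij_betw[OF h])
  finally show ?thesis .
qed

text \<open>With \<open>y = 2 ^ i\<close> the radius at scale \<open>i\<close> is
  \<open>s / y\<close>. The identity \<open>(s / y) powr p * y powr (p - q) = (s / y) powr q * s
  powr (p - q)\<close> explains the decay exponent \<open>(p - q) / p\<close>: after taking
  \<open>p\<close>-th powers, the radius appears with the power \<open>q\<close> of the content,
  times a factor that does not depend on the scale.\<close>

lemma powr_scale_estimate:
  fixes B s y D m p q :: real
  assumes pos: "0 < B" "0 < s" "0 < y" "0 < D" "0 \<le> m" "0 < p"
    and le: "B * y powr (- ((p - q) / p)) \<le> D * (s / y) * m powr (1 / p)"
  shows "B powr p * (s / y) powr (- q) \<le> D powr p * s powr (p - q) * m"
proof -
  have **: "(B * y powr (- ((p - q) / p))) powr p \<le> (D * (s / y) * m powr (1 / p)) powr p"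
    using le pos by (intro powr_mono2) auto
  have *: "B powr p * y powr (q - p) \<le> D powr p * (s / y) powr p * m"
  proof -
    have "(p - q) / p * p = p - q" "1 / p * p = 1" using pos by auto
    then show ?thesis
      using ** pos
      by (simp add: powr_mult powr_powr del: times_divide_eq_right times_divide_eq_left)
  qed
  have eq: "(s / y) powr (- q) = y powr (q - p) * (s powr (p - q) * (s / y) powr (- p))"
  proof -
    have "(s / y) powr (- q) = (s / y) powr (p - q) * (s / y) powr (- p)"
      by (simp flip: powr_add)
    also have "(s / y) powr (p - q) = y powr (q - p) * s powr (p - q)"
      using pos by (simp add: powr_divide powr_minus_divide[of y "p - q", symmetric] field_simps)
        (simp flip: powr_add)
    finally show ?thesis by simp
  qed
  have "B powr p * (s / y) powr (- q) = (B powr p * y powr (q - p)) * (s powr (p - q) * (s / y) powr (- p))"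
    by (simp add: eq)
  also have "\<dots> \<le> (D powr p * (s / y) powr p * m) * (s powr (p - q) * (s / y) powr (- p))"
    by (rule mult_right_mono[OF *]) simp
  also have "\<dots> = D powr p * s powr (p - q) * m * ((s / y) powr p * (s / y) powr (- p))"
    by simp
  also have "(s / y) powr p * (s / y) powr (- p) = 1"
    using pos by (simp flip: powr_add)
  finally show ?thesis by simp
qed

section \<open>Constants of the boundary estimate\<close>

context poincare_space
begin

text \<open>Compares \<open>ball x ((2 * L + 1) * \<delta>)\<close> with a ball of radius
  \<open>\<delta> / (3 * \<tau>)\<close> whose centre has distance at most
  \<open>2 * L * \<delta>\<close> from \<open>x\<close>: distance plus larger radius is at most
  \<open>(4 * L + 1) * \<delta>\<close>.\<close>

definition doublings :: "real \<Rightarrow> nat" where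
  "doublings L = (SOME j. (4 * L + 1) * (3 * \<tau>) \<le> 2 ^ j)"

lemma doublings: "(4 * L + 1) * (3 * \<tau>) \<le> 2 ^ doublings L"
  unfolding doublings_def by (rule someI_ex) (use exists_power_ge[of 1] in simp)

text \<open>Balls of radius at most \<open>\<delta>\<close> about points of
  \<open>cball x (2 * L * \<delta>)\<close> lie in \<open>ball x ((2 * L + 1) * \<delta>)\<close>,
  and the Poincare inequality on that ball involves its dilation by \<open>\<tau>\<close>.\<close>

definition dilatation :: "real \<Rightarrow> real" where
  "dilatation L = \<tau> * (2 * L + 1)"

text \<open>The \<open>i\<close>-th power is \<open>(2 ^ i) powr (- ((p - q) / p))\<close>, the
  decay treated in \<open>powr_scale_estimate\<close>.\<close>

definition ratio :: "real \<Rightarrow> real" where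
  "ratio q = 2 powr (- ((p - q) / p))"

text \<open>The term \<open>2 * c\<^sub>D\<close> comes from telescoping at \<open>x\<close> with
  ratio 1/2, and \<open>c\<^sub>D ^ doublings L\<close> from the single comparison with a ball about
  a boundary point.\<close>

definition near_const :: "real \<Rightarrow> real" where
  "near_const L = (2 * c\<^sub>D + c\<^sub>D ^ doublings L) * c\<^sub>P * (2 * L + 1)"

text \<open>The maximum reflects the two cases of \<open>main_estimate\<close>: either
  \<open>v x\<close> is of the size of the error in \<open>near_estimate\<close>, or the covering
  argument applies.\<close>

definition hardy_const :: "real \<Rightarrow> real \<Rightarrow> real \<Rightarrow> real" where
  "hardy_const L q C = max (2 * near_const L)
     (2 / (1 - ratio q) * (c\<^sub>D * c\<^sub>P) * (c\<^sub>D ^ (2 + doublings L) / C) powr (1 / p))"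

lemma near_const_pos: "1 \<le> L \<Longrightarrow> 0 < near_const L"
  using c\<^sub>D c\<^sub>P unfolding near_const_def by (intro mult_pos_pos add_pos_pos) auto

lemma hardy_const_pos: "1 \<le> L \<Longrightarrow> 0 < hardy_const L q C"
  using near_const_pos[of L] by (simp add: hardy_const_def less_max_iff_disj)

end

section \<open>Energy near boundary points and the covering argument\<close>

context test_function
begin

text \<open>A telescoping sum from \<open>x\<close> up to the radius
  \<open>(2 * L + 1) * \<delta>\<close> is followed by one comparison with the ball about
  \<open>w\<close>, so all energies are centred at \<open>x\<close>. Dilated by
  \<open>\<tau>\<close> and tripled, the radius \<open>\<delta> / (3 * \<tau>)\<close> becomes
  \<open>\<delta>\<close>, the largest radius that the content admits.\<close>

lemma near_estimate:
  assumes L: "1 \<le> L" and \<delta>: "0 < \<delta>" and A: "0 \<le> A" and w: "w \<in> cball x (2 * L * \<delta>)"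
    and en: "\<And>s. 0 < s \<Longrightarrow> s \<le> dilatation L * \<delta> \<Longrightarrow> energy x s \<le> A powr p"
  shows "\<bar>v x - avg w (\<delta> / (3 * \<tau>))\<bar> \<le> near_const L * \<delta> * A"
proof -
  define R where "R = (2 * L + 1) * \<delta>"
  define s where "s = \<delta> / (3 * \<tau>)"
  have R: "0 < R" "\<tau> * R = dilatation L * \<delta>" using L \<delta> by (auto simp: R_def dilatation_def)
  have s: "0 < s" "s \<le> \<delta>" using \<delta> \<tau> by (auto simp: s_def field_simps)
  have en': "energy x t powr (1 / p) \<le> A" if "0 < t" "t \<le> \<tau> * R" for t
  proof -
    have "energy x t powr (1 / p) \<le> (A powr p) powr (1 / p)"
      using en[of t] that R p by (intro powr_mono2) auto
    also have "\<dots> = A" using A p by (simp add: powr_powr)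
    finally show ?thesis .
  qed
  have "\<bar>v x - avg x R\<bar> \<le> (c\<^sub>D * c\<^sub>P * R * A) / (1 - 1 / 2)"
  proof (rule telescope[OF R(1)])
    fix i
    have "\<tau> * (R / 2 ^ i) \<le> \<tau> * R" using R \<tau> by (intro mult_left_mono) (auto simp: field_simps)
    moreover have "0 < \<tau> * (R / 2 ^ i)" by (intro mult_pos_pos divide_pos_pos) (use R \<tau> in auto)
    ultimately have "energy x (\<tau> * (R / 2 ^ i)) powr (1 / p) \<le> A" by (intro en')
    then have "c\<^sub>D * c\<^sub>P * (R / 2 ^ i) * energy x (\<tau> * (R / 2 ^ i)) powr (1 / p) \<le> c\<^sub>D * c\<^sub>P * (R / 2 ^ i) * A"
      using c\<^sub>D c\<^sub>P R by (intro mult_left_mono) auto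
    then show "\<bar>avg x (R / 2 ^ Suc i) - avg x (R / 2 ^ i)\<bar> \<le> c\<^sub>D * c\<^sub>P * R * A * (1 / 2) ^ i"
      using avg_step[OF R(1), of x i] by (simp add: power_one_over field_simps)
  qed (use c\<^sub>D c\<^sub>P R A in auto)
  moreover have "\<bar>avg w s - avg x R\<bar> \<le> c\<^sub>D ^ doublings L * c\<^sub>P * R * energy x (\<tau> * R) powr (1 / p)"
  proof (rule avg_compare[OF s(1) R(1)])
    have dw: "dist x w \<le> 2 * L * \<delta>" using w by simp
    show "ball w s \<subseteq> ball x R"
    proof
      fix z assume "z \<in> ball w s"
      then have "dist w z < \<delta>" using s by simp
      then show "z \<in> ball x R"
        using dw dist_triangle[of x z w] by (simp add: R_def distrib_right)
    qed
    show "V x R \<le> c\<^sub>D ^ doublings L * V w s"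
    proof (rule V_compare[OF _ s(1)])
      have "dist x w + R \<le> ((4 * L + 1) * (3 * \<tau>)) * s"
        using dw \<tau> by (simp add: R_def s_def algebra_simps)
      also have "\<dots> \<le> 2 ^ doublings L * s"
        using doublings s(1) by (intro mult_right_mono) auto
      finally show "dist x w + R \<le> 2 ^ doublings L * s" .
    qed
  qed
  moreover have "c\<^sub>D ^ doublings L * c\<^sub>P * R * energy x (\<tau> * R) powr (1 / p) \<le> c\<^sub>D ^ doublings L * c\<^sub>P * R * A"
  proof (rule mult_left_mono)
    show "energy x (\<tau> * R) powr (1 / p) \<le> A" using R(1) \<tau> by (intro en' mult_pos_pos) auto
  qed (use c\<^sub>D c\<^sub>P R in auto)
  ultimately have "\<bar>v x - avg w s\<bar> \<le> 2 * (c\<^sub>D * c\<^sub>P * R * A) + c\<^sub>D ^ doublings L * c\<^sub>P * R * A"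
    by simp
  also have "\<dots> = near_const L * \<delta> * A"
    by (simp add: near_const_def R_def algebra_simps)
  finally show ?thesis by (simp add: s_def)
qed

lemma ratio_less_1: "q < p \<Longrightarrow> 0 < ratio q \<and> ratio q < 1"
  using p by (simp add: ratio_def powr_less_one)

text \<open>If the averages at \<open>w\<close> changed by at most \<open>B * ratio q ^ i\<close> at
  every scale, \<open>telescope\<close> would bound the total change by \<open>T / 2\<close>. So
  some scale violates this, and \<open>avg_step\<close> turns the violation into a lower bound for
  the energy there. The radius \<open>3 * \<rho>\<close> anticipates the tripling in the covering
  lemma.\<close>

lemma boundary_ball:
  assumes \<delta>: "0 < \<delta>" and q: "1 \<le> q" "q < p" and T: "0 < T" "T / 2 < \<bar>v w - avg w (\<delta> / (3 * \<tau>))\<bar>"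
  obtains \<rho> where "0 < \<rho>" "3 * \<rho> \<le> \<delta>"
    "((1 - ratio q) * T / 2) powr p * (V w \<rho> * (3 * \<rho>) powr (- q))
      \<le> (c\<^sub>D * c\<^sub>P) powr p * \<delta> powr (p - q) * (energy w \<rho> * V w \<rho>)"
proof -
  define s where "s = \<delta> / (3 * \<tau>)"
  have s: "0 < s" "s \<le> \<delta>" using \<delta> \<tau> by (auto simp: s_def field_simps)
  define B where "B = (1 - ratio q) * T / 2"
  have l: "0 < ratio q" "ratio q < 1" using ratio_less_1[OF q(2)] by auto
  have B: "0 < B" using l T by (simp add: B_def)
  have "\<exists>i. B * ratio q ^ i < \<bar>avg w (s / 2 ^ Suc i) - avg w (s / 2 ^ i)\<bar>"
  proof (rule ccontr)
    assume "\<not> ?thesis"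
    then have "\<bar>v w - avg w s\<bar> \<le> B / (1 - ratio q)"
      using l B by (intro telescope[OF s(1)]) (auto simp: not_less)
    also have "\<dots> = T / 2" using l by (simp add: B_def field_simps)
    finally show False using T(2) by (simp add: s_def)
  qed
  then obtain i where i: "B * ratio q ^ i < \<bar>avg w (s / 2 ^ Suc i) - avg w (s / 2 ^ i)\<bar>" ..
  define y where "y = (2::real) ^ i"
  have y: "1 \<le> y" by (simp add: y_def)
  define \<rho> where "\<rho> = \<tau> * (s / y)"
  have \<rho>: "0 < \<rho>" "3 * \<rho> \<le> \<delta>"
    using s y \<tau> \<delta> by (auto simp: \<rho>_def s_def field_simps)
  have "ratio q ^ i = y powr (- ((p - q) / p))"
    by (simp add: ratio_def y_def powr_powr mult.commute flip: powr_realpow)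
  then have "B * y powr (- ((p - q) / p)) \<le> c\<^sub>D * c\<^sub>P * (s / y) * energy w \<rho> powr (1 / p)"
    using i avg_step[OF s(1), of w i] by (simp add: y_def \<rho>_def)
  then have *: "B powr p * (s / y) powr (- q) \<le> (c\<^sub>D * c\<^sub>P) powr p * s powr (p - q) * energy w \<rho>"
    using B s y c\<^sub>D c\<^sub>P p by (intro powr_scale_estimate) auto
  have "(3 * \<rho>) powr (- q) \<le> (s / y) powr (- q)"
  proof (rule powr_mono2')
    show "s / y \<le> 3 * \<rho>"
      using mult_right_mono[of 1 "3 * \<tau>" "s / y"] \<tau> s y by (simp add: \<rho>_def)
  qed (use q s y in auto)
  then have "B powr p * (3 * \<rho>) powr (- q) \<le> B powr p * (s / y) powr (- q)"
    by (intro mult_left_mono) auto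
  also note *
  also have "(c\<^sub>D * c\<^sub>P) powr p * s powr (p - q) * energy w \<rho> \<le> (c\<^sub>D * c\<^sub>P) powr p * \<delta> powr (p - q) * energy w \<rho>"
    using s q by (intro mult_right_mono mult_left_mono powr_mono2) auto
  finally have "(B powr p * (3 * \<rho>) powr (- q)) * V w \<rho> \<le> ((c\<^sub>D * c\<^sub>P) powr p * \<delta> powr (p - q) * energy w \<rho>) * V w \<rho>"
    by (rule mult_right_mono) simp
  then show thesis
    using that[OF \<rho>] by (simp add: B_def mult.assoc mult.commute mult.left_commute)
qed

text \<open>A large value at \<open>x\<close> persists in the averages near the boundary, where
  \<open>v\<close> vanishes, so the drop costs energy near every boundary point in reach. Disjoint
  balls carrying this energy fit into one ball about \<open>x\<close>; their triples cover the
  boundary piece, so the content bounds their weights from below.\<close>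

lemma main_estimate:
  assumes L: "1 \<le> L" and q: "1 \<le> q" "q < p" and C: "0 < C" and \<delta>: "0 < \<delta>" and A: "0 \<le> A"
    and E: "closed E" "\<And>w. w \<in> E \<Longrightarrow> v w = 0"
    and content: "ennreal (C * \<delta> powr (- q)) * \<mu> (cball x \<delta>) \<le> hausdorff_content \<mu> q \<delta> (E \<inter> cball x (2 * L * \<delta>))"
    and en: "\<And>s. 0 < s \<Longrightarrow> s \<le> dilatation L * \<delta> \<Longrightarrow> energy x s \<le> A powr p"
  shows "v x \<le> hardy_const L q C * \<delta> * A"
proof (cases "v x \<le> 2 * (near_const L * \<delta> * A)")
  case True
  also have "2 * (near_const L * \<delta> * A) \<le> hardy_const L q C * \<delta> * A"
    using \<delta> A by (simp add: hardy_const_def mult_right_mono flip: mult.assoc)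
  finally show ?thesis .
next
  case False
  define T where "T = v x"
  define B where "B = (1 - ratio q) * T / 2"
  define G where "G = (c\<^sub>D * c\<^sub>P) powr p * \<delta> powr (p - q)"
  define R where "R = (2 * L + 1) * \<delta>"
  define K where "K = E \<inter> cball x (2 * L * \<delta>)"
  have near0: "0 \<le> near_const L * \<delta> * A" using near_const_pos[OF L] \<delta> A by simp
  have T: "0 < T" "near_const L * \<delta> * A < T / 2" using False near0 by (auto simp: T_def)
  have l: "0 < ratio q" "ratio q < 1" using ratio_less_1[OF q(2)] by auto
  have B: "0 < B" using l T by (simp add: B_def)
  have R: "0 < R" "R \<le> dilatation L * \<delta>"
    using L \<delta> \<tau> mult_right_mono[of 1 \<tau> "(2 * L + 1) * \<delta>"] by (auto simp: R_def dilatation_def)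
  have G0: "0 \<le> G" by (simp add: G_def)
  have "\<exists>\<rho>. 0 < \<rho> \<and> 3 * \<rho> \<le> \<delta> \<and> B powr p * (V w \<rho> * (3 * \<rho>) powr (- q)) \<le> G * (energy w \<rho> * V w \<rho>)"
    if w: "w \<in> K" for w
  proof -
    have "\<bar>T - avg w (\<delta> / (3 * \<tau>))\<bar> < T / 2"
      using near_estimate[OF L \<delta> A _ en, of w] w T(2) by (simp add: K_def T_def)
    then have "T / 2 < \<bar>v w - avg w (\<delta> / (3 * \<tau>))\<bar>"
    proof -
      have "v w = 0" using E(2)[of w] w by (simp add: K_def)
      then show ?thesis using \<open>\<bar>T - avg w (\<delta> / (3 * \<tau>))\<bar> < T / 2\<close> by linarith
    qed
    then obtain \<rho> where "0 < \<rho>" "3 * \<rho> \<le> \<delta>"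
      "((1 - ratio q) * T / 2) powr p * (V w \<rho> * (3 * \<rho>) powr (- q))
        \<le> (c\<^sub>D * c\<^sub>P) powr p * \<delta> powr (p - q) * (energy w \<rho> * V w \<rho>)"
      using boundary_ball[OF \<delta> q T(1)] by blast
    then show ?thesis unfolding B_def G_def by blast
  qed
  then have "\<forall>w\<in>K. \<exists>\<rho>. 0 < \<rho> \<and> 3 * \<rho> \<le> \<delta> \<and> B powr p * (V w \<rho> * (3 * \<rho>) powr (- q)) \<le> G * (energy w \<rho> * V w \<rho>)"
    by blast
  from bchoice[OF this] obtain \<rho> where \<rho>: "\<And>w. w \<in> K \<Longrightarrow> 0 < \<rho> w" "\<And>w. w \<in> K \<Longrightarrow> 3 * \<rho> w \<le> \<delta>"
    "\<And>w. w \<in> K \<Longrightarrow> B powr p * (V w (\<rho> w) * (3 * \<rho> w) powr (- q)) \<le> G * (energy w (\<rho> w) * V w (\<rho> w))"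
    by blast
  have "compact K" unfolding K_def by (intro closed_Int_compact E compact_cball)
  then obtain W where W: "W \<subseteq> K" "finite W" "K \<subseteq> (\<Union>w\<in>W. ball w (\<rho> w))"
  proof (rule compactE_image[of K K "\<lambda>w. ball w (\<rho> w)"])
    show "K \<subseteq> (\<Union>w\<in>K. ball w (\<rho> w))" using \<rho>(1) by force
  qed auto
  obtain J where J: "J \<subseteq> W" "disjoint_family_on (\<lambda>w. ball w (\<rho> w)) J"
    "(\<Union>w\<in>W. ball w (\<rho> w)) \<subseteq> (\<Union>w\<in>J. ball w (3 * \<rho> w))"
    using finite_Vitali[OF W(2), of "\<lambda>w. w" \<rho>] by blast
  have fJ: "finite J" using J(1) W(2) by (rule finite_subset)
  have JK: "w \<in> K" if "w \<in> J" for w using that J(1) W(1) by blast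
  define S where "S = (\<Sum>w\<in>J. V w (\<rho> w) * (3 * \<rho> w) powr (- q))"
  have S0: "0 \<le> S" unfolding S_def by (intro sum_nonneg mult_nonneg_nonneg) auto
  have "ennreal (C * \<delta> powr (- q) * V x \<delta>) \<le> ennreal (C * \<delta> powr (- q)) * \<mu> (cball x \<delta>)"
  proof -
    have "\<mu> (ball x \<delta>) \<le> \<mu> (cball x \<delta>)"
      using emeasure_mono[of "ball x \<delta>" "cball x \<delta>" M] borel_sets_M[of "cball x \<delta>"]
      by (simp add: emeasure_open emeasure_M ball_subset_cball)
    then show ?thesis
      using C by (simp add: \<mu>_ball[OF \<delta>] ennreal_mult mult_left_mono)
  qed
  also have "\<dots> \<le> hausdorff_content \<mu> q \<delta> K" using content by (simp add: K_def)
  also have "\<dots> \<le> (\<Sum>w\<in>J. \<mu> (ball w (3 * \<rho> w)) * ennreal ((3 * \<rho> w) powr (- q)))"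
    using \<rho>(1,2) JK W(3) J(3) by (intro hausdorff_content_le_sum[OF fJ]) auto
  also have "\<dots> \<le> (\<Sum>w\<in>J. ennreal (c\<^sub>D ^ 2 * (V w (\<rho> w) * (3 * \<rho> w) powr (- q))))"
  proof (rule sum_mono)
    fix w assume w: "w \<in> J"
    have pos: "0 < \<rho> w" using \<rho>(1) JK[OF w] by simp
    have "V w (3 * \<rho> w) \<le> c\<^sub>D ^ 2 * V w (\<rho> w)" using pos by (intro V_compare) auto
    then have "V w (3 * \<rho> w) * (3 * \<rho> w) powr (- q) \<le> c\<^sub>D ^ 2 * V w (\<rho> w) * (3 * \<rho> w) powr (- q)"
      by (intro mult_right_mono) auto
    then show "\<mu> (ball w (3 * \<rho> w)) * ennreal ((3 * \<rho> w) powr (- q)) \<le> ennreal (c\<^sub>D ^ 2 * (V w (\<rho> w) * (3 * \<rho> w) powr (- q)))"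
      using pos by (simp add: \<mu>_ball ennreal_leI mult.assoc flip: ennreal_mult)
  qed
  also have "\<dots> = ennreal (c\<^sub>D ^ 2 * S)"
    using c\<^sub>D by (simp add: S_def sum_distrib_left)
  finally have lower: "C * \<delta> powr (- q) * V x \<delta> \<le> c\<^sub>D ^ 2 * S"
    using S0 by (simp add: ennreal_le_iff)
  have "ennreal (\<Sum>w\<in>J. energy w (\<rho> w) * V w (\<rho> w)) = (\<Sum>w\<in>J. \<integral>\<^sup>+y\<in>ball w (\<rho> w). ennreal (k y powr p) \<partial>M)"
    using \<rho>(1) JK by (simp add: nn_integral_k flip: sum_ennreal)
  also have "\<dots> = (\<integral>\<^sup>+y\<in>(\<Union>w\<in>J. ball w (\<rho> w)). ennreal (k y powr p) \<partial>M)"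
    using k_measurable by (intro sum_disjoint_balls[OF fJ J(2)]) simp
  also have "\<dots> \<le> (\<integral>\<^sup>+y\<in>ball x R. ennreal (k y powr p) \<partial>M)"
  proof -
    have "(\<Union>w\<in>J. ball w (\<rho> w)) \<subseteq> ball x R"
    proof
      fix z assume "z \<in> (\<Union>w\<in>J. ball w (\<rho> w))"
      then obtain w where w: "w \<in> J" "dist w z < \<rho> w" by auto
      have "dist x w \<le> 2 * L * \<delta>" using JK[OF w(1)] by (simp add: K_def)
      moreover have "\<rho> w \<le> \<delta>" using \<rho>(1,2)[OF JK[OF w(1)]] by linarith
      ultimately show "z \<in> ball x R"
        using w(2) dist_triangle[of x z w] by (simp add: R_def distrib_right)
    qed
    from subsetD[OF this] show ?thesis
      by (intro nn_integral_mono mult_left_mono indicator_leI) auto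
  qed
  also have "\<dots> = ennreal (energy x R * V x R)" by (rule nn_integral_k[OF R(1)])
  finally have "(\<Sum>w\<in>J. energy w (\<rho> w) * V w (\<rho> w)) \<le> energy x R * V x R"
    by (simp add: ennreal_le_iff)
  also have "\<dots> \<le> A powr p * (c\<^sub>D ^ doublings L * V x \<delta>)"
  proof (rule mult_mono)
    show "energy x R \<le> A powr p" by (rule en[OF R])
    show "V x R \<le> c\<^sub>D ^ doublings L * V x \<delta>"
    proof (rule V_compare[OF _ \<delta>])
      have "2 * L + 1 \<le> (4 * L + 1) * 1" using L by simp
      also have "\<dots> \<le> (4 * L + 1) * (3 * \<tau>)" using L \<tau> by (intro mult_left_mono) auto
      also have "\<dots> \<le> 2 ^ doublings L" by (rule doublings)
      finally show "dist x x + R \<le> 2 ^ doublings L * \<delta>"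
        using \<delta> by (simp add: R_def)
    qed
  qed auto
  finally have sumI: "(\<Sum>w\<in>J. energy w (\<rho> w) * V w (\<rho> w)) \<le> A powr p * (c\<^sub>D ^ doublings L * V x \<delta>)" .
  have "B powr p * S \<le> G * (\<Sum>w\<in>J. energy w (\<rho> w) * V w (\<rho> w))"
    unfolding S_def sum_distrib_left using \<rho>(3) JK by (intro sum_mono) auto
  also have "\<dots> \<le> G * (A powr p * (c\<^sub>D ^ doublings L * V x \<delta>))"
    by (rule mult_left_mono[OF sumI G0])
  finally have "c\<^sub>D ^ 2 * (B powr p * S) \<le> c\<^sub>D ^ 2 * (G * (A powr p * (c\<^sub>D ^ doublings L * V x \<delta>)))"
    using c\<^sub>D by (intro mult_left_mono) auto
  moreover have "B powr p * (C * \<delta> powr (- q) * V x \<delta>) \<le> B powr p * (c\<^sub>D ^ 2 * S)"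
    by (rule mult_left_mono[OF lower]) simp
  \<comment> \<open>The exponent 2 pays for tripling, \<open>doublings L\<close> for passing from
    radius \<open>R\<close> to radius \<open>\<delta>\<close>; then the volume
    \<open>V x \<delta>\<close> cancels.\<close>
  ultimately have "(B powr p * (C * \<delta> powr (- q))) * V x \<delta> \<le> (c\<^sub>D ^ (2 + doublings L) * G * A powr p) * V x \<delta>"
    by (simp add: power_add power2_eq_square mult.assoc mult.left_commute)
  then have "B powr p * (C * \<delta> powr (- q)) \<le> c\<^sub>D ^ (2 + doublings L) * G * A powr p"
    using V_pos[OF \<delta>, of x] by simp
  \<comment> \<open>The content contributes \<open>\<delta> powr q\<close> and \<open>G\<close>
    contributes \<open>\<delta> powr (p - q)\<close>. Their product is
    \<open>\<delta> powr p\<close>, whose root is the factor \<open>\<delta>\<close> of the Hardy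
    inequality.\<close>
  then have "B powr p * (C * \<delta> powr (- q)) * \<delta> powr q \<le> c\<^sub>D ^ (2 + doublings L) * G * A powr p * \<delta> powr q"
    by (rule mult_right_mono) simp
  also have "c\<^sub>D ^ (2 + doublings L) * G * A powr p * \<delta> powr q
      = c\<^sub>D ^ (2 + doublings L) * (c\<^sub>D * c\<^sub>P) powr p * A powr p * (\<delta> powr (p - q) * \<delta> powr q)"
    by (simp only: G_def ac_simps)
  also have "\<delta> powr (p - q) * \<delta> powr q = \<delta> powr p"
    by (simp flip: powr_add)
  also have "B powr p * (C * \<delta> powr (- q)) * \<delta> powr q = B powr p * C * (\<delta> powr (- q) * \<delta> powr q)"
    by (simp only: ac_simps)
  also have "\<delta> powr (- q) * \<delta> powr q = 1"
    using \<delta> by (simp flip: powr_add)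
  finally have "B powr p * C \<le> c\<^sub>D ^ (2 + doublings L) * (c\<^sub>D * c\<^sub>P) powr p * A powr p * \<delta> powr p"
    by simp
  then have "B powr p \<le> (c\<^sub>D ^ (2 + doublings L) / C) * ((c\<^sub>D * c\<^sub>P) * \<delta> * A) powr p"
    using C c\<^sub>D c\<^sub>P \<delta> A by (simp add: powr_mult field_simps)
  then have "(B powr p) powr (1 / p) \<le> ((c\<^sub>D ^ (2 + doublings L) / C) * ((c\<^sub>D * c\<^sub>P) * \<delta> * A) powr p) powr (1 / p)"
    using p by (intro powr_mono2) auto
  also have "\<dots> = (c\<^sub>D ^ (2 + doublings L) / C) powr (1 / p) * ((c\<^sub>D * c\<^sub>P) * \<delta> * A)"
  proof -
    have "(X * Y powr p) powr (1 / p) = X powr (1 / p) * Y" if "0 \<le> X" "0 \<le> Y" for X Y :: real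
      using that p by (simp add: powr_mult powr_powr)
    then show ?thesis
      by this (use C c\<^sub>D c\<^sub>P \<delta> A in auto)
  qed
  finally have "B \<le> (c\<^sub>D ^ (2 + doublings L) / C) powr (1 / p) * ((c\<^sub>D * c\<^sub>P) * \<delta> * A)"
    using B p by (simp add: powr_powr)
  then have "2 / (1 - ratio q) * B \<le> 2 / (1 - ratio q) * ((c\<^sub>D ^ (2 + doublings L) / C) powr (1 / p) * ((c\<^sub>D * c\<^sub>P) * \<delta> * A))"
    using l by (intro mult_left_mono) auto
  moreover have "2 / (1 - ratio q) * B = T" using l by (simp add: B_def)
  ultimately have "T \<le> (2 / (1 - ratio q) * (c\<^sub>D * c\<^sub>P) * (c\<^sub>D ^ (2 + doublings L) / C) powr (1 / p)) * (\<delta> * A)"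
    by (simp add: mult.assoc mult.left_commute)
  also have "\<dots> \<le> hardy_const L q C * (\<delta> * A)"
    unfolding hardy_const_def using \<delta> A by (intro mult_right_mono) auto
  finally show ?thesis by (simp add: T_def mult.assoc)
qed

end

section \<open>The pointwise Hardy inequality\<close>

lemma ennpowr_measurable [measurable]: "(\<lambda>x. ennpowr x p) \<in> borel_measurable borel"
  unfolding ennpowr_def by measurable

lemma less_ennpowr_inverse_iff:
  assumes "0 \<le> c" "0 < p"
  shows "ennreal c < ennpowr a (1 / p) \<longleftrightarrow> ennreal (c powr p) < a"
proof (cases a)
  case (real b)
  have "c < b powr (1 / p) \<longleftrightarrow> c powr p < b"
  proof
    assume "c < b powr (1 / p)"
    then have "c powr p < (b powr (1 / p)) powr p" using assms by (intro powr_less_mono2) auto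
    then show "c powr p < b" using real assms by (simp add: powr_powr)
  next
    assume "c powr p < b"
    then have "(c powr p) powr (1 / p) < b powr (1 / p)" using assms by (intro powr_less_mono2) auto
    then show "c < b powr (1 / p)" using assms by (simp add: powr_powr)
  qed
  then show ?thesis using real assms by (simp add: ennreal_less_iff)
next
  case top
  then show ?thesis by (simp add: ennpowr_def)
qed

lemma ennpowr_le_of_le_inverse:
  assumes "0 < p" "a \<le> ennpowr b (1 / p)"
  shows "ennpowr a p \<le> b"
proof (cases b)
  case (real b')
  then have "a < top" using assms(2) by (simp add: order.strict_trans1)
  then obtain a' where a': "a = ennreal a'" "0 \<le> a'" by (cases a) auto
  have "a' powr p \<le> (b' powr (1 / p)) powr p" using assms real a' by (intro powr_mono2) auto
  then show ?thesis using real a' assms by (simp add: powr_powr ennreal_leI)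
qed simp

lemma le_ennpowr_inverse:
  assumes "0 < p" "ennpowr a p \<le> b"
  shows "a \<le> ennpowr b (1 / p)"
proof (cases b)
  case (real b')
  then have "a \<noteq> top" using assms(2) by (auto simp: ennpowr_def top_unique)
  then obtain a' where a': "a = ennreal a'" "0 \<le> a'" by (cases a) auto
  have "(a' powr p) powr (1 / p) \<le> b' powr (1 / p)" using assms real a' by (intro powr_mono2) auto
  then show ?thesis using real a' assms by (simp add: powr_powr ennreal_leI)
qed (simp add: ennpowr_def)

lemma (in rectifiable) curve_integral_cmult:
  assumes "\<rho> \<in> borel_measurable borel"
  shows "curve_integral (\<lambda>x. c * \<rho> x) (a, b, \<gamma>) = c * curve_integral \<rho> (a, b, \<gamma>)"
proof -
  have "\<gamma>' \<in> measurable (restrict_space borel {0..len}) borel"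
    by (rule borel_measurable_continuous_on_restrict[OF arc_length_param_continuous])
  then have "(\<lambda>s. \<rho> (\<gamma>' s)) \<in> borel_measurable (restrict_space borel {0..len})"
    by (rule measurable_compose[OF _ assms])
  then have "(\<lambda>s. \<rho> (\<gamma>' s) * indicator {0..len} s) \<in> borel_measurable borel"
    by (subst (asm) borel_measurable_restrict_space_iff_ennreal) auto
  then have "(\<lambda>s. \<rho> (\<gamma>' s) * indicator {0..len} s) \<in> borel_measurable lebesgue"
    by (intro measurable_completion) simp
  from nn_integral_cmult[OF this, of c] show ?thesis
    by (simp add: curve_integral_def arc_def mult.assoc)
qed

context doubling_measure
begin

lemma mean_mono: "(\<And>y. f y \<le> g y) \<Longrightarrow> mean \<mu> B f \<le> mean \<mu> B g"
  unfolding mean_def by (intro divide_right_mono_ennreal nn_integral_mono mult_right_mono) auto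

lemma mean_add:
  assumes "f \<in> borel_measurable M" "g \<in> borel_measurable M"
  shows "mean \<mu> (ball x r) (\<lambda>y. f y + g y) = mean \<mu> (ball x r) f + mean \<mu> (ball x r) g"
proof -
  have "(\<integral>\<^sup>+y\<in>ball x r. f y + g y \<partial>M) = (\<integral>\<^sup>+y. f y * indicator (ball x r) y + g y * indicator (ball x r) y \<partial>M)"
    by (simp add: distrib_right)
  also have "\<dots> = (\<integral>\<^sup>+y\<in>ball x r. f y \<partial>M) + (\<integral>\<^sup>+y\<in>ball x r. g y \<partial>M)"
    by (intro nn_integral_add borel_measurable_times_ennreal borel_measurable_indicator assms) auto
  finally show ?thesis by (simp add: mean_def add_divide_distrib_ennreal)
qed

lemma mean_cmult:
  assumes "f \<in> borel_measurable M"
  shows "mean \<mu> (ball x r) (\<lambda>y. c * f y) = c * mean \<mu> (ball x r) f"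
proof -
  have "(\<integral>\<^sup>+y\<in>ball x r. c * f y \<partial>M) = c * (\<integral>\<^sup>+y\<in>ball x r. f y \<partial>M)"
    unfolding mult.assoc
    by (intro nn_integral_cmult borel_measurable_times_ennreal borel_measurable_indicator assms) auto
  then show ?thesis by (simp add: mean_def ennreal_times_divide)
qed

lemma mean_const:
  assumes "0 < r"
  shows "mean \<mu> (ball x r) (\<lambda>_. c) = c"
proof -
  have "mean \<mu> (ball x r) (\<lambda>_. 1) = 1"
    using V_pos[OF assms, of x] by (simp add: mean_def emeasure_open \<mu>_ball[OF assms] divide_ennreal)
  then show ?thesis using mean_cmult[of "\<lambda>_. 1" x r c] by simp
qed

end

context poincare_space
begin

text \<open>The Poincare inequality forces connectedness: the indicator of a clopen set is constant
  along curves, so 0 is an upper gradient, and its oscillation vanishes on a ball that contains both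
  points.\<close>

lemma clopen_trivial:
  fixes \<Omega> :: "'a set"
  assumes \<Omega>: "open \<Omega>" "closed \<Omega>" and a: "a \<in> \<Omega>"
  shows "b \<in> \<Omega>"
proof (rule ccontr)
  assume b: "b \<notin> \<Omega>"
  define u where "u x = ereal (indicator \<Omega> x)" for x :: 'a
  define r where "r = dist a b + 1"
  define c where "c = average \<mu> (ball a r) u"
  have r: "0 < r" by (simp add: r_def add_nonneg_pos)
  have um: "u \<in> borel_measurable M"
    unfolding u_def using \<Omega>(1) by (intro borel_measurable_ereal borel_measurable_indicator) auto
  have "locally_integrable \<mu> u"
    unfolding locally_integrable_def
  proof (intro conjI allI um)
    fix x
    have "(\<integral>\<^sup>+y\<in>ball x 1. e2ennreal \<bar>u y\<bar> \<partial>M) \<le> (\<integral>\<^sup>+y\<in>ball x 1. 1 \<partial>M)"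
      by (intro nn_integral_mono mult_right_mono) (auto simp: u_def e2ennreal_ereal indicator_def)
    also have "\<dots> < top" by (simp add: emeasure_open \<mu>_ball)
    finally show "\<exists>r>0. (\<integral>\<^sup>+y\<in>ball x r. e2ennreal \<bar>u y\<bar> \<partial>M) < top" by (intro exI[of _ 1]) simp
  qed
  moreover have "weak_upper_gradient \<mu> p u (\<lambda>_. 0)"
    unfolding weak_upper_gradient_def
  proof (intro conjI exI[of _ "{}"])
    show "modulus \<mu> p {} = 0" by (rule modulus_empty)
    show "\<forall>(a, b, \<gamma>)\<in>curves - {}.
      if \<bar>u (\<gamma> a)\<bar> \<noteq> \<infinity> \<and> \<bar>u (\<gamma> b)\<bar> \<noteq> \<infinity>
      then \<bar>u (\<gamma> a) - u (\<gamma> b)\<bar> \<le> enn2ereal (curve_integral (\<lambda>_. 0) (a, b, \<gamma>))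
      else curve_integral (\<lambda>_. 0) (a, b, \<gamma>) = top"
    proof clarify
      fix s t and \<gamma> :: "real \<Rightarrow> 'a" assume "(s, t, \<gamma>) \<in> curves"
      then have \<gamma>: "s \<le> t" "continuous_on {s..t} \<gamma>" by (auto simp: curves_def)
      have "connected (\<gamma> ` {s..t})" by (rule connected_continuous_image[OF \<gamma>(2)]) simp
      moreover have "open (- \<Omega>)" using \<Omega>(2) by auto
      ultimately have "\<Omega> \<inter> \<gamma> ` {s..t} = {} \<or> - \<Omega> \<inter> \<gamma> ` {s..t} = {}"
        using \<Omega>(1) by (intro connectedD) auto
      then have "\<gamma> s \<in> \<Omega> \<longleftrightarrow> \<gamma> t \<in> \<Omega>" using \<gamma>(1) by force
      then have "u (\<gamma> s) = u (\<gamma> t)" by (simp add: u_def indicator_def)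
      then show "if \<bar>u (\<gamma> s)\<bar> \<noteq> \<infinity> \<and> \<bar>u (\<gamma> t)\<bar> \<noteq> \<infinity>
        then \<bar>u (\<gamma> s) - u (\<gamma> t)\<bar> \<le> enn2ereal (curve_integral (\<lambda>_. 0) (s, t, \<gamma>))
        else curve_integral (\<lambda>_. 0) (s, t, \<gamma>) = top"
        by (simp add: u_def)
    qed
  qed auto
  ultimately have "mean \<mu> (ball a r) (\<lambda>y. e2ennreal \<bar>u y - ereal c\<bar>)
      \<le> ennreal (c\<^sub>P * r) * ennpowr (mean \<mu> (ball a (\<tau> * r)) (\<lambda>y. ennpowr 0 p)) (1 / p)"
    unfolding c_def by (rule poincare[OF r])
  also have "\<dots> = 0" by (simp add: ennpowr_def mean_def)
  finally have "mean \<mu> (ball a r) (\<lambda>y. e2ennreal \<bar>u y - ereal c\<bar>) = 0" by simp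
  then have zero: "(\<integral>\<^sup>+y\<in>ball a r. e2ennreal \<bar>u y - ereal c\<bar> \<partial>M) = 0"
    using V_pos[OF r, of a] by (simp add: mean_def \<mu>_ball[OF r] ennreal_divide_eq_0_iff)
  \<comment> \<open>An open set contains a ball of positive measure, so the vanishing integral of
    the oscillation forces the value on an open piece where \<open>u\<close> is constant to equal
    \<open>c\<close>.\<close>
  have eq: "c = t" if z: "z \<in> W" "open W" "W \<subseteq> ball a r" "\<And>y. y \<in> W \<Longrightarrow> u y = ereal t" for z W t
  proof -
    obtain s where s: "0 < s" "ball z s \<subseteq> W" using z(1,2) by (auto simp: open_contains_ball)
    have "ennreal \<bar>t - c\<bar> * ennreal (V z s) = (\<integral>\<^sup>+y\<in>ball z s. ennreal \<bar>t - c\<bar> \<partial>M)"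
      by (simp add: nn_integral_cmult_indicator emeasure_open \<mu>_ball[OF s(1)])
    also have "\<dots> \<le> (\<integral>\<^sup>+y\<in>ball a r. e2ennreal \<bar>u y - ereal c\<bar> \<partial>M)"
    proof (intro nn_integral_mono)
      fix y
      show "ennreal \<bar>t - c\<bar> * indicator (ball z s) y \<le> e2ennreal \<bar>u y - ereal c\<bar> * indicator (ball a r) y"
      proof (cases "y \<in> ball z s")
        case True
        then have "y \<in> W" using s(2) by blast
        moreover from this have "y \<in> ball a r" using z(3) by blast
        ultimately show ?thesis using z(4)[of y] True by (simp add: e2ennreal_ereal)
      qed simp
    qed
    finally have "ennreal \<bar>t - c\<bar> * ennreal (V z s) = 0" using zero by simp
    then show ?thesis using V_pos[OF s(1), of z] by simp
  qed
  have "c = 1"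
    by (rule eq[of a "\<Omega> \<inter> ball a r"]) (use \<Omega> a r in \<open>auto simp: u_def\<close>)
  moreover have "c = 0"
    by (rule eq[of b "- \<Omega> \<inter> ball a r"]) (use \<Omega> b r in \<open>auto simp: u_def r_def indicator_def\<close>)
  ultimately show False by simp
qed

text \<open>\<open>H\<close> stands for the \<open>p\<close>-th power of the integrand, since means
  of powers are what is controlled. The potentials are truncated at \<open>K\<close> itself: the
  estimate does not depend on the truncation level, so a bound strictly below \<open>K\<close>
  yields chains of cost less than \<open>K\<close>.\<close>

lemma exists_short_curve:
  assumes L: "1 \<le> L" and q: "1 \<le> q" "q < p" and C: "0 < C" and \<delta>: "0 < \<delta>" and A: "0 \<le> A"
    and E: "closed E" "x \<notin> E"
    and content: "ennreal (C * \<delta> powr (- q)) * \<mu> (cball x \<delta>) \<le> hausdorff_content \<mu> q \<delta> (E \<inter> cball x (2 * L * \<delta>))"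
    and H: "\<And>c. open {x. c < H x}" "0 < \<eta>" "\<eta> \<le> 1" "\<And>x. ennreal \<eta> \<le> H x"
    and en: "\<And>s. 0 < s \<Longrightarrow> s \<le> dilatation L * \<delta> \<Longrightarrow> mean \<mu> (ball x s) H \<le> ennreal (A powr p)"
    and K: "hardy_const L q C * \<delta> * A < K"
  obtains \<gamma> where "(0, K, \<gamma>) \<in> curves" "\<gamma> 0 = x" "\<gamma> K \<in> E"
    "curve_integral (\<lambda>y. ennpowr (H y) (1 / p)) (0, K, \<gamma>) \<le> ennreal K"
proof -
  define h where "h y = ennpowr (H y) (1 / p)" for y
  define \<eta>' where "\<eta>' = \<eta> powr (1 / p)"
  have p0: "0 < p" using p by simp
  have \<eta>': "0 < \<eta>'" "\<eta>' \<le> 1" using H(2,3) p by (auto simp: \<eta>'_def powr_le1)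
  have h\<eta>: "ennreal \<eta>' \<le> h y" for y
    unfolding h_def
    by (rule le_ennpowr_inverse[OF p0]) (use H(2) H(4)[of y] p0 in \<open>simp add: \<eta>'_def powr_powr\<close>)
  have lsc: "open {y. c < h y}" for c
  proof (cases c)
    case (real c')
    then have "{y. c < h y} = {y. ennreal (c' powr p) < H y}"
      using less_ennpowr_inverse_iff[OF _ p0, of c'] by (simp add: h_def)
    then show ?thesis using H(1) by simp
  qed simp
  have K0: "0 \<le> K"
    using K hardy_const_pos[OF L, of q C] \<delta> A by (intro order_trans[OF _ less_imp_le[OF K]]) simp
  have "chain_potential E (lip_approx h (Suc j)) (1 / (real (Suc j))\<^sup>2) K x < K" for j
  proof -
    let ?k = "lip_approx h (Suc j)" and ?e = "1 / (real (Suc j))\<^sup>2"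
    interpret test_function \<mu> c\<^sub>D p c\<^sub>P \<tau> "chain_potential E ?k ?e K" ?k ?e K "real (Suc j)"
    proof unfold_locales
      show "continuous_on UNIV ?k" by (rule lip_approx_continuous)
      show "0 \<le> ?k y" for y by (rule lip_approx_nonneg)
      show "?k y \<le> real (Suc j)" for y by (rule lip_approx_le)
      show "0 < ?e" by simp
      show "0 \<le> chain_potential E ?k ?e K y" for y by (rule chain_potential_nonneg[OF lip_approx_nonneg K0])
      show "chain_potential E ?k ?e K y \<le> K" for y by (rule chain_potential_le[OF lip_approx_nonneg K0])
      show "\<bar>chain_potential E ?k ?e K y - chain_potential E ?k ?e K z\<bar> \<le> max (?k y) (?k z) * dist y z"
        if "dist y z \<le> ?e" for y z
        by (rule chain_potential_step[OF lip_approx_nonneg K0 that])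
    qed
    have "chain_potential E ?k ?e K x \<le> hardy_const L q C * \<delta> * A"
    proof (rule main_estimate[OF L q C \<delta> A E(1) _ content])
      show "chain_potential E ?k ?e K w = 0" if "w \<in> E" for w
        by (rule chain_potential_zero[OF lip_approx_nonneg K0 that])
      show "energy x s \<le> A powr p" if "0 < s" "s \<le> dilatation L * \<delta>" for s
      proof -
        have "mean \<mu> (ball x s) (\<lambda>y. ennpowr (ennreal (?k y)) p) \<le> mean \<mu> (ball x s) H"
          by (intro mean_mono ennpowr_le_of_le_inverse[OF p0]) (use lip_approx_le(1)[of h "Suc j"] in \<open>simp add: h_def\<close>)
        also have "\<dots> \<le> ennreal (A powr p)" by (rule en[OF that])
        finally show ?thesis unfolding energy_def by (intro enn2real_leI) auto
      qed
    qed
    then show ?thesis using K by simp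
  qed
  then show thesis
    using exists_curve_integral_le[OF compact_cball lsc \<eta>' h\<eta> E order_refl K0] that
    unfolding h_def by blast
qed

text \<open>The integrand must be large on exceptional curves as well. As their modulus is zero,
  some \<open>\<rho>\<close> with integral at least 1 on each of them has so little energy that even
  \<open>n * \<rho>\<close> can be absorbed into \<open>H\<close>. On these curves the integral is
  then at least \<open>n\<close>, whence the truncation of \<open>u\<close> at
  \<open>n\<close>.\<close>

lemma exists_lsc_majorant:
  assumes g: "weak_upper_gradient \<mu> p u g" and n: "0 < n"
  obtains H F where "\<And>c. open {x. c < H x}" "\<And>x. ennreal (1 / real n) \<le> H x"
    "F \<in> borel_measurable M" "(\<integral>\<^sup>+x. F x \<partial>M) \<le> ennreal ((1 / 4) ^ n)"
    "\<And>x. H x \<le> ennreal (1 / real n) + 2 * ennpowr (g x) p + F x"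
    "\<And>K \<gamma>. (0, K, \<gamma>) \<in> curves \<Longrightarrow> u (\<gamma> K) = 0 \<Longrightarrow>
      min (e2ennreal \<bar>u (\<gamma> 0)\<bar>) (of_nat n) \<le> curve_integral (\<lambda>y. ennpowr (H y) (1 / p)) (0, K, \<gamma>)"
proof -
  have p0: "0 < p" using p by simp
  have gm: "g \<in> borel_measurable M" using g by (simp add: weak_upper_gradient_def)
  obtain \<Gamma> where \<Gamma>: "modulus \<mu> p \<Gamma> = 0" "\<And>a b \<gamma>. (a, b, \<gamma>) \<in> curves - \<Gamma> \<Longrightarrow>
      if \<bar>u (\<gamma> a)\<bar> \<noteq> \<infinity> \<and> \<bar>u (\<gamma> b)\<bar> \<noteq> \<infinity>
      then \<bar>u (\<gamma> a) - u (\<gamma> b)\<bar> \<le> enn2ereal (curve_integral g (a, b, \<gamma>))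
      else curve_integral g (a, b, \<gamma>) = top"
    using g unfolding weak_upper_gradient_def by blast
  \<comment> \<open>The budget: \<open>2 * \<sigma>\<close> and \<open>f\<close> contribute at most
    \<open>e\<close> each, and \<open>2 * e = (1 / 4) ^ n\<close>. The factor \<open>np\<close>
    compensates for multiplying \<open>\<rho>\<close> by \<open>n\<close> before taking the
    \<open>p\<close>-th power.\<close>
  define e :: real where "e = (1 / 4) ^ n / 2"
  have e: "0 < e" by (simp add: e_def)
  define np where "np = real n powr p"
  have np: "0 < np" using n by (simp add: np_def)
  have "modulus \<mu> p \<Gamma> < ennreal (e / (2 * np))" using \<Gamma>(1) e np by simp
  then obtain \<rho> where \<rho>: "\<rho> \<in> borel_measurable borel" "\<And>c. c \<in> \<Gamma> \<Longrightarrow> 1 \<le> curve_integral \<rho> c"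
    "(\<integral>\<^sup>+x. ennpowr (\<rho> x) p \<partial>M) < ennreal (e / (2 * np))"
    unfolding modulus_def INF_less_iff by blast
  define \<sigma> where "\<sigma> x = ennreal np * ennpowr (\<rho> x) p" for x
  have \<sigma>: "\<sigma> x = ennpowr (of_nat n * \<rho> x) p" for x
  proof (cases "\<rho> x")
    case (real r)
    then show ?thesis
      by (simp add: \<sigma>_def np_def ennreal_of_nat_eq_real_of_nat powr_mult flip: ennreal_mult)
  next
    case top
    then show ?thesis using np n by (simp add: \<sigma>_def ennpowr_def ennreal_mult_top)
  qed
  have \<rho>m: "\<rho> \<in> borel_measurable M" by (rule borel_measurable_M[OF \<rho>(1)])
  note [measurable] = gm \<rho>m
  have gp: "(\<lambda>x. ennpowr (g x) p) \<in> borel_measurable M" by measurable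
  have \<rho>p: "(\<lambda>x. ennpowr (\<rho> x) p) \<in> borel_measurable M" by measurable
  have \<sigma>m: "\<sigma> \<in> borel_measurable M" unfolding \<sigma>_def using \<rho>p by measurable
  have \<sigma>i: "(\<integral>\<^sup>+x. \<sigma> x \<partial>M) \<le> ennreal (e / 2)"
  proof -
    have "(\<integral>\<^sup>+x. \<sigma> x \<partial>M) = ennreal np * (\<integral>\<^sup>+x. ennpowr (\<rho> x) p \<partial>M)"
      unfolding \<sigma>_def by (rule nn_integral_cmult[OF \<rho>p])
    also have "\<dots> \<le> ennreal np * ennreal (e / (2 * np))"
      using \<rho>(3) by (intro mult_left_mono) auto
    also have "\<dots> = ennreal (e / 2)" using np e by (simp flip: ennreal_mult)
    finally show ?thesis .
  qed
  have Gm: "(\<lambda>x. max (ennpowr (g x) p) (\<sigma> x)) \<in> borel_measurable M" using gp \<sigma>m by measurable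
  have n1: "0 < 1 / real n" using n by simp
  obtain H f where H: "\<And>c. open {x. c < H x}" "f \<in> borel_measurable M" "(\<integral>\<^sup>+x. f x \<partial>M) \<le> ennreal e"
    "\<And>x. max (ennpowr (g x) p) (\<sigma> x) \<le> H x" "\<And>x. ennreal (1 / real n) \<le> H x"
    "\<And>x. H x \<le> ennreal (1 / real n) + 2 * max (ennpowr (g x) p) (\<sigma> x) + f x"
    using Vitali_Caratheodory[OF Gm n1 e] by blast
  define F where "F x = 2 * \<sigma> x + f x" for x
  show thesis
  proof
    show "open {x. c < H x}" for c by (rule H)
    show "ennreal (1 / real n) \<le> H x" for x by (rule H)
    show "F \<in> borel_measurable M" unfolding F_def using \<sigma>m H(2) by measurable
    have "(\<integral>\<^sup>+x. F x \<partial>M) = 2 * (\<integral>\<^sup>+x. \<sigma> x \<partial>M) + (\<integral>\<^sup>+x. f x \<partial>M)"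
      unfolding F_def using \<sigma>m H(2) by (simp add: nn_integral_add nn_integral_cmult)
    also have "\<dots> \<le> 2 * ennreal (e / 2) + ennreal e"
      by (intro add_mono mult_left_mono \<sigma>i H(3)) simp
    also have "\<dots> = ennreal ((1 / 4) ^ n)"
      using e by (simp add: e_def flip: ennreal_plus ennreal_mult ennreal_numeral)
    finally show "(\<integral>\<^sup>+x. F x \<partial>M) \<le> ennreal ((1 / 4) ^ n)" .
    show "H x \<le> ennreal (1 / real n) + 2 * ennpowr (g x) p + F x" for x
    proof -
      have "max (ennpowr (g x) p) (\<sigma> x) \<le> ennpowr (g x) p + \<sigma> x" by (simp add: add_increasing add_increasing2)
      then have "ennreal (1 / real n) + 2 * max (ennpowr (g x) p) (\<sigma> x) + f x
          \<le> ennreal (1 / real n) + 2 * (ennpowr (g x) p + \<sigma> x) + f x"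
        by (intro add_mono mult_left_mono) auto
      also have "\<dots> = ennreal (1 / real n) + 2 * ennpowr (g x) p + F x"
        by (simp add: F_def distrib_left add.assoc)
      finally show ?thesis by (rule order_trans[OF H(6)])
    qed
    let ?h = "\<lambda>y. ennpowr (H y) (1 / p)"
    have gh: "g y \<le> ?h y" for y
      using H(4)[of y] by (intro le_ennpowr_inverse[OF p0]) simp
    have \<rho>h: "of_nat n * \<rho> y \<le> ?h y" for y
      using H(4)[of y] by (intro le_ennpowr_inverse[OF p0]) (simp add: \<sigma>)
    have mono: "curve_integral f1 c \<le> curve_integral f2 c" if "\<And>y. f1 y \<le> f2 y" for f1 f2 :: "'a \<Rightarrow> ennreal" and c
      unfolding curve_integral_def using that by (auto intro!: nn_integral_mono mult_right_mono split: prod.split)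
    show "min (e2ennreal \<bar>u (\<gamma> 0)\<bar>) (of_nat n) \<le> curve_integral ?h (0, K, \<gamma>)"
      if c: "(0, K, \<gamma>) \<in> curves" and u: "u (\<gamma> K) = 0" for K \<gamma>
    proof (cases "(0, K, \<gamma>) \<in> \<Gamma>")
      case True
      interpret rectifiable 0 K \<gamma> using c by unfold_locales (auto simp: curves_def)
      have "of_nat n \<le> of_nat n * curve_integral \<rho> (0, K, \<gamma>)"
        using mult_left_mono[OF \<rho>(2)[OF True], of "of_nat n"] by simp
      also have "\<dots> = curve_integral (\<lambda>y. of_nat n * \<rho> y) (0, K, \<gamma>)"
        by (rule curve_integral_cmult[OF \<rho>(1), symmetric])
      also have "\<dots> \<le> curve_integral ?h (0, K, \<gamma>)" by (rule mono[OF \<rho>h])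
      finally show ?thesis by (simp add: min.coboundedI2)
    next
      case False
      have "e2ennreal \<bar>u (\<gamma> 0)\<bar> \<le> curve_integral g (0, K, \<gamma>)"
      proof (cases "\<bar>u (\<gamma> 0)\<bar> = \<infinity>")
        case True
        then show ?thesis using \<Gamma>(2)[of 0 K \<gamma>] c False u by simp
      next
        case fin: False
        then have "\<bar>u (\<gamma> 0)\<bar> \<le> enn2ereal (curve_integral g (0, K, \<gamma>))"
          using \<Gamma>(2)[of 0 K \<gamma>] c False u by simp
        then show ?thesis using e2ennreal_mono by fastforce
      qed
      also have "\<dots> \<le> curve_integral ?h (0, K, \<gamma>)" by (rule mono[OF gh])
      finally show ?thesis by (simp add: min.coboundedI1)
    qed
  qed
qed

text \<open>Each \<open>n\<close> has its own majorant and its own short curve; letting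
  \<open>n\<close> tend to infinity removes the positive floor, the error and the truncation
  together.\<close>

lemma pointwise_hardy:
  assumes \<Omega>: "open \<Omega>" "\<Omega> \<subset> UNIV" and L: "1 \<le> L" and q: "1 \<le> q" "q < p" and C: "0 < C"
    and content: "\<And>x. x \<in> \<Omega> \<Longrightarrow>
      ennreal (C * boundary_dist \<Omega> x powr (- q)) * \<mu> (cball x (boundary_dist \<Omega> x))
        \<le> hausdorff_content \<mu> q (boundary_dist \<Omega> x) (frontier \<Omega> \<inter> cball x (2 * L * boundary_dist \<Omega> x))"
    and u: "\<And>x. x \<notin> \<Omega> \<Longrightarrow> u x = 0" and g: "weak_upper_gradient \<mu> p u g"
  shows "AE x in M. x \<in> \<Omega> \<longrightarrow> e2ennreal \<bar>u x\<bar> \<le>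
    ennreal (hardy_const L q C * 2 powr (1 / p) * boundary_dist \<Omega> x) *
      ennpowr (maximal_function \<mu> (dilatation L * boundary_dist \<Omega> x) (\<lambda>y. ennpowr (g y) p) x) (1 / p)"
proof -
  define c where "c = hardy_const L q C"
  have c: "0 < c" unfolding c_def by (rule hardy_const_pos[OF L])
  have p0: "0 < p" using p by simp
  have gm: "g \<in> borel_measurable M" using g by (simp add: weak_upper_gradient_def)
  note [measurable] = gm
  have gp: "(\<lambda>x. ennpowr (g x) p) \<in> borel_measurable M" by measurable
  have fr: "frontier \<Omega> \<inter> \<Omega> = {}" using \<Omega>(1) by (simp add: frontier_def interior_open Diff_Int_distrib2)
  have "\<forall>n. \<exists>H F. 0 < n \<longrightarrow> (\<forall>c. open {x. c < H x}) \<and> (\<forall>x. ennreal (1 / real n) \<le> H x) \<and>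
    F \<in> borel_measurable M \<and> (\<integral>\<^sup>+x. F x \<partial>M) \<le> ennreal ((1 / 4) ^ n) \<and>
    (\<forall>x. H x \<le> ennreal (1 / real n) + 2 * ennpowr (g x) p + F x) \<and>
    (\<forall>K \<gamma>. (0, K, \<gamma>) \<in> curves \<longrightarrow> u (\<gamma> K) = 0 \<longrightarrow>
      min (e2ennreal \<bar>u (\<gamma> 0)\<bar>) (of_nat n) \<le> curve_integral (\<lambda>y. ennpowr (H y) (1 / p)) (0, K, \<gamma>))"
    (is "\<forall>n. \<exists>H F. 0 < n \<longrightarrow> ?P n H F")
  proof
    fix n
    show "\<exists>H F. 0 < n \<longrightarrow> ?P n H F"
    proof (cases "0 < n")
      case True
      obtain H F where "\<And>c. open {x. c < H x}" "\<And>x. ennreal (1 / real n) \<le> H x"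
        "F \<in> borel_measurable M" "(\<integral>\<^sup>+x. F x \<partial>M) \<le> ennreal ((1 / 4) ^ n)"
        "\<And>x. H x \<le> ennreal (1 / real n) + 2 * ennpowr (g x) p + F x"
        "\<And>K \<gamma>. (0, K, \<gamma>) \<in> curves \<Longrightarrow> u (\<gamma> K) = 0 \<Longrightarrow>
          min (e2ennreal \<bar>u (\<gamma> 0)\<bar>) (of_nat n) \<le> curve_integral (\<lambda>y. ennpowr (H y) (1 / p)) (0, K, \<gamma>)"
        using exists_lsc_majorant[OF g True] by blast
      then have "?P n H F" by blast
      then show ?thesis by blast
    qed simp
  qed
  from choice[OF this] obtain H where "\<forall>n. \<exists>F. 0 < n \<longrightarrow> ?P n (H n) F" by blast
  from choice[OF this] obtain F where HF': "\<forall>n. 0 < n \<longrightarrow> ?P n (H n) (F n)" by blast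
  have HF:
    "\<And>n c. 0 < n \<Longrightarrow> open {x. c < H n x}" "\<And>n x. 0 < n \<Longrightarrow> ennreal (1 / real n) \<le> H n x"
    "\<And>n. 0 < n \<Longrightarrow> F n \<in> borel_measurable M" "\<And>n. 0 < n \<Longrightarrow> (\<integral>\<^sup>+x. F n x \<partial>M) \<le> ennreal ((1 / 4) ^ n)"
    "\<And>n x. 0 < n \<Longrightarrow> H n x \<le> ennreal (1 / real n) + 2 * ennpowr (g x) p + F n x"
    "\<And>n K \<gamma>. 0 < n \<Longrightarrow> (0, K, \<gamma>) \<in> curves \<Longrightarrow> u (\<gamma> K) = 0 \<Longrightarrow>
      min (e2ennreal \<bar>u (\<gamma> 0)\<bar>) (of_nat n) \<le> curve_integral (\<lambda>y. ennpowr (H n y) (1 / p)) (0, K, \<gamma>)"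
    using HF' by blast+
  \<comment> \<open>One function controls all errors: it is integrable because
    \<open>2 ^ n * (1 / 4) ^ n\<close> is summable, and \<open>2 ^ n * F n \<le> F'\<close> for
    positive \<open>n\<close>. Where its maximal function is finite, the means of \<open>F n\<close>
    tend to 0 uniformly in the radius, so one null set serves all \<open>n\<close>.\<close>
  define F' where "F' x = (\<Sum>n. ennreal (2 ^ Suc n) * F (Suc n) x)" for x
  have F'm: "F' \<in> borel_measurable M"
    unfolding F'_def using HF(3) by (intro borel_measurable_suminf_order borel_measurable_times_ennreal) auto
  have "(\<integral>\<^sup>+x. F' x \<partial>M) = (\<Sum>n. ennreal (2 ^ Suc n) * (\<integral>\<^sup>+x. F (Suc n) x \<partial>M))"
    unfolding F'_def using HF(3)
    by (subst nn_integral_suminf) (auto simp: nn_integral_cmult intro!: borel_measurable_times_ennreal)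
  also have "\<dots> \<le> (\<Sum>n. ennreal ((1 / 2) ^ Suc n))"
  proof (rule suminf_le)
    fix n
    have "ennreal (2 ^ Suc n) * (\<integral>\<^sup>+x. F (Suc n) x \<partial>M) \<le> ennreal (2 ^ Suc n) * ennreal ((1 / 4) ^ Suc n)"
      by (intro mult_left_mono HF(4)) auto
    also have "\<dots> = ennreal ((1 / 2) ^ Suc n)"
      by (simp add: power_mult_distrib[symmetric] del: power_Suc flip: ennreal_mult)
    finally show "ennreal (2 ^ Suc n) * (\<integral>\<^sup>+x. F (Suc n) x \<partial>M) \<le> ennreal ((1 / 2) ^ Suc n)" .
  qed auto
  also have "\<dots> = ennreal 1" by (intro suminf_ennreal_eq power_half_series) simp
  finally have "(\<integral>\<^sup>+x. F' x \<partial>M) < top" by (rule order.strict_trans1) simp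
  from AE_maximal_finite[OF F'm this] show ?thesis
  proof (rule AE_mp, intro AE_I2 impI)
    fix x assume x: "x \<in> \<Omega>" and "\<exists>b<top. \<forall>r>0. mean \<mu> (ball x r) F' \<le> b"
    then obtain b where b: "0 \<le> b" "\<And>r. 0 < r \<Longrightarrow> mean \<mu> (ball x r) F' \<le> ennreal b"
      by (metis ennreal_cases top.not_eq_extremum)
    define \<delta> where "\<delta> = boundary_dist \<Omega> x"
    \<comment> \<open>The distance to an empty frontier would be 0 by convention; connectedness
      excludes this.\<close>
    have "frontier \<Omega> \<noteq> {}"
    proof
      assume "frontier \<Omega> = {}"
      then have "closure \<Omega> \<subseteq> \<Omega>" using \<Omega>(1) by (auto simp: frontier_def interior_open)
      then have "closed \<Omega>" by (metis closure_subset closure_closed closed_closure subset_antisym)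
      then show False using clopen_trivial[OF \<Omega>(1) _ x] \<Omega>(2) by blast
    qed
    moreover have xE: "x \<notin> frontier \<Omega>" using fr x by blast
    ultimately have \<delta>: "0 < \<delta>"
      unfolding \<delta>_def boundary_dist_def by (intro infdist_pos_not_in_closed) auto
    define Mg where "Mg = maximal_function \<mu> (dilatation L * \<delta>) (\<lambda>y. ennpowr (g y) p) x"
    have "e2ennreal \<bar>u x\<bar> \<le> ennreal (c * 2 powr (1 / p) * \<delta>) * ennpowr Mg (1 / p)"
    proof (cases Mg)
      case top
      then show ?thesis using c \<delta> by (simp add: ennpowr_def ennreal_mult_top)
    next
      case (real m)
      have Mg: "mean \<mu> (ball x s) (\<lambda>y. ennpowr (g y) p) \<le> ennreal m" if "0 < s" "s \<le> dilatation L * \<delta>" for s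
        unfolding real(2)[symmetric] Mg_def maximal_function_def using that by (intro SUP_upper) auto
      \<comment> \<open>The summands bound the contributions of the floor, of twice \<open>g\<close>
        to the power \<open>p\<close>, and of the error \<open>F n\<close>; only the second one
        survives in the limit.\<close>
      define b' where "b' n = 1 / real n + 2 * m + b / 2 ^ n" for n
      define A where "A n = b' n powr (1 / p)" for n
      have b'0: "0 \<le> b' n" for n using real b by (simp add: b'_def)
      have meanH: "mean \<mu> (ball x s) (H n) \<le> ennreal (A n powr p)"
        if n: "0 < n" and s: "0 < s" "s \<le> dilatation L * \<delta>" for n s
      proof -
        have Fn: "F n \<in> borel_measurable M" by (rule HF(3)[OF n])
        have "ennreal (2 ^ n) * F n y \<le> F' y" for y
        proof -
          define t where "t i = ennreal (2 ^ Suc i) * F (Suc i) y" for i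
          have "sum t {n - 1} \<le> suminf t" by (rule sum_le_suminf) auto
          moreover have "suminf t = F' y" by (simp only: F'_def t_def[abs_def])
          moreover have "t (n - 1) = ennreal (2 ^ n) * F n y" using n by (simp add: t_def del: power_Suc)
          ultimately show ?thesis by simp
        qed
        then have "ennreal (2 ^ n) * mean \<mu> (ball x s) (F n) \<le> ennreal b"
          using b(2)[OF s(1)] by (subst mean_cmult[OF Fn, symmetric]) (rule order_trans[OF mean_mono])
        then have "ennreal (1 / 2 ^ n) * (ennreal (2 ^ n) * mean \<mu> (ball x s) (F n)) \<le> ennreal (1 / 2 ^ n) * ennreal b"
          by (rule mult_left_mono) simp
        then have meanF: "mean \<mu> (ball x s) (F n) \<le> ennreal (b / 2 ^ n)"
          using b(1) by (simp flip: mult.assoc ennreal_mult)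
        have "mean \<mu> (ball x s) (H n) \<le> mean \<mu> (ball x s) (\<lambda>y. (ennreal (1 / real n) + 2 * ennpowr (g y) p) + F n y)"
          by (rule mean_mono[OF HF(5)[OF n]])
        also have "\<dots> = mean \<mu> (ball x s) (\<lambda>y. ennreal (1 / real n) + 2 * ennpowr (g y) p) + mean \<mu> (ball x s) (F n)"
          by (rule mean_add[OF _ Fn]) (use gp in measurable)
        also have "mean \<mu> (ball x s) (\<lambda>y. ennreal (1 / real n) + 2 * ennpowr (g y) p)
            = mean \<mu> (ball x s) (\<lambda>y. ennreal (1 / real n)) + mean \<mu> (ball x s) (\<lambda>y. 2 * ennpowr (g y) p)"
          by (rule mean_add) (use gp in measurable)
        also have "\<dots> = ennreal (1 / real n) + 2 * mean \<mu> (ball x s) (\<lambda>y. ennpowr (g y) p)"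
          by (simp only: mean_const[OF s(1)] mean_cmult[OF gp])
        also have "\<dots> + mean \<mu> (ball x s) (F n) \<le> ennreal (1 / real n) + 2 * ennreal m + ennreal (b / 2 ^ n)"
          by (intro add_mono mult_left_mono order_refl Mg[OF s] meanF) simp
        also have "\<dots> = ennreal (b' n)"
          using real b by (simp add: b'_def flip: ennreal_plus ennreal_mult ennreal_numeral)
        also have "b' n = A n powr p" using b'0[of n] p0 by (simp add: A_def powr_powr)
        finally show ?thesis .
      qed
      have main: "min (e2ennreal \<bar>u x\<bar>) (of_nat n) \<le> ennreal K" if n: "0 < n" and K: "c * \<delta> * A n < K" for n K
      proof -
        have n1: "0 < 1 / real n" "1 / real n \<le> 1" using n by auto
        have "0 \<le> A n" by (simp add: A_def)
        from exists_short_curve[OF L q C \<delta> this frontier_closed xE content[OF x, folded \<delta>_def]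
            HF(1)[OF n] n1 HF(2)[OF n] meanH[OF n] K[unfolded c_def]]
        obtain \<gamma> where \<gamma>: "(0, K, \<gamma>) \<in> curves" "\<gamma> 0 = x" "\<gamma> K \<in> frontier \<Omega>"
          "curve_integral (\<lambda>y. ennpowr (H n y) (1 / p)) (0, K, \<gamma>) \<le> ennreal K" by blast
        have "u (\<gamma> K) = 0" using \<gamma>(3) fr by (intro u) blast
        from HF(6)[OF n \<gamma>(1) this] show ?thesis using \<gamma>(2,4) by simp
      qed
      define U where "U = c * \<delta> * (2 * m) powr (1 / p)"
      have "b' \<longlonglongrightarrow> 0 + 2 * m + 0"
        unfolding b'_def
        by (intro tendsto_add tendsto_const lim_1_over_n LIMSEQ_divide_realpow_zero) simp
      then have "A \<longlonglongrightarrow> (2 * m) powr (1 / p)"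
        unfolding A_def using b'0 p0 by (intro tendsto_powr') auto
      then have lim: "(\<lambda>n. c * \<delta> * A n) \<longlonglongrightarrow> U"
        unfolding U_def by (intro tendsto_intros)
      have U0: "0 \<le> U" using c \<delta> by (simp add: U_def)
      have "e2ennreal \<bar>u x\<bar> \<le> ennreal U"
      proof (rule ccontr)
        assume "\<not> ?thesis"
        \<comment> \<open>A bound by \<open>d\<close> for \<open>u\<close> truncated at
          \<open>n\<close> is a bound for \<open>u\<close> itself once \<open>n\<close> exceeds
          \<open>d\<close>, so \<open>d\<close> contradicts \<open>main\<close> for large
          \<open>n\<close>.\<close>
        then obtain d where d: "ennreal U < d" "d < e2ennreal \<bar>u x\<bar>" using dense by (metis not_le)
        then have "d < top" by (meson order.strict_trans2 top_greatest)
        then obtain d' where d': "d = ennreal d'" "0 \<le> d'" by (cases d) auto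
        then have "U < d'" using d U0 by (simp add: ennreal_less_iff)
        from order_tendstoD(2)[OF lim this] eventually_gt_at_top[of "nat \<lceil>d'\<rceil>"]
        have "eventually (\<lambda>n. c * \<delta> * A n < d' \<and> nat \<lceil>d'\<rceil> < n) sequentially" by eventually_elim simp
        then obtain n where n: "c * \<delta> * A n < d'" "nat \<lceil>d'\<rceil> < n" by (auto simp: eventually_sequentially)
        have "min (e2ennreal \<bar>u x\<bar>) (of_nat n) \<le> d" using main[OF _ n(1)] n(2) d' by simp
        moreover have "d < of_nat n"
        proof -
          have "d' < real n" using n(2) by linarith
          then show ?thesis using d' by (simp add: ennreal_of_nat_eq_real_of_nat ennreal_less_iff)
        qed
        ultimately show False using d(2) by (meson leD min_less_iff_conj)
      qed
      also have "ennreal U = ennreal (c * 2 powr (1 / p) * \<delta>) * ennpowr Mg (1 / p)"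
        using real c \<delta> by (simp add: U_def powr_mult ac_simps flip: ennreal_mult)
      finally show ?thesis .
    qed
    then show "e2ennreal \<bar>u x\<bar> \<le> ennreal (hardy_const L q C * 2 powr (1 / p) * boundary_dist \<Omega> x) *
      ennpowr (maximal_function \<mu> (dilatation L * boundary_dist \<Omega> x) (\<lambda>y. ennpowr (g y) p) x) (1 / p)"
      by (simp add: Mg_def c_def \<delta>_def)
  qed
qed

end

theorem theorem6p2:
  fixes \<mu> :: "'a::complete_space set \<Rightarrow> ennreal"
    and \<Omega> :: "'a set"
    and p q C L :: real
  assumes "1 < p"
    and "borel_regular_outer_measure \<mu>"
    and "balls_positive_finite \<mu>"
    and "doubling \<mu>"
    and "poincare \<mu> p"
    and "open \<Omega>" and "\<Omega> \<subset> UNIV"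
    and "1 \<le> q" and "q < p"
    and "0 < C" and "1 \<le> L"
    and "\<And>x. x \<in> \<Omega> \<Longrightarrow>
      hausdorff_content \<mu> q (boundary_dist \<Omega> x)
          (frontier \<Omega> \<inter> cball x (2 * L * boundary_dist \<Omega> x))
        \<ge> ennreal (C * boundary_dist \<Omega> x powr (- q)) * \<mu> (cball x (boundary_dist \<Omega> x))"
  shows "\<exists>c\<^sub>H L'::real. 0 < c\<^sub>H \<and> 1 \<le> L' \<and>
    (\<forall>u\<in>newtonian_zero \<mu> p \<Omega>. \<forall>g. weak_upper_gradient \<mu> p u g \<longrightarrow>
      (AE x in carath \<mu>. x \<in> \<Omega> \<longrightarrow>
        e2ennreal \<bar>u x\<bar> \<le> ennreal (c\<^sub>H * boundary_dist \<Omega> x) *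
          ennpowr (maximal_function \<mu> (L' * boundary_dist \<Omega> x) (\<lambda>y. ennpowr (g y) p) x) (1 / p)))"
proof -
  obtain c\<^sub>D :: real where D: "1 \<le> c\<^sub>D" "\<And>x r. 0 < r \<Longrightarrow> \<mu> (ball x (2 * r)) \<le> ennreal c\<^sub>D * \<mu> (ball x r)"
    using assms(4) unfolding doubling_def by blast
  obtain c\<^sub>P \<tau> :: real where P: "0 < c\<^sub>P" "1 \<le> \<tau>"
    "\<And>x r u g. 0 < r \<Longrightarrow> locally_integrable \<mu> u \<Longrightarrow> weak_upper_gradient \<mu> p u g \<Longrightarrow>
      mean \<mu> (ball x r) (\<lambda>y. e2ennreal \<bar>u y - ereal (average \<mu> (ball x r) u)\<bar>)
        \<le> ennreal (c\<^sub>P * r) * ennpowr (mean \<mu> (ball x (\<tau> * r)) (\<lambda>y. ennpowr (g y) p)) (1 / p)"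
    using assms(5) unfolding poincare_def by blast
  interpret poincare_space \<mu> c\<^sub>D p c\<^sub>P \<tau>
    by unfold_locales (use assms(1-3) D P in auto)
  show ?thesis
  proof (intro exI conjI ballI allI impI)
    show "0 < hardy_const L q C * 2 powr (1 / p)" using hardy_const_pos[OF assms(11)] by simp
    show "1 \<le> dilatation L"
      using mult_mono[of 1 \<tau> 1 "2 * L + 1"] P(2) assms(11) by (simp add: dilatation_def)
    fix u g assume "u \<in> newtonian_zero \<mu> p \<Omega>" and g: "weak_upper_gradient \<mu> p u g"
    then have "\<And>x. x \<notin> \<Omega> \<Longrightarrow> u x = 0" by (simp add: newtonian_zero_def)
    from pointwise_hardy[OF assms(6,7,11,8,9,10,12) this g]
    show "AE x in carath \<mu>. x \<in> \<Omega> \<longrightarrow> e2ennreal \<bar>u x\<bar> \<le>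
      ennreal (hardy_const L q C * 2 powr (1 / p) * boundary_dist \<Omega> x) *
        ennpowr (maximal_function \<mu> (dilatation L * boundary_dist \<Omega> x) (\<lambda>y. ennpowr (g y) p) x) (1 / p)" .
  qed
qed

end
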